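(* Let $q$ be an odd prime power. In $\mathrm{PG}(3,q^2)$, let $\mathcal H$ be a non-degenerate Hermitian surface and $\mathcal Q$ an irreducible quadric such that there is a point $P\in\mathcal H\cap\mathcal Q$ which is a nonsingular point of $\mathcal Q$ and at which $\mathcal H$ and $\mathcal Q$ have the same tangent plane $\pi$. Then the possible intersection sizes $|\mathcal H\cap\mathcal Q|$ in $\mathrm{PG}(3,q^2)$ are as follows. \begin{itemize} \item For $\mathcal Q$ elliptic: $q^3-q^2+1,\ q^3-q^2+q+1,\ q^3-q+1,\ q^3+1,\ q^3+q+1,\ q^3+q^2-q+1,\ q^3+q^2+1$. \item For $\mathcal Q$ a $1$-degenerate cone and $q>3$: $q^3-q^2+1,\ q^3-q^2+q+1,\ q^3-q+1,\ q^3+1,\ q^3+q+1,\ q^3+q^2-q+1,\ q^3+q^2+1,\ q^3+2q^2-q+1$. \item For $\mathcal Q$ hyperbolic: $q^2+1,\ q^3-q^2+1,\ q^3-q^2+q+1,\ q^3-q+1,\ q^3+1,\ q^3+q+1,\ q^3+q^2-q+1,\ q^3+q^2+1,\ q^3+2q^2-q+1,\ q^3+2q^2+1,\ q^3+3q^2-q+1,\ 2q^3+q^2+1$. \end{itemize}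
   Context: A $1$-degenerate cone is a quadric of $\mathrm{PG}(3,q^2)$ which is a cone with a point vertex over a non-degenerate conic. Elliptic and hyperbolic quadrics are the non-singular quadrics of $\mathrm{PG}(3,q^2)$ containing no lines, respectively containing lines (two reguli).
   Formalization: The lists are read as exactly the sizes that occur; for hyperbolic quadrics with q = 3 the size q^3−q^2+1 = 19 does not occur, so for q = 3 its occurrence is not claimed (all sizes still lie in the list). *)

theory Defs
  imports "HOL-Analysis.Determinants" "HOL-Number_Theory.Prime_Powers"
begin

section \<open>Projective 3-space over a field\<close>

text \<open>A projective subspace is represented by the underlying linear subspace of the coordinate
  space \<open>'k ^ 4\<close>; incidence is inclusion.\<close>

definition pg_points :: "('k::field ^ 4) set set" where
  "pg_points = {P. vec.subspace P \<and> vec.dim P = 1}"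

definition pg_lines :: "('k::field ^ 4) set set" where
  "pg_lines = {l. vec.subspace l \<and> vec.dim l = 2}"

definition pg_planes :: "('k::field ^ 4) set set" where
  "pg_planes = {\<pi>. vec.subspace \<pi> \<and> vec.dim \<pi> = 3}"


section \<open>Quadrics\<close>

text \<open>In odd characteristic every quadratic form is \<open>x \<mapsto> bil A x x\<close> for exactly one symmetric
  matrix \<open>A\<close>, so a quadric is given by a nonzero symmetric matrix.\<close>

definition bil :: "'k::field ^ 4 ^ 4 \<Rightarrow> 'k ^ 4 \<Rightarrow> 'k ^ 4 \<Rightarrow> 'k" where
  "bil A u v = (\<Sum>i\<in>UNIV. \<Sum>j\<in>UNIV. u $ i * A $ i $ j * v $ j)"

definition quadric_matrix :: "'k::field ^ 4 ^ 4 \<Rightarrow> bool" where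
  "quadric_matrix A \<longleftrightarrow> transpose A = A \<and> A \<noteq> 0"

definition quadric :: "'k::field ^ 4 ^ 4 \<Rightarrow> ('k ^ 4) set set" where
  "quadric A = {P \<in> pg_points. \<forall>v\<in>P. bil A v v = 0}"

text \<open>The quadratic form is not a product of two linear forms. Over a field with at least three
  elements, equality of quadratic forms as functions and as polynomials coincide. A quadric that
  splits into two planes only over a quadratic extension has no nonsingular rational point, so for
  the quadrics in \<open>tangent_pair\<close> below this is the same as absolute irreducibility.\<close>

definition irreducible_quadric :: "'k::field ^ 4 ^ 4 \<Rightarrow> bool" where
  "irreducible_quadric A \<longleftrightarrow> quadric_matrix A \<and>
     \<not> (\<exists>a b :: 'k ^ 4. \<forall>x. bil A x x = (\<Sum>i\<in>UNIV. a $ i * x $ i) * (\<Sum>i\<in>UNIV. b $ i * x $ i))"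

text \<open>The gradient of the form at \<open>v\<close> is \<open>2 * (A *v v)\<close>.\<close>

definition nonsingular_point :: "'k::field ^ 4 ^ 4 \<Rightarrow> ('k ^ 4) set \<Rightarrow> bool" where
  "nonsingular_point A P \<longleftrightarrow> P \<in> quadric A \<and> (\<exists>v\<in>P. A *v v \<noteq> 0)"

definition quadric_tangent :: "'k::field ^ 4 ^ 4 \<Rightarrow> ('k ^ 4) set \<Rightarrow> ('k ^ 4) set" where
  "quadric_tangent A P = {x. \<forall>v\<in>P. bil A v x = 0}"

definition nonsingular_quadric :: "'k::field ^ 4 ^ 4 \<Rightarrow> bool" where
  "nonsingular_quadric A \<longleftrightarrow> quadric_matrix A \<and> (\<forall>P\<in>quadric A. nonsingular_point A P)"

definition contained_in_quadric :: "('k::field ^ 4) set \<Rightarrow> 'k ^ 4 ^ 4 \<Rightarrow> bool" where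
  "contained_in_quadric W A \<longleftrightarrow> (\<forall>P\<in>pg_points. P \<subseteq> W \<longrightarrow> P \<in> quadric A)"

definition elliptic_quadric :: "'k::field ^ 4 ^ 4 \<Rightarrow> bool" where
  "elliptic_quadric A \<longleftrightarrow> nonsingular_quadric A \<and> \<not> (\<exists>l\<in>pg_lines. contained_in_quadric l A)"

definition hyperbolic_quadric :: "'k::field ^ 4 ^ 4 \<Rightarrow> bool" where
  "hyperbolic_quadric A \<longleftrightarrow> nonsingular_quadric A \<and> (\<exists>l\<in>pg_lines. contained_in_quadric l A)"

text \<open>The section of the quadric by the plane \<open>\<sigma>\<close> is a non-degenerate conic of \<open>\<sigma>\<close>: the form
  restricted to \<open>\<sigma>\<close> has trivial radical.\<close>

definition nondegenerate_conic_section :: "'k::field ^ 4 ^ 4 \<Rightarrow> ('k ^ 4) set \<Rightarrow> bool" where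
  "nondegenerate_conic_section A \<sigma> \<longleftrightarrow> \<sigma> \<in> pg_planes \<and>
     (\<forall>u\<in>\<sigma>. (\<forall>w\<in>\<sigma>. bil A u w = 0) \<longrightarrow> u = 0)"

text \<open>Union of the lines joining the vertex \<open>V\<close> to the points of a non-degenerate conic in a
  plane not through \<open>V\<close>.\<close>

definition one_degenerate_cone :: "'k::field ^ 4 ^ 4 \<Rightarrow> bool" where
  "one_degenerate_cone A \<longleftrightarrow> quadric_matrix A \<and>
     (\<exists>V\<in>pg_points. \<exists>\<sigma>\<in>pg_planes. \<not> V \<subseteq> \<sigma> \<and> nondegenerate_conic_section A \<sigma> \<and>
        quadric A = {P \<in> pg_points. \<exists>R\<in>quadric A. R \<subseteq> \<sigma> \<and> P \<subseteq> vec.span (V \<union> R)})"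


section \<open>Hermitian surfaces\<close>

text \<open>In a field with \<open>q\<^sup>2\<close> elements, \<open>x \<mapsto> x ^ q\<close> is the involutory automorphism.\<close>

definition herm :: "nat \<Rightarrow> 'k::field ^ 4 ^ 4 \<Rightarrow> 'k ^ 4 \<Rightarrow> 'k ^ 4 \<Rightarrow> 'k" where
  "herm q H u v = (\<Sum>i\<in>UNIV. \<Sum>j\<in>UNIV. u $ i * H $ i $ j * (v $ j) ^ q)"

definition nondegenerate_hermitian_matrix :: "nat \<Rightarrow> 'k::field ^ 4 ^ 4 \<Rightarrow> bool" where
  "nondegenerate_hermitian_matrix q H \<longleftrightarrow> (\<forall>i j. H $ j $ i = (H $ i $ j) ^ q) \<and> det H \<noteq> 0"

definition hermitian_surface :: "nat \<Rightarrow> 'k::field ^ 4 ^ 4 \<Rightarrow> ('k ^ 4) set set" where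
  "hermitian_surface q H = {P \<in> pg_points. \<forall>v\<in>P. herm q H v v = 0}"

text \<open>The partial derivative of \<open>\<Sum>i j. X\<^sub>i H\<^sub>i\<^sub>j X\<^sub>j ^ q\<close> with respect to \<open>X\<^sub>i\<close> is
  \<open>\<Sum>j. H\<^sub>i\<^sub>j X\<^sub>j ^ q\<close>.\<close>

definition hermitian_tangent :: "nat \<Rightarrow> 'k::field ^ 4 ^ 4 \<Rightarrow> ('k ^ 4) set \<Rightarrow> ('k ^ 4) set" where
  "hermitian_tangent q H P = {x. \<forall>v\<in>P. herm q H x v = 0}"


section \<open>Pairs with a common tangent plane\<close>

definition tangent_pair :: "nat \<Rightarrow> 'k::field ^ 4 ^ 4 \<Rightarrow> 'k ^ 4 ^ 4 \<Rightarrow> bool" where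
  "tangent_pair q H A \<longleftrightarrow> nondegenerate_hermitian_matrix q H \<and> irreducible_quadric A \<and>
     (\<exists>P \<in> hermitian_surface q H \<inter> quadric A.
        nonsingular_point A P \<and> hermitian_tangent q H P = quadric_tangent A P)"

definition intersection_sizes :: "nat \<Rightarrow> ('k::field ^ 4 ^ 4 \<Rightarrow> bool) \<Rightarrow> nat set" where
  "intersection_sizes q T =
     {card (hermitian_surface q H \<inter> quadric A) | H A. tangent_pair q H A \<and> T A}"

end

theory Submission
  imports Defs "HOL-Computational_Algebra.Polynomial"
begin

text \<open>
  Let \<open>K\<close> be the subfield of order \<open>q\<close>, with conjugation \<open>cj\<close> and trace \<open>tr\<close>. Choose coordinates in which
  the Hermitian surface is \<open>tr (z * cj t - x * cj y) = 0\<close>, the point of tangency is \<open>(0, 0, 0, 1)\<close> and the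
  common tangent plane is \<open>t = 0\<close>. For \<open>t = 1\<close> the quadric gives \<open>z\<close> as a quadratic function of
  \<open>x, y\<close>, so the affine common points are the zeros of one quadratic function over \<open>K\<close> in four
  \<open>K\<close>-variables. In the plane \<open>t = 0\<close> both surfaces are unions of lines through the point of tangency,
  and they share at most two of them.

  If they share a line, it may be taken as the axis \<open>y = 0\<close>; then the quadratic function is linear in \<open>x\<close> and
  its zeros can be counted directly. Otherwise completing the square in \<open>x\<close> splits off the
  nondegenerate binary form \<open>tr (a / 2 * x\<^sup>2)\<close> and leaves the number of zeros of a conic over \<open>K\<close>.
  The conic can vanish identically only if the quadric is hyperbolic, and then the size is \<open>q\<^sup>2 + 1\<close>.
  All sizes are attained with quadratic functions that have no linear terms.
\<close>

section \<open>The field with \<open>q\<^sup>2\<close> elements and its subfield of order \<open>q\<close>\<close>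

text \<open>Few sizes occur because a nondegenerate binary form over \<open>K\<close> takes all
  nonzero values equally often, with a sign e = 1 (isotropic) or e = -1 (anisotropic). Summing over
  \<open>y\<close>, the affine count is q^3 + e q (Z - q), where Z is the number of zeros of the
  residual conic. The possible values of Z are symmetric about q, so both signs lead to the same
  seven sizes. Each shared line adds q^2 points besides the point of tangency. The obstacle when a
  line is shared is that the number of shared lines and the number of solutions of the linear
  equation are linked; treated as independent they would admit too many sizes. Every element of
  \<open>K\<close> is a square in the big field, so isotropy over \<open>K\<close> is decided by a
  quadratic character of the big field. Elliptic and some hyperbolic examples therefore prescribe
  the characters of \<open>m\<close> and \<open>m - 1\<close>; most cones are handled by splitting
  off the norm form instead. Two constructions may need an element of \<open>K\<close> other than 0,
  1 and -1. Hence q > 3 for cones, and one size for q = 3 whose attainment by hyperbolic quadrics is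
  left open.\<close>

lemma card_power_eq_le:
  fixes c :: "'a::idom"
  assumes "n > 0"
  shows "finite {x. x ^ n = c} \<and> card {x. x ^ n = c} \<le> n"
proof -
  let ?p = "monom 1 n + [:- c:]"
  have deg: "degree ?p = n"
    using assms degree_add_eq_left[of "[:- c:]" "monom (1::'a) n"]
    by (simp add: degree_monom_eq)
  then have "?p \<noteq> 0" using assms by (metis degree_0 less_irrefl)
  then show ?thesis
    using card_poly_roots_bound[of ?p] poly_roots_finite[of ?p] deg by (simp add: poly_monom add_eq_0_iff2)
qed

lemma card_power_add_le:
  fixes c d :: "'a::idom"
  assumes "n > 1"
  shows "finite {x. x ^ n + d * x = c} \<and> card {x. x ^ n + d * x = c} \<le> n"
proof -
  let ?p = "monom 1 n + [:- c, d:]"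
  have deg: "degree ?p = n"
    using assms degree_add_eq_left[of "[:- c, d:]" "monom (1::'a) n"]
    by (simp add: degree_monom_eq)
  then have "?p \<noteq> 0" using assms by (metis degree_0 less_irrefl not_one_less_zero)
  moreover have "{x. poly ?p x = 0} = {x. x ^ n + d * x = c}"
    by (auto simp: poly_monom algebra_simps)
  ultimately show ?thesis
    using card_poly_roots_bound[of ?p] poly_roots_finite[of ?p] deg by metis
qed

text \<open>If every fibre has at most \<open>n\<close> elements and \<open>A\<close> has at least
  \<open>card B * n\<close>, no fibre can fall short. This turns root bounds for polynomials into
  exact fibre sizes of trace and norm.\<close>

lemma card_fibre_eqI:
  assumes fA: "finite A" and fB: "finite B" and im: "f ` A \<subseteq> B"
    and le: "\<And>y. y \<in> B \<Longrightarrow> card {x \<in> A. f x = y} \<le> n"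
    and ge: "card B * n \<le> card A" and y: "y \<in> B"
  shows "card {x \<in> A. f x = y} = n"
proof (rule ccontr)
  assume "card {x \<in> A. f x = y} \<noteq> n"
  then have lt: "card {x \<in> A. f x = y} < n" using le[OF y] by simp
  have "card A = (\<Sum>y\<in>B. card {x \<in> A. f x = y})"
    using sum.group[OF fA fB im, of "\<lambda>_. 1::nat"] by simp
  also have "\<dots> < (\<Sum>y\<in>B. n)"
    using le lt y fB by (intro sum_strict_mono_ex1) auto
  finally show False using ge by simp
qed

locale hermitian_field =
  fixes q :: nat and ty :: "'k::{field,finite} itself"
  assumes pq: "primepow q" and oq: "odd q" and cardk: "CARD('k) = q ^ 2"
begin

definition cj :: "'k \<Rightarrow> 'k" where "cj x = x ^ q"
definition K :: "'k set" where "K = {x. cj x = x}"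
definition tr :: "'k \<Rightarrow> 'k" where "tr x = x + cj x"
definition square :: "'k \<Rightarrow> bool" where "square x \<longleftrightarrow> (\<exists>y. x = y ^ 2)"

lemma q_ge_3: "q \<ge> 3"
  using oq primepow_gt_Suc_0[OF pq] by (cases "q = 2") auto

lemma q_pos [simp]: "q > 0"
  using q_ge_3 by simp

text \<open>The shift x -> x + 1 permutes the field, so the sum of all elements equals itself plus
  q^2 times 1.\<close>

lemma char_eq_0: "of_nat (q ^ 2) = (0::'k)"
proof -
  have "(\<Sum>x\<in>UNIV. x + 1) = (\<Sum>x\<in>UNIV. x::'k)"
    by (rule sum.reindex_bij_witness[of _ "\<lambda>x. x - 1" "\<lambda>x. x + 1"]) auto
  then show ?thesis by (simp add: sum.distrib flip: cardk)
qed

lemma cj_add [simp]: "cj (x + y) = cj x + cj y"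
proof -
  obtain p n where pn: "prime p" "n > 0" "q = p ^ n"
    using pq unfolding primepow_def by blast
  \<comment> \<open>The characteristic divides a power of \<open>p\<close>, hence is a power of
    \<open>p\<close>; being prime it is \<open>p\<close>, and \<open>cj\<close> is an iterated
    Frobenius map.\<close>
  have "CHAR('k) dvd p ^ (n * 2)"
    using char_eq_0 by (simp add: of_nat_eq_0_iff_char_dvd pn(3) power_mult del: of_nat_power)
  then obtain i where i: "CHAR('k) = p ^ i"
    using divides_primepow_nat[OF pn(1)] by auto
  have "prime CHAR('k)"
    by (rule prime_CHAR_semidom) (use i pn(1) prime_gt_0_nat in auto)
  then have "CHAR('k) = p"
    using i by (auto simp: prime_power_iff)
  then show ?thesis
    using freshmans_dream'[of q n x y] \<open>prime CHAR('k)\<close> pn(3) unfolding cj_def by simp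
qed

lemma cj_mult [simp]: "cj (x * y) = cj x * cj y"
  by (simp add: cj_def power_mult_distrib)

lemma cj_0 [simp]: "cj 0 = 0" by (simp add: cj_def)
lemma cj_1 [simp]: "cj 1 = 1" by (simp add: cj_def)

lemma cj_uminus [simp]: "cj (- x) = - cj x"
  using oq by (simp add: cj_def)

lemma cj_diff [simp]: "cj (x - y) = cj x - cj y"
  using cj_add[of x "- y"] by simp

lemma cj_power [simp]: "cj (x ^ n) = cj x ^ n"
  by (simp add: cj_def mult.commute flip: power_mult)

lemma cj_divide [simp]: "cj (x / y) = cj x / cj y"
  by (simp add: cj_def power_divide)

lemma cj_numeral [simp]: "cj (numeral n) = numeral n"
  by (induction n) (simp_all only: numeral.simps cj_add cj_1)

lemma cj_eq_0_iff [simp]: "cj x = 0 \<longleftrightarrow> x = 0"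
  by (simp add: cj_def)

text \<open>Multiplication by a nonzero \<open>x\<close> permutes the nonzero elements; comparing
  the products gives x^(q^2 - 1) = 1.\<close>

lemma power_card_eq: "x ^ (q ^ 2) = (x::'k)"
proof (cases "x = 0")
  case False
  have "(\<Prod>y\<in>UNIV-{0}. x * y) = (\<Prod>y\<in>UNIV-{0}. y)"
    by (rule prod.reindex_bij_witness[of _ "\<lambda>y. y / x" "\<lambda>y. x * y"]) (use False in auto)
  then have "x ^ (q ^ 2 - 1) = 1"
    by (simp add: prod.distrib cardk)
  then show ?thesis using power_minus_mult[of "q ^ 2" x] by simp
qed simp

lemma cj_cj [simp]: "cj (cj x) = x"
  using power_card_eq[of x] by (simp add: cj_def power2_eq_square flip: power_mult)

lemma two_neq_0 [simp]: "(2::'k) \<noteq> 0"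
proof
  assume "(2::'k) = 0"
  moreover obtain m where "q = 2 * m + 1" using oq by (rule oddE)
  ultimately have "of_nat q = (1::'k)" by simp
  then show False using char_eq_0 by simp
qed

lemma four_neq_0 [simp]: "(4::'k) \<noteq> 0"
  using two_neq_0 by (metis mult_eq_0_iff numeral_Bit0 mult_2)

lemma K_iff: "x \<in> K \<longleftrightarrow> cj x = x" by (simp add: K_def)

lemma K_simps [simp, intro]:
  "0 \<in> K" "1 \<in> K" "numeral n \<in> K"
  "x \<in> K \<Longrightarrow> y \<in> K \<Longrightarrow> x + y \<in> K"
  "x \<in> K \<Longrightarrow> y \<in> K \<Longrightarrow> x - y \<in> K"
  "x \<in> K \<Longrightarrow> - x \<in> K"
  "x \<in> K \<Longrightarrow> y \<in> K \<Longrightarrow> x * y \<in> K"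
  "x \<in> K \<Longrightarrow> y \<in> K \<Longrightarrow> x / y \<in> K"
  "x \<in> K \<Longrightarrow> x ^ m \<in> K"
  by (auto simp: K_iff)

lemma tr_in_K [simp, intro]: "tr x \<in> K"
  by (simp add: K_iff tr_def)

lemma norm_in_K [simp, intro]: "x * cj x \<in> K"
  by (simp add: K_iff mult.commute)

lemma tr_simps [simp]:
  "tr 0 = 0" "tr (x + y) = tr x + tr y" "tr (x - y) = tr x - tr y" "tr (- x) = - tr x" "tr (cj x) = tr x"
  by (simp_all add: tr_def)

lemma tr_scale: "k \<in> K \<Longrightarrow> tr (k * x) = k * tr x"
  by (simp add: tr_def K_iff algebra_simps)

lemma tr_K: "k \<in> K \<Longrightarrow> tr k = 2 * k"
  by (simp add: tr_def K_iff)

lemma card_K_le: "card K \<le> q"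
  using card_power_add_le[of q "-1::'k" 0] q_ge_3 by (simp add: K_def cj_def)

lemma card_tr_le: "card {x. tr x = k} \<le> q"
  using card_power_add_le[of q "1::'k" k] q_ge_3 by (simp add: tr_def cj_def add.commute)

text \<open>The trace maps q^2 elements into \<open>K\<close> with fibres of at most q elements,
  which forces \<open>K\<close> to reach the upper bound q.\<close>

lemma card_K [simp]: "card K = q"
proof -
  have "q ^ 2 = (\<Sum>k\<in>K. card {x. tr x = k})"
    using sum.group[of UNIV K tr "\<lambda>_. 1::nat"] by (simp add: cardk image_subset_iff)
  also have "\<dots> \<le> (\<Sum>k\<in>K. q)"
    by (intro sum_mono card_tr_le)
  finally have "q * q \<le> card K * q" by (simp add: power2_eq_square)
  then show ?thesis using card_K_le by simp
qed

lemma card_tr: "k \<in> K \<Longrightarrow> card {x. tr x = k} = q"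
  using card_fibre_eqI[of UNIV K tr q k] card_tr_le by (simp add: cardk power2_eq_square image_subset_iff)

lemma card_tr_mult:
  assumes "k \<in> K" "m \<noteq> 0"
  shows "card {x. tr (x * m) = k} = q"
proof -
  have "bij_betw (\<lambda>x. x * m) {x. tr (x * m) = k} {x. tr x = k}"
    by (rule bij_betw_byWitness[of _ "\<lambda>x. x / m"]) (use assms in auto)
  then show ?thesis using card_tr[OF assms(1)] by (simp add: bij_betw_same_card)
qed

text \<open>The norm sends q^2 - 1 nonzero elements to the q - 1 nonzero elements of
  \<open>K\<close>, and its degree bounds each fibre by q + 1; so every fibre is full.\<close>

lemma card_norm:
  assumes k: "k \<in> K" "k \<noteq> 0"
  shows "card {x. x * cj x = k} = q + 1"
proof -
  have le: "card {x. x * cj x = y} \<le> q + 1" for y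
    using card_power_eq_le[of "q + 1" y] by (simp add: cj_def)
  have "card {x \<in> UNIV - {0}. x * cj x = k} = q + 1"
  proof (rule card_fibre_eqI[of _ "K - {0}"])
    show "card {x \<in> UNIV - {0}. x * cj x = y} \<le> q + 1" for y
      using card_mono[of "{x. x * cj x = y}" "{x \<in> UNIV - {0}. x * cj x = y}"] le[of y] by force
    show "card (K - {0}) * (q + 1) \<le> card (UNIV - {0::'k})"
      using q_pos by (simp add: cardk power2_eq_square diff_mult_distrib algebra_simps)
  qed (use k in auto)
  also have "{x \<in> UNIV - {0}. x * cj x = k} = {x. x * cj x = k}"
    using k by auto
  finally show ?thesis .
qed

lemma norm_surj: "k \<in> K \<Longrightarrow> \<exists>x. x * cj x = k"
  using card_norm[of k] by (cases "k = 0") (auto intro: exI[of _ 0] dest!: card_eq_SucD)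

section \<open>Squares and nonsquares of the big field\<close>

lemma square_K: "k \<in> K \<Longrightarrow> square k"
proof -
  assume "k \<in> K"
  then obtain x where "x * cj x = k" using norm_surj by blast
  moreover obtain m where "q = 2 * m + 1" using oq by (rule oddE)
  \<comment> \<open>The norm is the power with the even exponent q + 1, so every norm, and thus
    every element of \<open>K\<close>, is a square.\<close>
  ultimately have "k = x ^ (2 * (m + 1))"
    unfolding cj_def by simp
  also have "\<dots> = (x ^ (m + 1)) ^ 2"
    by (simp only: power_mult[symmetric] mult.commute)
  finally show ?thesis unfolding square_def by blast
qed

lemma square_mult: "square x \<Longrightarrow> square y \<Longrightarrow> square (x * y)"
  unfolding square_def by (metis power_mult_distrib)

lemma square_divide: "square x \<Longrightarrow> square y \<Longrightarrow> square (x / y)"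
  unfolding square_def by (metis power_divide)

lemma square_0 [simp]: "square 0" and square_1 [simp]: "square 1"
  by (simp_all add: square_K)

lemma square_power2 [simp]: "square (x ^ 2)"
  by (auto simp: square_def)

lemma square_mult_left_iff: "square x \<Longrightarrow> x \<noteq> 0 \<Longrightarrow> square (x * y) \<longleftrightarrow> square y"
  using square_mult[of x y] square_divide[of "x * y" x] by auto

lemma square_uminus [simp]: "square (- x) \<longleftrightarrow> square x"
  using square_mult_left_iff[of "-1" x] square_K[of "-1"] by simp

lemma exists_nonsquare: "\<exists>x. \<not> square x"
proof (rule ccontr)
  assume "\<not> ?thesis"
  then have "surj (\<lambda>x::'k. x ^ 2)" by (metis square_def surjI surj_def)
  then have "inj (\<lambda>x::'k. x ^ 2)" by (simp add: finite_UNIV_surj_inj)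
  then have "(1::'k) = - 1" by (rule injD) simp
  then have "(2::'k) = 0" by (metis one_add_one add.right_inverse)
  then show False by simp
qed

lemma card_power2_fibre_le: "card {x. x ^ 2 = (c::'k)} \<le> 2"
  using card_power_eq_le[of 2 c] by simp

text \<open>If the product were a nonsquare, \<open>y\<close> would lie outside zero, the nonzero
  squares \<open>S\<close> and the coset \<open>x * S\<close>. These already fill the field, because
  squaring is at most two-to-one and so \<open>S\<close> has at least (q^2 - 1)/2 elements.\<close>

lemma nonsquare_mult:
  assumes x: "\<not> square x" and y: "\<not> square y"
  shows "square (x * y)"
proof (rule ccontr)
  assume xy: "\<not> square (x * y)"
  define S where "S = {x. square x \<and> x \<noteq> 0}"
  have x0: "x \<noteq> 0" "y \<noteq> 0" using x y by auto
  have "card (UNIV - {0::'k}) = (\<Sum>s\<in>S. card {z \<in> UNIV - {0}. z ^ 2 = s})"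
    using sum.group[of "UNIV - {0::'k}" S "\<lambda>z. z ^ 2" "\<lambda>_. 1::nat"]
    by (force simp: S_def)
  also have "\<dots> \<le> (\<Sum>s\<in>S. 2)"
  proof (rule sum_mono)
    fix s :: 'k
    have "{z \<in> UNIV - {0}. z ^ 2 = s} \<subseteq> {z. z ^ 2 = s}" by auto
    then show "card {z \<in> UNIV - {0}. z ^ 2 = s} \<le> 2"
      using card_power2_fibre_le[of s] card_mono[of "{z. z ^ 2 = s}"] by (meson finite order_trans)
  qed
  finally have S: "q ^ 2 - 1 \<le> 2 * card S" by (simp add: cardk)
  have cS: "card ((*) z ` S) = card S" if "z \<noteq> 0" for z
    using that by (intro card_image) (auto simp: inj_on_def)
  have 1: "((*) x ` S) \<inter> S = {}" "y \<notin> S" "y \<noteq> 0" "0 \<notin> (*) x ` S \<union> S"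
    using x y x0 square_mult_left_iff by (auto simp: S_def mult.commute)
  have "y \<notin> (*) x ` S"
  proof
    assume "y \<in> (*) x ` S"
    then obtain s where "square s" "y = x * s" by (auto simp: S_def)
    then have "x * y = x ^ 2 * s" by (simp add: power2_eq_square)
    then show False using xy \<open>square s\<close> square_mult[of "x ^ 2" s] by simp
  qed
  then have "card (insert 0 (insert y ((*) x ` S \<union> S))) = 2 + 2 * card S"
    using 1 cS[OF x0(1)] by (simp add: card_Un_disjoint)
  then have "2 + 2 * card S \<le> q ^ 2"
    using card_mono[of UNIV "insert 0 (insert y ((*) x ` S \<union> S))"] by (simp add: cardk)
  then show False using S by simp
qed

section \<open>An imaginary element and coordinates over \<open>K\<close>\<close>

definition \<delta> :: 'k where "\<delta> = (SOME x. x \<noteq> 0 \<and> cj x = - x)"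

lemma \<delta>: "\<delta> \<noteq> 0" "cj \<delta> = - \<delta>"
proof -
  \<comment> \<open>The kernel of the trace has q > 1 elements, and its nonzero elements are those
    wanted.\<close>
  have "card {x. tr x = 0} \<noteq> card {0::'k}"
    using card_tr[of 0] q_ge_3 by simp
  then have "{x. tr x = 0} \<noteq> {0}" by metis
  then obtain x where "tr x = 0" "x \<noteq> 0" by force
  then have "\<exists>x. x \<noteq> 0 \<and> cj x = - x"
    by (intro exI[of _ x]) (simp add: tr_def add_eq_0_iff)
  then show "\<delta> \<noteq> 0" "cj \<delta> = - \<delta>" unfolding \<delta>_def by (metis (mono_tags, lifting) someI_ex)+
qed

lemma neq_uminus: "x \<noteq> 0 \<Longrightarrow> x \<noteq> - (x::'k)"
  by (metis add_eq_0_iff mult_2 mult_eq_0_iff two_neq_0)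

lemma \<delta>_notin_K: "\<delta> \<notin> K"
  using \<delta> neq_uminus by (auto simp: K_iff)

lemma \<delta>2_in_K [simp]: "\<delta> ^ 2 \<in> K"
  by (simp add: K_iff \<delta>)

text \<open>The only square roots of \<open>\<delta> ^ 2\<close> are \<delta> and its negative, both
  outside \<open>K\<close>. This supplies a nonsquare of \<open>K\<close> for the examples.\<close>

lemma \<delta>2_nonsquare_K: "k \<in> K \<Longrightarrow> k ^ 2 \<noteq> \<delta> ^ 2"
  using \<delta>_notin_K K_simps(6)[of "- \<delta>"] by (auto simp: power2_eq_iff)

lemma imag_iff: "cj x = - x \<longleftrightarrow> x / \<delta> \<in> K"
  using \<delta> by (simp add: K_iff minus_divide_left [symmetric] divide_simps) (metis minus_minus minus_mult_right)

lemma sqrt_K_cases: "x ^ 2 \<in> K \<Longrightarrow> cj x = x \<or> cj x = - x"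
  by (simp add: K_iff power2_eq_iff)

lemma bij_coords: "bij_betw (\<lambda>(u, v). u + v * \<delta>) (K \<times> K) UNIV"
proof -
  have inj: "inj_on (\<lambda>(u, v). u + v * \<delta>) (K \<times> K)"
  proof (rule inj_onI, clarify)
    fix u v u' v' assume K: "u \<in> K" "v \<in> K" "u' \<in> K" "v' \<in> K" and e: "u + v * \<delta> = u' + v' * \<delta>"
    from arg_cong[OF e, of tr] K have "2 * u = 2 * u'"
      by (simp add: tr_def K_iff \<delta>)
    then show "u = u' \<and> v = v'" using e \<delta> by simp
  qed
  moreover have "(\<lambda>(u, v). u + v * \<delta>) ` (K \<times> K) = UNIV"
    using inj by (intro card_subset_eq) (simp_all add: card_image cardk power2_eq_square card_cartesian_product)
  ultimately show ?thesis by (simp add: bij_betw_def)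
qed

lemma coords_exist: "\<exists>u\<in>K. \<exists>v\<in>K. z = u + v * \<delta>"
proof -
  have "z \<in> (\<lambda>(u, v). u + v * \<delta>) ` (K \<times> K)"
    using bij_betw_imp_surj_on[OF bij_coords] by simp
  then show ?thesis by auto
qed

section \<open>Counting points of conics over the subfield\<close>

lemma card_hyperbola:
  assumes k: "k \<in> K"
  shows "card {(s, t). s \<in> K \<and> t \<in> K \<and> s * t = k} = (if k = 0 then 2 * q - 1 else q - 1)"
proof (cases "k = 0")
  case True
  have "{(s, t). s \<in> K \<and> t \<in> K \<and> s * t = k} = {0} \<times> K \<union> (K - {0}) \<times> {0}"
    using True by auto
  moreover have "({0} \<times> K) \<inter> ((K - {0}) \<times> {0}) = {}" by auto
  ultimately show ?thesis
    using True q_pos by (simp add: card_Un_disjoint card_cartesian_product)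
next
  case False
  have "bij_betw (\<lambda>s. (s, k / s)) (K - {0}) {(s, t). s \<in> K \<and> t \<in> K \<and> s * t = k}"
    by (rule bij_betw_byWitness[of _ fst]) (use k False in \<open>auto simp: field_simps\<close>)
  then show ?thesis using False by (simp flip: bij_betw_same_card)
qed

text \<open>In the big field \<open>m\<close> has a root \<mu>, fixed or negated by
  \<open>cj\<close>. If it is fixed, the form factors over \<open>K\<close> and the level set is a
  hyperbola; if it is negated, the form is the norm of \<open>u + \<mu> * v\<close>.\<close>

lemma card_diff_of_squares:
  assumes m: "m \<in> K" "m \<noteq> 0" and k: "k \<in> K"
  shows "card {(u, v). u \<in> K \<and> v \<in> K \<and> u ^ 2 - m * v ^ 2 = k} \<in> {1, q - 1, q + 1, 2 * q - 1}"
    (is "card ?S \<in> _")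
proof -
  obtain \<mu> where \<mu>: "m = \<mu> ^ 2" using square_K[OF m(1)] by (auto simp: square_def)
  then have \<mu>0: "\<mu> \<noteq> 0" using m by auto
  from sqrt_K_cases[of \<mu>] \<mu> m consider "cj \<mu> = \<mu>" | "cj \<mu> = - \<mu>" by auto
  then show ?thesis
  proof cases
    case 1
    then have \<mu>K: "\<mu> \<in> K" by (simp add: K_iff)
    have "bij_betw (\<lambda>(u, v). (u - \<mu> * v, u + \<mu> * v)) ?S {(s, t). s \<in> K \<and> t \<in> K \<and> s * t = k}"
      by (rule bij_betw_byWitness[of _ "\<lambda>(s, t). ((s + t) / 2, (t - s) / (2 * \<mu>))"])
        (use \<mu>K \<mu>0 in \<open>auto simp: \<mu> field_simps power2_eq_square\<close>)
    then have "card ?S = card {(s, t). s \<in> K \<and> t \<in> K \<and> s * t = k}" by (rule bij_betw_same_card)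
    then show ?thesis using card_hyperbola[OF k] by (auto split: if_splits)
  next
    case 2
    have "bij_betw (\<lambda>(u, v). u + \<mu> * v) ?S {x. x * cj x = k}"
      by (rule bij_betw_byWitness[of _ "\<lambda>x. ((x + cj x) / 2, (x - cj x) / (2 * \<mu>))"])
        (use 2 \<mu>0 in \<open>auto simp: K_iff \<mu> field_simps power2_eq_square\<close>)
    then have "card ?S = card {x. x * cj x = k}" by (rule bij_betw_same_card)
    moreover have "{x. x * cj x = 0} = {0}" by auto
    ultimately show ?thesis using card_norm[OF k] by (cases "k = 0") auto
  qed
qed

text \<open>The numbers of zeros in the affine plane over \<open>K\<close> allowed for a nonzero
  polynomial of degree at most 2. The set is invariant under Z -> 2 q - Z.\<close>

definition conic_sizes :: "nat set" where
  "conic_sizes = {0, 1, q - 1, q, q + 1, 2 * q - 1, 2 * q}"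

lemma card_conic_monic:
  assumes K: "C \<in> K" "E \<in> K" "F \<in> K"
  shows "card {(u, v). u \<in> K \<and> v \<in> K \<and> u ^ 2 + C * v ^ 2 + E * v + F = 0} \<in> conic_sizes"
    (is "card ?S \<in> _")
proof (cases "C = 0")
  case C: True
  show ?thesis
  proof (cases "E = 0")
    case True
    have "?S = {u \<in> K. u ^ 2 = - F} \<times> K"
      using C True by (auto simp: add_eq_0_iff2)
    then have "card ?S = card {u \<in> K. u ^ 2 = - F} * q" by (simp add: card_cartesian_product)
    moreover have "card {u \<in> K. u ^ 2 = - F} \<le> 2"
      by (rule order_trans[OF card_mono card_power2_fibre_le[of "- F"]]) auto
    then have "card {u \<in> K. u ^ 2 = - F} \<in> {0, 1, 2}" by force
    ultimately show ?thesis by (auto simp: conic_sizes_def)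
  next
    case False
    have "bij_betw (\<lambda>u. (u, - (u ^ 2 + F) / E)) K ?S"
    proof (rule bij_betw_byWitness[of _ fst])
      have "v = - (u ^ 2 + F) / E" if "u\<^sup>2 + C * v\<^sup>2 + E * v + F = 0" for u v
      proof -
        have "E * v = - (u ^ 2 + F)" using C that by (simp add: add_eq_0_iff algebra_simps)
        then show ?thesis using False by (simp add: field_simps)
      qed
      then show "\<forall>a'\<in>?S. (fst a', - ((fst a')\<^sup>2 + F) / E) = a'" by auto
      show "(\<lambda>u. (u, - (u ^ 2 + F) / E)) ` K \<subseteq> ?S"
        using K False C K_simps(8)[of "- (_\<^sup>2 + F)" E] by (intro image_subsetI) simp
    qed auto
    then have "card ?S = q" by (simp flip: bij_betw_same_card)
    then show ?thesis by (simp add: conic_sizes_def)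
  qed
next
  case C: False
  define e where "e = E / (2 * C)"
  let ?k = "C * e ^ 2 - F"
  have e: "e \<in> K" and E: "E = 2 * C * e" using K C by (simp_all add: e_def)
  have eq: "u ^ 2 + C * v ^ 2 + E * v + F = u ^ 2 - (- C) * (v + e) ^ 2 - ?k" for u v
    by (simp add: E power2_eq_square algebra_simps)
  have "bij_betw (\<lambda>(u, v). (u, v + e)) ?S {(u, v). u \<in> K \<and> v \<in> K \<and> u ^ 2 - (- C) * v ^ 2 = ?k}"
  proof (rule bij_betw_byWitness[of _ "\<lambda>(u, v). (u, v - e)"])
    show "(\<lambda>(u, v). (u, v + e)) ` ?S \<subseteq> {(u, v). u \<in> K \<and> v \<in> K \<and> u ^ 2 - (- C) * v ^ 2 = ?k}"
      using e unfolding eq by auto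
    show "(\<lambda>(u, v). (u, v - e)) ` {(u, v). u \<in> K \<and> v \<in> K \<and> u ^ 2 - (- C) * v ^ 2 = ?k} \<subseteq> ?S"
      using e unfolding eq by auto
  qed auto
  then have "card ?S = card {(u, v). u \<in> K \<and> v \<in> K \<and> u ^ 2 - (- C) * v ^ 2 = ?k}"
    by (rule bij_betw_same_card)
  moreover have "?k \<in> K" using K e by simp
  ultimately show ?thesis
    using card_diff_of_squares[of "- C" ?k] K C by (auto simp: conic_sizes_def)
qed

lemma card_conic_square:
  assumes K: "A \<in> K" "B \<in> K" "C \<in> K" "D \<in> K" "E \<in> K" "F \<in> K" and A: "A \<noteq> 0"
  shows "card {(u, v). u \<in> K \<and> v \<in> K \<and> A * u ^ 2 + B * u * v + C * v ^ 2 + D * u + E * v + F = 0}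
    \<in> conic_sizes" (is "card ?S \<in> _")
proof -
  \<comment> \<open>The coefficients after multiplying by 4 A and completing the square in
    \<open>u\<close>.\<close>
  let ?C = "4 * A * C - B ^ 2" and ?E = "4 * A * E - 2 * B * D" and ?F = "4 * A * F - D ^ 2"
  let ?T = "{(u, v). u \<in> K \<and> v \<in> K \<and> u ^ 2 + ?C * v ^ 2 + ?E * v + ?F = 0}"
  have eq: "4 * A * (A * u ^ 2 + B * u * v + C * v ^ 2 + D * u + E * v + F)
      = (2 * A * u + B * v + D) ^ 2 + ?C * v ^ 2 + ?E * v + ?F" for u v
    by (simp add: algebra_simps power2_eq_square)
  have "bij_betw (\<lambda>(u, v). (2 * A * u + B * v + D, v)) ?S ?T"
  proof (rule bij_betw_byWitness[of _ "\<lambda>(u, v). ((u - B * v - D) / (2 * A), v)"])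
    show "(\<lambda>(u, v). (2 * A * u + B * v + D, v)) ` ?S \<subseteq> ?T"
      using K by (auto simp flip: eq)
    show "(\<lambda>(u, v). ((u - B * v - D) / (2 * A), v)) ` ?T \<subseteq> ?S"
    proof clarify
      fix u v assume uv: "u \<in> K" "v \<in> K" "u ^ 2 + ?C * v ^ 2 + ?E * v + ?F = 0"
      let ?u = "(u - B * v - D) / (2 * A)"
      have "2 * A * ?u + B * v + D = u" using A by simp
      then have "4 * A * (A * ?u ^ 2 + B * ?u * v + C * v ^ 2 + D * ?u + E * v + F) = 0"
        unfolding eq using uv(3) by simp
      then show "?u \<in> K \<and> v \<in> K \<and> A * ?u ^ 2 + B * ?u * v + C * v ^ 2 + D * ?u + E * v + F = 0"
        using uv K A by simp
    qed
  qed (use A in auto)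
  then have "card ?S = card ?T" by (rule bij_betw_same_card)
  then show ?thesis using card_conic_monic[of ?C ?E ?F] K by simp
qed

lemma card_line:
  assumes K: "D \<in> K" "E \<in> K" "F \<in> K" and D: "D \<noteq> 0"
  shows "card {(u, v). u \<in> K \<and> v \<in> K \<and> D * u + E * v + F = 0} = q"
proof -
  have "bij_betw (\<lambda>v. (- (E * v + F) / D, v)) K {(u, v). u \<in> K \<and> v \<in> K \<and> D * u + E * v + F = 0}"
  proof (rule bij_betw_byWitness[of _ snd])
    have "u = - (E * v + F) / D" if "D * u + E * v + F = 0" for u v
    proof -
      have "D * u = - (E * v + F)" using that by (simp add: add_eq_0_iff2 add.assoc)
      then show ?thesis using D by (simp add: field_simps)
    qed
    then show "\<forall>a'\<in>{(u, v). u \<in> K \<and> v \<in> K \<and> D * u + E * v + F = 0}. (- (E * snd a' + F) / D, snd a') = a'"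
      by auto
    show "(\<lambda>v. (- (E * v + F) / D, v)) ` K \<subseteq> {(u, v). u \<in> K \<and> v \<in> K \<and> D * u + E * v + F = 0}"
      using K D K_simps(8)[of "- (E * _ + F)" D] by (intro image_subsetI) simp
  qed auto
  then show ?thesis by (simp flip: bij_betw_same_card)
qed

lemma card_swap: "card {(u, v). P u v} = card {(v, u). P u v}"
  by (rule bij_betw_same_card[OF bij_betw_byWitness[of _ prod.swap prod.swap]]) auto

lemma card_conic:
  assumes K: "A \<in> K" "B \<in> K" "C \<in> K" "D \<in> K" "E \<in> K" "F \<in> K"
    and nz: "\<not> (A = 0 \<and> B = 0 \<and> C = 0 \<and> D = 0 \<and> E = 0 \<and> F = 0)"
  shows "card {(u, v). u \<in> K \<and> v \<in> K \<and> A * u ^ 2 + B * u * v + C * v ^ 2 + D * u + E * v + F = 0}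
    \<in> conic_sizes" (is "card ?S \<in> _")
proof -
  consider "A \<noteq> 0" | "A = 0" "C \<noteq> 0" | "A = 0" "C = 0" "B \<noteq> 0" | "A = 0" "C = 0" "B = 0"
    by blast
  then show ?thesis
  proof cases
    case 1 then show ?thesis using card_conic_square K by blast
  next
    case 2
    have "card ?S = card {(v, u). v \<in> K \<and> u \<in> K \<and> C * v ^ 2 + B * v * u + A * u ^ 2 + E * v + D * u + F = 0}"
      by (subst card_swap) (simp add: algebra_simps conj_commute conj_left_commute)
    then show ?thesis using card_conic_square[of C B A E D F] K 2 by simp
  next
    case 3
    \<comment> \<open>With A = C = 0, the polynomial times \<open>B\<close> is a product of two
      affine linear factors minus this constant.\<close>
    let ?k = "D * E - B * F"
    have eq: "B * (A * u ^ 2 + B * u * v + C * v ^ 2 + D * u + E * v + F) = (B * u + E) * (B * v + D) - ?k" for u v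
      using 3 by (simp add: algebra_simps)
    have "bij_betw (\<lambda>(u, v). (B * u + E, B * v + D)) ?S {(s, t). s \<in> K \<and> t \<in> K \<and> s * t = ?k}"
    proof (rule bij_betw_byWitness[of _ "\<lambda>(s, t). ((s - E) / B, (t - D) / B)"])
      show "(\<lambda>(u, v). (B * u + E, B * v + D)) ` ?S \<subseteq> {(s, t). s \<in> K \<and> t \<in> K \<and> s * t = ?k}"
      proof clarify
        fix u v assume uv: "u \<in> K" "v \<in> K" "A * u ^ 2 + B * u * v + C * v ^ 2 + D * u + E * v + F = 0"
        show "B * u + E \<in> K \<and> B * v + D \<in> K \<and> (B * u + E) * (B * v + D) = ?k"
          using uv K eq[of u v] by simp
      qed
      show "(\<lambda>(s, t). ((s - E) / B, (t - D) / B)) ` {(s, t). s \<in> K \<and> t \<in> K \<and> s * t = ?k} \<subseteq> ?S"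
      proof clarify
        fix s t assume st: "s \<in> K" "t \<in> K" "s * t = ?k"
        have "B * (A * ((s - E) / B)\<^sup>2 + B * ((s - E) / B) * ((t - D) / B) + C * ((t - D) / B)\<^sup>2
            + D * ((s - E) / B) + E * ((t - D) / B) + F) = 0"
          unfolding eq using 3 st by simp
        then show "(s - E) / B \<in> K \<and> (t - D) / B \<in> K \<and>
            A * ((s - E) / B)\<^sup>2 + B * ((s - E) / B) * ((t - D) / B) + C * ((t - D) / B)\<^sup>2
            + D * ((s - E) / B) + E * ((t - D) / B) + F = 0"
          using st K 3(3) by simp
      qed
    qed (use 3 in auto)
    then have "card ?S = card {(s, t). s \<in> K \<and> t \<in> K \<and> s * t = ?k}" by (rule bij_betw_same_card)
    then show ?thesis using card_hyperbola[of ?k] K by (auto simp: conic_sizes_def split: if_splits)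
  next
    case 4
    consider "D \<noteq> 0" | "D = 0" "E \<noteq> 0" | "D = 0" "E = 0" by blast
    then show ?thesis
    proof cases
      case 1 then show ?thesis using card_line[of D E F] K 4 by (simp add: conic_sizes_def)
    next
      case 2
      have "card ?S = card {(v, u). v \<in> K \<and> u \<in> K \<and> E * v + D * u + F = 0}"
        by (subst card_swap) (simp add: 4 algebra_simps conj_commute conj_left_commute)
      then show ?thesis using card_line[of E D F] K 2 by (simp add: conic_sizes_def)
    next
      case 3
      then have "?S = {}" using 4 nz by auto
      then show ?thesis by (simp add: conic_sizes_def)
    qed
  qed
qed

text \<open>In the coordinates \<open>y = u + v * \<delta>\<close> this is a conic over
  \<open>K\<close>. Its six coefficients vanish together only if \<alpha>, \<beta>, \<gamma> and
  \<kappa> do, since \<beta> is recovered from \<open>2 * \<alpha>1 + \<beta>\<close> and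
  \<open>2 * \<alpha>1 - \<beta>\<close>.\<close>

lemma card_trace_conic:
  assumes K: "\<beta> \<in> K" "\<kappa> \<in> K"
    and nz: "\<not> (\<alpha> = 0 \<and> \<beta> = 0 \<and> \<gamma> = 0 \<and> \<kappa> = 0)"
  shows "card {y. tr (\<alpha> * y ^ 2) + \<beta> * (y * cj y) + tr (\<gamma> * y) + \<kappa> = 0} \<in> conic_sizes"
    (is "card ?S \<in> _")
proof -
  obtain \<alpha>1 \<alpha>2 where \<alpha>: "\<alpha>1 \<in> K" "\<alpha>2 \<in> K" "\<alpha> = \<alpha>1 + \<alpha>2 * \<delta>" using coords_exist by blast
  obtain \<gamma>1 \<gamma>2 where \<gamma>: "\<gamma>1 \<in> K" "\<gamma>2 \<in> K" "\<gamma> = \<gamma>1 + \<gamma>2 * \<delta>" using coords_exist by blast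
  let ?A = "2 * \<alpha>1 + \<beta>" and ?B = "4 * \<delta> ^ 2 * \<alpha>2" and ?C = "\<delta> ^ 2 * (2 * \<alpha>1 - \<beta>)"
  let ?D = "2 * \<gamma>1" and ?E = "2 * \<delta> ^ 2 * \<gamma>2"
  let ?T = "{(u, v). u \<in> K \<and> v \<in> K \<and> ?A * u ^ 2 + ?B * u * v + ?C * v ^ 2 + ?D * u + ?E * v + \<kappa> = 0}"
  have eq: "tr (\<alpha> * (u + v * \<delta>) ^ 2) + \<beta> * ((u + v * \<delta>) * cj (u + v * \<delta>)) + tr (\<gamma> * (u + v * \<delta>)) + \<kappa>
      = ?A * u ^ 2 + ?B * u * v + ?C * v ^ 2 + ?D * u + ?E * v + \<kappa>" if "u \<in> K" "v \<in> K" for u v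
    using that \<alpha> \<gamma> by (simp add: tr_def K_iff \<delta> power2_eq_square algebra_simps)
  have "bij_betw (\<lambda>(u, v). u + v * \<delta>) ?T ?S"
    unfolding bij_betw_def
  proof
    show "inj_on (\<lambda>(u, v). u + v * \<delta>) ?T"
      using bij_betw_imp_inj_on[OF bij_coords] by (rule inj_on_subset) auto
    show "(\<lambda>(u, v). u + v * \<delta>) ` ?T = ?S"
    proof (intro equalityI subsetI)
      fix y assume y: "y \<in> ?S"
      obtain u v where "u \<in> K" "v \<in> K" "y = u + v * \<delta>" using coords_exist by blast
      then show "y \<in> (\<lambda>(u, v). u + v * \<delta>) ` ?T"
        using y eq[of u v] by (intro image_eqI[of _ _ "(u, v)"]) auto
    qed (use eq in auto)
  qed
  then have "card ?S = card ?T" by (simp add: bij_betw_same_card)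
  moreover have "\<not> (?A = 0 \<and> ?B = 0 \<and> ?C = 0 \<and> ?D = 0 \<and> ?E = 0 \<and> \<kappa> = 0)"
  proof
    assume 0: "?A = 0 \<and> ?B = 0 \<and> ?C = 0 \<and> ?D = 0 \<and> ?E = 0 \<and> \<kappa> = 0"
    then have "2 * \<alpha>1 - \<beta> = 0" using \<delta> by simp
    then have "2 * \<beta> = 0" using 0 by (simp add: algebra_simps)
    then have "\<beta> = 0" by simp
    moreover have "\<alpha>1 = 0" using 0 \<open>\<beta> = 0\<close> by simp
    moreover have "\<alpha>2 = 0" "\<gamma>1 = 0" "\<gamma>2 = 0" using 0 \<delta> by auto
    ultimately show False using nz \<alpha> \<gamma> 0 by simp
  qed
  ultimately show ?thesis using card_conic[of ?A ?B ?C ?D ?E \<kappa>] K \<alpha> \<gamma> by simp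
qed

text \<open>\<open>\<epsilon> a\<close> is \<open>1\<close> exactly if the quadratic form \<open>x \<mapsto> tr (a * x\<^sup>2)\<close> is isotropic over \<open>K\<close>.\<close>

definition \<epsilon> :: "'k \<Rightarrow> int" where "\<epsilon> a = (if square (a * \<delta>) then 1 else - 1)"

text \<open>The equation says that \<open>a * x ^ 2\<close> is imaginary. If
  \<open>a * \<delta> = w ^ 2\<close>, this means that \<open>w * x\<close> is fixed or negated by
  \<open>cj\<close>, which gives two lines over \<open>K\<close> meeting in 0. If
  \<open>a * \<delta>\<close> is a nonsquare, only \<open>x = 0\<close> remains.\<close>

lemma card_trace_form_0:
  assumes a: "a \<noteq> 0"
  shows "card {x. tr (a * x ^ 2) = 0} = (if square (a * \<delta>) then 2 * q - 1 else 1)"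
proof (cases "square (a * \<delta>)")
  case True
  then obtain w where w: "a * \<delta> = w ^ 2" by (auto simp: square_def)
  have w0: "w \<noteq> 0" using w a \<delta> by auto
  have aw: "a = w ^ 2 / \<delta>" using w \<delta> by (simp add: field_simps)
  have "tr (a * x ^ 2) = 0 \<longleftrightarrow> cj (w * x) = w * x \<or> cj (w * x) = - (w * x)" for x
  proof -
    have "\<delta> * tr (a * x ^ 2) = (w * x) ^ 2 - cj (w * x) ^ 2"
      unfolding aw using \<delta> by (simp add: tr_def field_simps power2_eq_square)
    then have "tr (a * x ^ 2) = 0 \<longleftrightarrow> cj (w * x) ^ 2 = (w * x) ^ 2"
      using \<delta> by (metis eq_iff_diff_eq_0 mult_eq_0_iff)
    then show ?thesis by (simp only: power2_eq_iff)
  qed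
  moreover have "z \<in> K \<union> ({x. tr x = 0} - {0}) \<longleftrightarrow> cj z = z \<or> cj z = - z" for z
    by (auto simp: K_iff tr_def add_eq_0_iff)
  ultimately have *: "{x. tr (a * x ^ 2) = 0} = {x. w * x \<in> K \<union> ({x. tr x = 0} - {0})}"
    by blast
  have "bij_betw (\<lambda>x. w * x) {x. tr (a * x ^ 2) = 0} (K \<union> ({x. tr x = 0} - {0}))"
    unfolding * using w0 by (intro bij_betw_byWitness[of _ "\<lambda>x. x / w"]) auto
  then have "card {x. tr (a * x ^ 2) = 0} = card (K \<union> ({x. tr x = 0} - {0}))"
    by (rule bij_betw_same_card)
  also have "\<dots> = q + (q - 1)"
    by (subst card_Un_disjoint) (auto simp: card_tr card_Diff_singleton tr_K)
  finally show ?thesis using True by simp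
next
  case False
  have "x = 0" if x: "tr (a * x ^ 2) = 0" for x
  proof (rule ccontr)
    assume "x \<noteq> 0"
    have "cj (a * x ^ 2) = - (a * x ^ 2)"
      using x by (simp add: tr_def add_eq_0_iff)
    then have "square (a * x ^ 2 / \<delta>)" using imag_iff square_K by blast
    then have "square (a * x ^ 2 / \<delta> * (\<delta> / x) ^ 2)" by (rule square_mult) simp
    moreover have "a * x ^ 2 / \<delta> * (\<delta> / x) ^ 2 = a * \<delta>"
      using \<open>x \<noteq> 0\<close> \<delta> by (simp add: field_simps power2_eq_square)
    ultimately show False using False by simp
  qed
  then have "{x. tr (a * x ^ 2) = 0} = {0}" by auto
  then show ?thesis using False by simp
qed

text \<open>Every element of \<open>K\<close> is a square \<open>\<mu>\<^sup>2\<close> of the big field, and \<open>x \<mapsto> \<mu> x\<close> multiplies the form by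
  \<open>\<mu>\<^sup>2\<close>; so all nonzero values are taken equally often.\<close>

lemma card_trace_form:
  assumes a: "a \<noteq> 0" and k: "k \<in> K"
  shows "int (card {x. tr (a * x ^ 2) = k}) = int q - \<epsilon> a + (if k = 0 then \<epsilon> a * q else 0)"
proof (cases "k = 0")
  case True
  then show ?thesis using card_trace_form_0[OF a] q_ge_3 by (auto simp: \<epsilon>_def)
next
  case False
  let ?f = "\<lambda>k. card {x. tr (a * x ^ 2) = k}"
  have const: "?f j = ?f k" if j: "j \<in> K - {0}" for j
  proof -
    obtain \<mu> where \<mu>: "k / j = \<mu> ^ 2" using square_K[of "k / j"] k j by (auto simp: square_def)
    have \<mu>0: "\<mu> \<noteq> 0" using \<mu> j False by auto
    have "\<mu> ^ 2 \<in> K" using \<mu> k j by (metis DiffD1 K_simps(8))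
    then have t: "tr (a * (\<mu> * x) ^ 2) = k / j * tr (a * x ^ 2)" for x
      using tr_scale[of "\<mu> ^ 2" "a * x ^ 2"] by (simp add: \<mu> power_mult_distrib mult_ac)
    have "bij_betw (\<lambda>x. \<mu> * x) {x. tr (a * x ^ 2) = j} {x. tr (a * x ^ 2) = k}"
    proof (rule bij_betw_byWitness[of _ "\<lambda>x. x / \<mu>"])
      show "(\<lambda>x. \<mu> * x) ` {x. tr (a * x ^ 2) = j} \<subseteq> {x. tr (a * x ^ 2) = k}"
        using j by (auto simp: t)
      show "(\<lambda>x. x / \<mu>) ` {x. tr (a * x ^ 2) = k} \<subseteq> {x. tr (a * x ^ 2) = j}"
      proof clarify
        fix x assume "k = tr (a * x ^ 2)"
        moreover have "tr (a * x ^ 2) = k / j * tr (a * (x / \<mu>) ^ 2)"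
          using t[of "x / \<mu>"] \<mu>0 by simp
        ultimately have "k = k / j * tr (a * (x / \<mu>) ^ 2)" by simp
        then show "tr (a * (x / \<mu>) ^ 2) = j" using False j by (simp add: field_simps)
      qed
    qed (use \<mu>0 in auto)
    then show ?thesis by (rule bij_betw_same_card)
  qed
  have "q ^ 2 = (\<Sum>j\<in>K. ?f j)"
    using sum.group[of UNIV K "\<lambda>x. tr (a * x ^ 2)" "\<lambda>_. 1::nat"] by (simp add: cardk image_subset_iff)
  also have "\<dots> = ?f 0 + (\<Sum>j\<in>K-{0}. ?f k)"
    using const by (subst sum.remove[of _ 0]) auto
  finally have "q ^ 2 = ?f 0 + (q - 1) * ?f k" by simp
  then have *: "int (q ^ 2) = int (?f 0) + (int q - 1) * int (?f k)"
    using q_ge_3 by (simp add: of_nat_diff)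
  have "int (?f 0) = q - \<epsilon> a + \<epsilon> a * q"
    using card_trace_form_0[OF a] q_ge_3 by (auto simp: \<epsilon>_def)
  then have "(int q - 1) * int (?f k) = (int q - 1) * (q - \<epsilon> a)"
    using * by (simp add: \<epsilon>_def power2_eq_square algebra_simps split: if_splits)
  then show ?thesis using False q_ge_3 by simp
qed

text \<open>The norm form is anisotropic; the right-hand side is spelled out with the sign -1 to fit
  the hypothesis of \<open>card_form_plus\<close>.\<close>

lemma card_norm_form:
  assumes k: "k \<in> K"
  shows "int (card {x. x * cj x = k}) = int q - (- 1) + (if k = 0 then - 1 * int q else 0)"
proof (cases "k = 0")
  case True
  then have "{x. x * cj x = k} = {0}" by auto
  then show ?thesis using True by simp
qed (simp add: card_norm[OF k])

text \<open>The fibre over \<open>y\<close> has q - e elements, and e q more if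
  \<open>G y = 0\<close>. Summed over all q^2 values of \<open>y\<close>, only the number of zeros
  of \<open>G\<close> matters.\<close>

lemma card_form_plus:
  fixes f G :: "'k \<Rightarrow> 'k" and e :: int
  assumes f: "\<And>k. k \<in> K \<Longrightarrow> int (card {x. f x = k}) = int q - e + (if k = 0 then e * q else 0)"
    and G: "\<And>y. G y \<in> K"
  shows "int (card {(x, y). f x + G y = 0}) = int q ^ 3 + e * int q * (int (card {y. G y = 0}) - q)"
proof -
  have "{(x, y). f x + G y = 0} = prod.swap ` (SIGMA y:UNIV. {x. f x = - G y})"
    by (force simp: add_eq_0_iff2)
  then have "card {(x, y). f x + G y = 0} = card (SIGMA y:UNIV. {x. f x = - G y})"
    by (simp add: card_image)
  also have "\<dots> = (\<Sum>y\<in>UNIV. card {x. f x = - G y})" by (rule card_SigmaI) auto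
  finally have "int (card {(x, y). f x + G y = 0}) = (\<Sum>y\<in>(UNIV::'k set). int q - e + (if G y = 0 then e * q else 0))"
    using f G by simp
  also have "\<dots> = int q ^ 2 * (int q - e) + int (card {y. G y = 0}) * (e * q)"
    by (simp add: sum.distrib cardk sum.If_cases)
  finally show ?thesis by (simp add: power2_eq_square power3_eq_cube algebra_simps)
qed

section \<open>Counting in normal form\<close>

text \<open>In suitable coordinates \<open>(t, x, y, z)\<close>, with \<open>(0, 0, 0, 1)\<close> the point of tangency and \<open>t = 0\<close> the
  common tangent plane, the two surfaces are \<open>tr (z * cj t - x * cj y) = 0\<close> and
  \<open>a x\<^sup>2 + 2 b x y + c y\<^sup>2 + 2 d x t + 2 e y t + 2 f t\<^sup>2 = 2 z t\<close>. Setting \<open>t = 1\<close> and eliminating \<open>z\<close>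
  leaves \<open>aff = 0\<close>. The plane \<open>t = 0\<close> contains \<open>q\<^sup>2 * inf_count - 1\<close> nonzero common zeros; the
  division by \<open>q\<^sup>2 - 1\<close> that turns vectors into points is exact.\<close>

definition aff :: "'k \<Rightarrow> 'k \<Rightarrow> 'k \<Rightarrow> 'k \<Rightarrow> 'k \<Rightarrow> 'k \<Rightarrow> 'k \<Rightarrow> 'k \<Rightarrow> 'k" where
  "aff a b c d e f x y = tr (a / 2 * x ^ 2 + b * x * y + c / 2 * y ^ 2 + d * x + e * y + f - x * cj y)"

definition aff_count :: "'k \<Rightarrow> 'k \<Rightarrow> 'k \<Rightarrow> 'k \<Rightarrow> 'k \<Rightarrow> 'k \<Rightarrow> nat" where
  "aff_count a b c d e f = card {(x, y). aff a b c d e f x y = 0}"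

definition inf_count :: "'k \<Rightarrow> 'k \<Rightarrow> 'k \<Rightarrow> nat" where
  "inf_count a b c = card {(x, y). a * x ^ 2 + 2 * b * x * y + c * y ^ 2 = 0 \<and> tr (x * cj y) = 0}"

definition total_count :: "'k \<Rightarrow> 'k \<Rightarrow> 'k \<Rightarrow> 'k \<Rightarrow> 'k \<Rightarrow> 'k \<Rightarrow> nat" where
  "total_count a b c d e f = aff_count a b c d e f + (q ^ 2 * inf_count a b c - 1) div (q ^ 2 - 1)"

text \<open>Here \<open>n\<close> is the number of shared lines through the point of tangency. Each
  carries q^2 further points, and the remaining 1 is the point of tangency itself.\<close>

lemma total_count_eqI:
  assumes "inf_count a b c = 1 + n * (q ^ 2 - 1)"
  shows "total_count a b c d e f = aff_count a b c d e f + 1 + q ^ 2 * n"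
proof -
  have "q ^ 2 > 1" using q_ge_3 by (intro one_less_power) auto
  have *: "q ^ 2 * (1 + n * (q ^ 2 - 1)) - 1 = (q ^ 2 - 1) * (1 + q ^ 2 * n)"
    using \<open>q ^ 2 > 1\<close> by (simp add: algebra_simps diff_mult_distrib)
  show ?thesis
    unfolding total_count_def assms * using \<open>q ^ 2 > 1\<close>
    by (subst nonzero_mult_div_cancel_left) auto
qed

lemma inf_count_aniso:
  assumes "\<And>x y. a * x ^ 2 + 2 * b * x * y + c * y ^ 2 = 0 \<Longrightarrow> tr (x * cj y) = 0 \<Longrightarrow> x = 0 \<and> y = 0"
  shows "inf_count a b c = 1"
proof -
  let ?S = "{(x, y). a * x ^ 2 + 2 * b * x * y + c * y ^ 2 = 0 \<and> tr (x * cj y) = 0}"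
  have "z = (0, 0)" if "z \<in> ?S" for z
    using that assms[of "fst z" "snd z"] by (simp add: split_beta prod_eq_iff)
  moreover have "(0, 0) \<in> ?S" by simp
  ultimately have "?S = {(0, 0)}" by blast
  then show ?thesis by (simp add: inf_count_def)
qed

lemma \<epsilon>_mult_square: "square s \<Longrightarrow> s \<noteq> 0 \<Longrightarrow> \<epsilon> (s * a) = \<epsilon> a"
  using square_mult_left_iff[of s "a * \<delta>"] by (simp add: \<epsilon>_def mult.assoc)

lemma \<epsilon>_half [simp]: "\<epsilon> (a / 2) = \<epsilon> a"
  using \<epsilon>_mult_square[of "1 / 2" a] square_K[of "1 / 2"] by simp

lemma card_form_plus_trace:
  fixes G :: "'k \<Rightarrow> 'k"
  assumes "a \<noteq> 0" and "\<And>y. G y \<in> K"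
  shows "int (card {(x, y). tr (a / 2 * x ^ 2) + G y = 0})
    = int q ^ 3 + \<epsilon> a * int q * (int (card {y. G y = 0}) - q)"
  using card_form_plus[of "\<lambda>x. tr (a / 2 * x ^ 2)" "\<epsilon> a" G] card_trace_form[of "a / 2"] assms by simp

text \<open>The constants come from completing the square in \<open>x\<close>.\<close>

lemma aff_count_square:
  fixes a b c d e f :: 'k
  assumes a: "a \<noteq> 0"
  defines "\<alpha> \<equiv> c / 2 - b ^ 2 / (2 * a) - 1 / (2 * cj a)" and "\<beta> \<equiv> tr (b / a)"
    and "\<gamma> \<equiv> e - b * d / a + cj d / cj a" and "\<kappa> \<equiv> tr (f - d ^ 2 / (2 * a))"
  shows "int (aff_count a b c d e f) = int q ^ 3 + \<epsilon> a * int q *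
    (int (card {y. tr (\<alpha> * y ^ 2) + \<beta> * (y * cj y) + tr (\<gamma> * y) + \<kappa> = 0}) - q)"
proof -
  let ?G = "\<lambda>y. tr (\<alpha> * y ^ 2) + \<beta> * (y * cj y) + tr (\<gamma> * y) + \<kappa>"
  let ?l = "\<lambda>y. (b * y - cj y + d) / a"
  define k where "k = 1 / (2 * a)"
  have poly: "tr (A * x ^ 2 + b * x * y + C * y ^ 2 + d * x + e * y + f - x * cj y)
      = tr (A * x ^ 2 + x * (b * y - cj y + d) + k * (b * y - cj y + d) ^ 2)
        + (tr ((C - b ^ 2 * k - cj k) * y ^ 2) + tr (2 * b * k) * (y * cj y)
        + tr ((e - 2 * b * d * k + 2 * cj d * cj k) * y) + tr (f - d ^ 2 * k))" for A C x y
    by (simp add: tr_def algebra_simps power2_eq_square)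
  have sq: "a / 2 * (x + l / a) ^ 2 = a / 2 * x ^ 2 + x * l + k * l ^ 2" for x l
    using a by (simp add: k_def field_simps power2_eq_square)
  have "\<alpha> = c / 2 - b ^ 2 * k - cj k" "\<beta> = tr (2 * b * k)" "\<kappa> = tr (f - d ^ 2 * k)"
    "\<gamma> = e - 2 * b * d * k + 2 * cj d * cj k"
    unfolding \<alpha>_def \<beta>_def \<gamma>_def \<kappa>_def k_def by simp_all
  then have eq: "aff a b c d e f x y = tr (a / 2 * (x + ?l y) ^ 2) + ?G y" for x y
    unfolding aff_def poly sq by (simp only:)
  have "bij_betw (\<lambda>(x, y). (x + ?l y, y)) {(x, y). aff a b c d e f x y = 0}
      {(x, y). tr (a / 2 * x ^ 2) + ?G y = 0}"
    by (rule bij_betw_byWitness[of _ "\<lambda>(x, y). (x - ?l y, y)"]) (auto simp: eq)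
  then have "aff_count a b c d e f = card {(x, y). tr (a / 2 * x ^ 2) + ?G y = 0}"
    unfolding aff_count_def by (rule bij_betw_same_card)
  moreover have "?G y \<in> K" for y
    unfolding \<beta>_def \<kappa>_def by (intro K_simps tr_in_K norm_in_K)
  ultimately show ?thesis using card_form_plus_trace[OF a, of ?G] by simp
qed

definition generic_sizes :: "int set" where
  "generic_sizes = (let q = int q in {q^3 - q^2 + 1, q^3 - q^2 + q + 1, q^3 - q + 1, q^3 + 1, q^3 + q + 1,
          q^3 + q^2 - q + 1, q^3 + q^2 + 1})"

lemma generic_sizesI:
  assumes N: "int N = int q ^ 3 + e * int q * (int Z - q)" and Z: "Z \<in> conic_sizes"
    and e: "e = 1 \<or> e = - 1"
  shows "int N + 1 \<in> generic_sizes"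
proof -
  have N': "int N = int q ^ 3 + e * (int q * int Z - int q ^ 2)"
    using N by (simp add: power2_eq_square algebra_simps)
  have "int Z \<in> {0, 1, int q - 1, int q, int q + 1, 2 * int q - 1, 2 * int q}"
    using Z q_ge_3 unfolding conic_sizes_def by auto
  then have "int q * int Z \<in> {0, int q, int q ^ 2 - int q, int q ^ 2, int q ^ 2 + int q,
      2 * int q ^ 2 - int q, 2 * int q ^ 2}"
    by (elim insertE) (simp_all add: power2_eq_square right_diff_distrib distrib_left)
  then show ?thesis
    using e unfolding N' generic_sizes_def Let_def by (elim insertE disjE) simp_all
qed

lemma \<epsilon>_cases: "\<epsilon> a = 1 \<or> \<epsilon> a = - 1"
  by (simp add: \<epsilon>_def)

text \<open>If the residual conic is nonzero, the size is generic. If it vanishes identically, then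
  Z = q^2; here \<open>\<epsilon> a = 1\<close> would produce a shared line, so the affine count is
  q^3 - q (q^2 - q) = q^2. The extra conditions of the second alternative later exclude cones and
  elliptic quadrics.\<close>

lemma total_count_aniso:
  assumes a: "a \<noteq> 0"
    and an: "\<And>x y. a * x ^ 2 + 2 * b * x * y + c * y ^ 2 = 0 \<Longrightarrow> tr (x * cj y) = 0 \<Longrightarrow> x = 0 \<and> y = 0"
  shows "int (total_count a b c d e f) \<in> generic_sizes \<or>
    total_count a b c d e f = q ^ 2 + 1 \<and> b ^ 2 \<noteq> a * c \<and>
    (\<exists>x. a * x ^ 2 + 2 * b * x + c = 0)"
proof -
  let ?\<alpha> = "c / 2 - b ^ 2 / (2 * a) - 1 / (2 * cj a)" and ?\<beta> = "tr (b / a)"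
    and ?\<gamma> = "e - b * d / a + cj d / cj a" and ?\<kappa> = "tr (f - d ^ 2 / (2 * a))"
  let ?Z = "card {y. tr (?\<alpha> * y ^ 2) + ?\<beta> * (y * cj y) + tr (?\<gamma> * y) + ?\<kappa> = 0}"
  have M: "total_count a b c d e f = aff_count a b c d e f + 1"
    using total_count_eqI[of a b c 0] inf_count_aniso[OF an] by simp
  show ?thesis
  proof (cases "?\<alpha> = 0 \<and> ?\<beta> = 0 \<and> ?\<gamma> = 0 \<and> ?\<kappa> = 0")
    case False
    then have "?Z \<in> conic_sizes" by (intro card_trace_conic) auto
    then have "int (aff_count a b c d e f) + 1 \<in> generic_sizes"
      using generic_sizesI[OF aff_count_square[OF a]] \<epsilon>_cases by blast
    then show ?thesis using M by (simp add: add.commute)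
  next
    case True
    moreover have "?\<alpha> = (a * c - b ^ 2 - a / cj a) / (2 * a)"
      using a by (simp add: diff_divide_distrib mult.commute)
    ultimately have c: "a * c = b ^ 2 + a / cj a"
      using a by (simp add: algebra_simps)
    \<comment> \<open>As \<open>a * c - b ^ 2 = a / cj a\<close>, the roots of the quadratic are
      \<open>- b / a + \<sigma>\<close> where the square of \<sigma> is this quotient. It lies in
      \<open>K\<close> and hence has a root in the big field.\<close>
    obtain \<tau> where \<tau>: "- 1 / (a * cj a) = \<tau> ^ 2"
      using square_K[of "- 1 / (a * cj a)"] unfolding square_def by (metis K_simps(2,6,8) norm_in_K)
    have root: "a * (- b / a + \<sigma>) ^ 2 + 2 * b * (- b / a + \<sigma>) + c = 0" if "\<sigma> ^ 2 = \<tau> ^ 2" for \<sigma>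
    proof -
      have "a * (a * (- b / a + \<sigma>) ^ 2 + 2 * b * (- b / a + \<sigma>) + c) = a ^ 2 * \<sigma> ^ 2 - b ^ 2 + a * c"
        using a by (simp add: field_simps power2_eq_square)
      also have "\<dots> = 0" unfolding c that \<tau>[symmetric] using a by (simp add: field_simps power2_eq_square)
      finally show ?thesis using a by simp
    qed
    have \<epsilon>: "\<epsilon> a = - 1"
    proof (rule ccontr)
      assume "\<epsilon> a \<noteq> - 1"
      then have "card {x. tr (a * x ^ 2) = 0} \<noteq> card {0::'k}"
        using card_trace_form_0[OF a] q_ge_3 by (auto simp: \<epsilon>_def split: if_splits)
      then have "{x. tr (a * x ^ 2) = 0} \<noteq> {0}" by metis
      then obtain x where x: "tr (a * x ^ 2) = 0" "x \<noteq> 0" by force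
      \<comment> \<open>Since \<open>a * x ^ 2\<close> is imaginary, this choice of root has trace
        0. So has \<open>b / a\<close>, and the root \<open>- b / a + ?\<sigma>\<close> then gives a
        shared line.\<close>
      let ?\<sigma> = "x * cj x / (a * x ^ 2)"
      have cjx: "cj a * cj x ^ 2 = - (a * x ^ 2)" using x by (simp add: tr_def add_eq_0_iff)
      have tr\<sigma>: "tr ?\<sigma> = 0"
        using x by (simp add: tr_def cjx mult.commute)
      have "?\<sigma> ^ 2 = (cj a * cj x ^ 2) * x ^ 2 / (cj a * (a * x ^ 2) ^ 2)"
        using a by (simp add: power2_eq_square)
      also have "\<dots> = \<tau> ^ 2"
        unfolding cjx \<tau>[symmetric] using a x by (simp add: field_simps power2_eq_square)
      finally have "a * (- b / a + ?\<sigma>) ^ 2 + 2 * b * (- b / a + ?\<sigma>) + c = 0" by (rule root)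
      moreover have "tr (- b / a + ?\<sigma>) = 0" using tr\<sigma> True by simp
      ultimately show False using an[of "- b / a + ?\<sigma>" 1] by simp
    qed
    have "?Z = q ^ 2" using True by (simp add: cardk)
    then have "int (aff_count a b c d e f) = int (q ^ 2)"
      using aff_count_square[OF a, of b c d e f] \<epsilon> by (simp add: power2_eq_square power3_eq_cube algebra_simps)
    then have "aff_count a b c d e f = q ^ 2" by (simp only: of_nat_eq_iff)
    moreover have "b ^ 2 \<noteq> a * c" using c a by simp
    ultimately show ?thesis using M root[of \<tau>] by auto
  qed
qed

section \<open>A shared line: the case a = 0\<close>

lemma aff_count_linear:
  "aff_count 0 b c d e f + q * card {y. cj y = b * y + d}
    = q ^ 3 + q ^ 2 * card {y. cj y = b * y + d \<and> tr (c / 2 * y ^ 2 + e * y + f) = 0}"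
proof -
  let ?l = "\<lambda>y. b * y - cj y + d" and ?g = "\<lambda>y. tr (c / 2 * y ^ 2 + e * y + f)"
  let ?Y = "{y. cj y = b * y + d}"
  have Y: "cj y = b * y + d \<longleftrightarrow> ?l y = 0" for y by (auto simp: algebra_simps)
  have "{(x, y). aff 0 b c d e f x y = 0} = prod.swap ` (SIGMA y:UNIV. {x. tr (x * ?l y) = - ?g y})"
    by (force simp: aff_def add_eq_0_iff2 algebra_simps)
  then have "aff_count 0 b c d e f = card (SIGMA y:(UNIV::'k set). {x. tr (x * ?l y) = - ?g y})"
    by (simp add: aff_count_def card_image)
  also have "\<dots> = (\<Sum>y\<in>UNIV. card {x. tr (x * ?l y) = - ?g y})" by (rule card_SigmaI) auto
  also have "\<dots> = (\<Sum>y\<in>- ?Y. card {x. tr (x * ?l y) = - ?g y}) + (\<Sum>y\<in>?Y. card {x. tr (x * ?l y) = - ?g y})"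
    by (subst sum.union_disjoint[symmetric]) (auto intro: sum.cong)
  \<comment> \<open>Off \<open>?Y\<close> the equation for \<open>x\<close> is a trace equation with
    a nonzero factor and has q solutions. On \<open>?Y\<close> the variable \<open>x\<close> drops
    out, so all q^2 values work or none.\<close>
  also have "(\<Sum>y\<in>- ?Y. card {x. tr (x * ?l y) = - ?g y}) = (\<Sum>y\<in>- ?Y. q)"
    by (intro sum.cong refl card_tr_mult) (auto simp: Y)
  also have "\<dots> = (q ^ 2 - card ?Y) * q" by (simp add: Compl_eq_Diff_UNIV card_Diff_subset cardk)
  also have "(\<Sum>y\<in>?Y. card {x. tr (x * ?l y) = - ?g y}) = (\<Sum>y\<in>?Y. if ?g y = 0 then q ^ 2 else 0)"
  proof (intro sum.cong refl)
    fix y assume "y \<in> ?Y"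
    then have "{x. tr (x * ?l y) = - ?g y} = (if ?g y = 0 then UNIV else {})"
      using Y by (simp del: tr_simps(2-4))
    then show "card {x. tr (x * ?l y) = - ?g y} = (if ?g y = 0 then q ^ 2 else 0)"
      by (simp add: cardk)
  qed
  also have "\<dots> = q ^ 2 * card {y. cj y = b * y + d \<and> ?g y = 0}"
    by (simp add: sum.If_cases Collect_conj_eq[symmetric] flip: Collect_conj_eq)
  finally show ?thesis
  proof -
    assume *: "aff_count 0 b c d e f = (q\<^sup>2 - card ?Y) * q + q\<^sup>2 * card {y. cj y = b * y + d \<and> ?g y = 0}"
    have "card ?Y \<le> q ^ 2" using card_mono[of UNIV ?Y] by (simp add: cardk)
    then have "(q\<^sup>2 - card ?Y) * q + card ?Y * q = q ^ 3"
      by (simp add: power2_eq_square power3_eq_cube flip: distrib_right)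
    then show ?thesis using * by (simp add: mult.commute)
  qed
qed

text \<open>The form factors as y (2 b x + c y), and the line y = 0 is always shared. On the other
  factor \<open>tr (x * cj y)\<close> is \<open>tr (c / b)\<close> times a multiple of the norm of
  \<open>y\<close>, so that line is shared exactly when this trace vanishes. For b = 0 both factors
  give the same line.\<close>

lemma inf_count_linear:
  assumes "b \<noteq> 0 \<or> c \<noteq> 0"
  shows "inf_count 0 b c = 1 + (if b \<noteq> 0 \<and> tr (c / b) = 0 then 2 else 1) * (q ^ 2 - 1)"
proof -
  let ?S = "{(x, y). 0 * x ^ 2 + 2 * b * x * y + c * y ^ 2 = 0 \<and> tr (x * cj y) = 0}"
  let ?x = "\<lambda>y. - c * y / (2 * b)"
  have eq: "0 * x ^ 2 + 2 * b * x * y + c * y ^ 2 = y * (2 * b * x + c * y)" for x y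
    by (simp add: power2_eq_square algebra_simps)
  have "inf_count 0 b c = card ((UNIV::'k set) \<times> {0::'k}) + card {(x, y) \<in> ?S. y \<noteq> 0}"
  proof -
    have "?S = UNIV \<times> {0} \<union> {(x, y) \<in> ?S. y \<noteq> 0}" by auto
    then have "inf_count 0 b c = card ((UNIV::'k set) \<times> {0::'k} \<union> {(x, y) \<in> ?S. y \<noteq> 0})"
      unfolding inf_count_def by (rule arg_cong)
    also have "\<dots> = card ((UNIV::'k set) \<times> {0::'k}) + card {(x, y) \<in> ?S. y \<noteq> 0}"
      by (rule card_Un_disjoint) auto
    finally show ?thesis .
  qed
  moreover have "card {(x, y) \<in> ?S. y \<noteq> 0} = (if b \<noteq> 0 \<and> tr (c / b) = 0 then q ^ 2 - 1 else 0)"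
  proof (cases "b \<noteq> 0 \<and> tr (c / b) = 0")
    case True
    have tr0: "tr (?x y * cj y) = 0" for y
    proof -
      have "?x y * cj y = (- (y * cj y) / 2) * (c / b)" by simp
      also have "tr \<dots> = (- (y * cj y) / 2) * tr (c / b)"
        by (intro tr_scale K_simps norm_in_K)
      finally show ?thesis using True by simp
    qed
    have "bij_betw (\<lambda>y. (?x y, y)) (- {0}) {(x, y) \<in> ?S. y \<noteq> 0}"
    proof (rule bij_betw_byWitness[of _ snd])
      have "x = ?x y" if "(x, y) \<in> ?S" "y \<noteq> 0" for x y
      proof -
        have "2 * b * x + c * y = 0" using that unfolding eq by simp
        then have "2 * b * x = - c * y" by (simp add: add_eq_0_iff2)
        then show ?thesis using True by (simp add: field_simps)
      qed
      then show "\<forall>a'\<in>{(x, y) \<in> ?S. y \<noteq> 0}. (?x (snd a'), snd a') = a'" by auto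
      show "(\<lambda>y. (?x y, y)) ` (- {0}) \<subseteq> {(x, y) \<in> ?S. y \<noteq> 0}"
        using True tr0 unfolding eq by (intro image_subsetI) simp
    qed auto
    then have "card {(x, y) \<in> ?S. y \<noteq> 0} = card (- {0::'k})" by (simp add: bij_betw_same_card)
    then show ?thesis using True by (simp add: Compl_eq_Diff_UNIV card_Diff_subset cardk)
  next
    case False
    have "{(x, y) \<in> ?S. y \<noteq> 0} = {}"
    proof (rule ccontr)
      assume "{(x, y) \<in> ?S. y \<noteq> 0} \<noteq> {}"
      then obtain x y where xy: "2 * b * x + c * y = 0" "tr (x * cj y) = 0" "y \<noteq> 0"
        unfolding eq by auto
      have b: "b \<noteq> 0" using xy assms by auto
      have "c / b = - 2 * x / y" using xy b by (simp add: field_simps add_eq_0_iff2)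
      also have "\<dots> = (- 2 / (y * cj y)) * (x * cj y)" using xy by simp
      also have "tr \<dots> = (- 2 / (y * cj y)) * tr (x * cj y)"
        by (intro tr_scale K_simps norm_in_K)
      finally show False using xy b False by simp
    qed
    then have "card {(x, y) \<in> ?S. y \<noteq> 0} = 0" by (simp only: card.empty)
    then show ?thesis by (simp only: if_not_P[OF False])
  qed
  ultimately show ?thesis using q_pos by (simp add: card_cartesian_product cardk)
qed

text \<open>Conjugating the equation and substituting it into the result eliminates
  \<open>cj y\<close> and leaves a linear equation with the factor
  \<open>1 - b * cj b\<close>.\<close>

lemma card_semilinear_unique:
  assumes "b * cj b \<noteq> 1"
  shows "{y. cj y = b * y + d} = {(cj b * d + cj d) / (1 - b * cj b)}"
proof -
  have b: "1 - b * cj b \<noteq> 0" using assms by simp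
  have "y = (cj b * d + cj d) / (1 - b * cj b)" if y: "cj y = b * y + d" for y
  proof -
    have "y = cj b * cj y + cj d" using arg_cong[OF y, of cj] by simp
    then have "y = cj b * (b * y + d) + cj d" using y by simp
    then have "y * (1 - b * cj b) = cj b * d + cj d" by (simp add: algebra_simps)
    then show ?thesis using b by (simp add: field_simps)
  qed
  moreover have "cj ((cj b * d + cj d) / (1 - b * cj b)) = b * ((cj b * d + cj d) / (1 - b * cj b)) + d"
  proof -
    have "cj (1 - b * cj b) = 1 - b * cj b" by (simp add: mult.commute)
    then have "cj ((cj b * d + cj d) / (1 - b * cj b)) = (b * cj d + d) / (1 - b * cj b)"
      by simp
    also have "\<dots> = b * ((cj b * d + cj d) / (1 - b * cj b)) + d" using b by (simp add: field_simps)
    finally show ?thesis .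
  qed
  ultimately show ?thesis by blast
qed

lemma card_quadratic_K:
  assumes K: "A \<in> K" "B \<in> K" "C \<in> K"
  shows "A \<noteq> 0 \<Longrightarrow> card {t \<in> K. A * t ^ 2 + B * t + C = 0} \<in> {0, 1, 2}"
    and "A = 0 \<Longrightarrow> card {t \<in> K. A * t ^ 2 + B * t + C = 0} \<in> {0, 1, q}"
proof -
  assume A: "A \<noteq> 0"
  let ?p = "[:C, B, A:]"
  have "?p \<noteq> 0" "degree ?p = 2" using A by auto
  then have "card {t. poly ?p t = 0} \<le> 2" "finite {t. poly ?p t = 0}"
    using card_poly_roots_bound[of ?p] by (simp_all add: poly_roots_finite)
  moreover have "{t \<in> K. A * t ^ 2 + B * t + C = 0} \<subseteq> {t. poly ?p t = 0}"
    by (auto simp: algebra_simps power2_eq_square)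
  ultimately have "card {t \<in> K. A * t ^ 2 + B * t + C = 0} \<le> 2"
    by (meson card_mono order_trans)
  then show "card {t \<in> K. A * t ^ 2 + B * t + C = 0} \<in> {0, 1, 2}" by force
next
  assume A: "A = 0"
  show "card {t \<in> K. A * t ^ 2 + B * t + C = 0} \<in> {0, 1, q}"
  proof (cases "B = 0")
    case True
    then have "{t \<in> K. A * t ^ 2 + B * t + C = 0} = (if C = 0 then K else {})" using A by auto
    then show ?thesis by simp
  next
    case False
    then have "A * t ^ 2 + B * t + C = 0 \<longleftrightarrow> t = - C / B" for t
      using A by (auto simp: field_simps add_eq_0_iff2)
    moreover have "- C / B \<in> K" using K by (intro K_simps)
    ultimately have "{t \<in> K. A * t ^ 2 + B * t + C = 0} = {- C / B}" by auto
    then show ?thesis by simp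
  qed
qed

definition cone_sizes :: "int set" where
  "cone_sizes = insert (int q ^ 3 + 2 * int q ^ 2 - int q + 1) generic_sizes"

definition hyperbolic_sizes :: "int set" where
  "hyperbolic_sizes = (let q = int q in {q^2 + 1, q^3 + 2 * q^2 + 1, q^3 + 3 * q^2 - q + 1, 2 * q^3 + q^2 + 1})
    \<union> cone_sizes"

lemmas sizes_defs = hyperbolic_sizes_def cone_sizes_def generic_sizes_def Let_def

text \<open>The number \<open>n\<close> of shared lines and the number \<open>s\<close> of
  exceptional \<open>y\<close> are linked. If \<open>b\<close> has norm 1 and \<open>?Y\<close> is
  nonempty, then \<open>?Y\<close> is a line over \<open>K\<close> on which \<open>?g\<close> is a
  polynomial of degree at most 2; its quadratic coefficient vanishes exactly when n = 2. So s = 2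
  goes only with n = 1, and s = q only with n = 2.\<close>

lemma total_count_linear:
  assumes bc: "b \<noteq> 0 \<or> c \<noteq> 0"
  shows "int (total_count 0 b c d e f) \<in> hyperbolic_sizes"
    and "b = 0 \<Longrightarrow> int (total_count 0 b c d e f) \<in> cone_sizes"
proof -
  let ?Y = "{y. cj y = b * y + d}" and ?g = "\<lambda>y. tr (c / 2 * y ^ 2 + e * y + f)"
  define s where "s = card {y. cj y = b * y + d \<and> ?g y = 0}"
  define N where "N = aff_count 0 b c d e f"
  define n :: nat where "n = (if b \<noteq> 0 \<and> tr (c / b) = 0 then 2 else 1)"
  have M: "int (total_count 0 b c d e f) = int N + 1 + int q ^ 2 * int n"
    unfolding N_def n_def using total_count_eqI[OF inf_count_linear[OF bc]] by simp
  have N: "int N + int q * int (card ?Y) = int q ^ 3 + int q ^ 2 * int s"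
    unfolding N_def s_def using arg_cong[OF aff_count_linear, of int] by simp
  have gen: "int (total_count 0 b c d e f) \<in> hyperbolic_sizes \<and> (n = 1 \<longrightarrow> int (total_count 0 b c d e f) \<in> cone_sizes)"
    if "b * cj b \<noteq> 1"
  proof -
    let ?y = "(cj b * d + cj d) / (1 - b * cj b)"
    have Y: "?Y = {?y}" by (rule card_semilinear_unique[OF that])
    then have "{y. cj y = b * y + d \<and> ?g y = 0} \<subseteq> {?y}" by blast
    then have "s \<in> {0, 1}" unfolding s_def by (auto dest!: subset_singletonD)
    then have "int N = int q ^ 3 - int q \<or> int N = int q ^ 3 + int q ^ 2 - int q" using N Y by auto
    moreover have "n = 1 \<or> n = 2" by (simp add: n_def)
    ultimately show ?thesis
      unfolding M sizes_defs by (elim disjE) simp_all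
  qed
  show "b = 0 \<Longrightarrow> int (total_count 0 b c d e f) \<in> cone_sizes"
    using gen by (simp add: n_def)
  show "int (total_count 0 b c d e f) \<in> hyperbolic_sizes"
  proof (cases "b * cj b = 1")
    case False then show ?thesis using gen by blast
  next
    case b1: True
    then have b0: "b \<noteq> 0" by auto
    \<comment> \<open>Hilbert 90 for the quadratic extension: \<open>1 + cj b\<close> works unless
      it is 0, that is b = -1, where \<delta> works.\<close>
    have "\<exists>u. u \<noteq> 0 \<and> cj u = b * u"
    proof (cases "b = - 1")
      case True then show ?thesis using \<delta> by (intro exI[of _ \<delta>]) simp
    next
      case False
      then have "1 + cj b \<noteq> 0" by (metis add_eq_0_iff cj_1 cj_cj cj_uminus)
      then show ?thesis using b1 by (intro exI[of _ "1 + cj b"]) (simp add: algebra_simps)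
    qed
    then obtain u where u: "u \<noteq> 0" "cj u = b * u" by blast
    show ?thesis
    proof (cases "?Y = {}")
      case True
      then have "int N = int q ^ 3" using N by (simp add: s_def)
      then show ?thesis
        unfolding M sizes_defs n_def by simp
    next
      case False
      then obtain y1 where y1: "cj y1 = b * y1 + d" by blast
      have inj: "inj_on (\<lambda>t. y1 + t * u) A" for A using u by (auto simp: inj_on_def)
      have Y: "cj y = b * y + d \<longleftrightarrow> (\<exists>t\<in>K. y = y1 + t * u)" for y
      proof
        assume y: "cj y = b * y + d"
        have "cj (y - y1) = b * (y - y1)" using y y1 by (simp add: algebra_simps)
        then have "(y - y1) / u \<in> K" using u b0 by (simp add: K_iff)
        moreover have "y = y1 + (y - y1) / u * u" using u by simp
        ultimately show "\<exists>t\<in>K. y = y1 + t * u" by blast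
      qed (use u y1 in \<open>auto simp: K_iff algebra_simps\<close>)
      then have "?Y = (\<lambda>t. y1 + t * u) ` K" by blast
      then have cY: "card ?Y = q" by (simp add: card_image inj)
      let ?A = "tr (c / 2 * u ^ 2)" and ?B = "tr (c * y1 * u + e * u)" and ?C = "?g y1"
      have g: "?g (y1 + t * u) = ?A * t ^ 2 + ?B * t + ?C" if "t \<in> K" for t
      proof -
        have "tr (h * (y1 + t * u) ^ 2 + e * (y1 + t * u) + f)
            = tr (h * u ^ 2) * t ^ 2 + tr (2 * h * y1 * u + e * u) * t + tr (h * y1 ^ 2 + e * y1 + f)" for h
          using that by (simp add: tr_def K_iff power2_eq_square algebra_simps)
        from this[of "c / 2"] show ?thesis by simp
      qed
      have "{y. cj y = b * y + d \<and> ?g y = 0} = (\<lambda>t. y1 + t * u) ` {t \<in> K. ?A * t ^ 2 + ?B * t + ?C = 0}"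
        unfolding Y using g by (auto simp del: tr_simps)
      then have s: "s = card {t \<in> K. ?A * t ^ 2 + ?B * t + ?C = 0}" by (simp only: s_def card_image[OF inj])
      have "?A = u * cj u / 2 * tr (c / b)"
      proof -
        have "c / 2 * u ^ 2 = (u * cj u / 2) * (c / b)" using u b0 by (simp add: power2_eq_square)
        then show ?thesis by (simp only:) (intro tr_scale K_simps norm_in_K)
      qed
      then have "n = 2 \<longleftrightarrow> ?A = 0" "n = 1 \<or> n = 2" using u b0 by (auto simp: n_def)
      then have "n = 1 \<and> s \<in> {0, 1, 2} \<or> n = 2 \<and> s \<in> {0, 1, q}"
        unfolding s using card_quadratic_K[of ?A ?B ?C] by auto
      moreover have "int N = int q ^ 3 - int q ^ 2 + int q ^ 2 * int s"
        using N cY by (simp add: power2_eq_square)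
      moreover have "int q ^ 2 * int q = int q ^ 3" by (simp add: power2_eq_square power3_eq_cube)
      ultimately show ?thesis
        unfolding M sizes_defs by (elim disjE conjE insertE) (simp_all del: of_nat_power)
    qed
  qed
qed

end

section \<open>Reduction to normal form\<close>

lemma span_singleton_in_pg_points: "v \<noteq> 0 \<Longrightarrow> vec.span {v} \<in> pg_points"
  by (simp add: pg_points_def)

lemma range_scale_in_pg_points: "v \<noteq> 0 \<Longrightarrow> range (\<lambda>k. k *s v) \<in> pg_points"
  using span_singleton_in_pg_points[of v] by (simp add: vec.span_singleton)

lemma pg_pointsE:
  assumes "P \<in> pg_points"
  obtains v where "v \<noteq> 0" "P = vec.span {v}"
proof -
  have P: "vec.subspace P" "vec.dim P = 1" using assms by (auto simp: pg_points_def)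
  then have "\<not> P \<subseteq> {0}" by (metis vec.dim_eq_0 zero_neq_one)
  then obtain v where v: "v \<in> P" "v \<noteq> 0" by blast
  have "vec.span {v} = P"
    using v P by (intro vec.subspace_dim_equal) (auto simp: vec.span_minimal)
  then show thesis using v that by blast
qed

lemma span_singleton_eq_iff:
  fixes v w :: "'k::field ^ 4"
  assumes "w \<noteq> 0"
  shows "v \<noteq> 0 \<and> vec.span {v} = vec.span {w} \<longleftrightarrow> v \<in> vec.span {w} - {0}"
proof
  assume v: "v \<in> vec.span {w} - {0}"
  have "vec.span {v} = vec.span {w}"
    using v assms by (intro vec.subspace_dim_equal) (auto simp: vec.span_minimal)
  then show "v \<noteq> 0 \<and> vec.span {v} = vec.span {w}" using v by blast
next
  assume v: "v \<noteq> 0 \<and> vec.span {v} = vec.span {w}"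
  have "v \<in> vec.span {v}" by (simp add: vec.span_base)
  then show "v \<in> vec.span {w} - {0}" using v by auto
qed

text \<open>Each point has \<open>CARD('k) - 1\<close> generators, so points can be counted through
  nonzero vectors.\<close>

lemma card_points_times:
  fixes \<Phi> :: "'k::{field,finite} ^ 4 \<Rightarrow> bool"
  assumes \<Phi>: "\<And>c v. \<Phi> v \<Longrightarrow> \<Phi> (c *s v)"
  shows "card {P \<in> pg_points. \<forall>v\<in>P. \<Phi> v} * (CARD('k) - 1) = card {v. v \<noteq> 0 \<and> \<Phi> v}"
proof -
  let ?A = "{v. v \<noteq> 0 \<and> \<Phi> v}" and ?B = "{P \<in> pg_points. \<forall>v\<in>P. \<Phi> v}"
  have fib: "card {v \<in> ?A. vec.span {v} = P} = CARD('k) - 1" if P: "P \<in> ?B" for P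
  proof -
    obtain w where w: "w \<noteq> 0" "P = vec.span {w}" using P pg_pointsE by blast
    have "{v \<in> ?A. vec.span {v} = P} = P - {0}"
      using P span_singleton_eq_iff[OF w(1)] unfolding w(2) by blast
    moreover have "bij_betw (\<lambda>c. c *s w) UNIV P"
      using w by (auto simp: bij_betw_def inj_on_def vec.span_singleton)
    then have "card P = CARD('k)" using bij_betw_same_card by force
    moreover have "0 \<in> P" using w by (simp add: vec.span_zero)
    ultimately show ?thesis by (simp add: card_Diff_singleton)
  qed
  have "card ?A = (\<Sum>P\<in>?B. card {v \<in> ?A. vec.span {v} = P})"
  proof -
    have "(\<lambda>v. vec.span {v}) ` ?A \<subseteq> ?B"
      using \<Phi> by (auto simp: range_scale_in_pg_points vec.span_singleton)
    then show ?thesis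
      using sum.group[of ?A ?B "\<lambda>v. vec.span {v}" "\<lambda>_. 1::nat"] by simp
  qed
  also have "\<dots> = card ?B * (CARD('k) - 1)" using fib by simp
  finally show ?thesis by simp
qed

section \<open>The bilinear form of a quadric\<close>

lemma bil_add_left: "bil A (u + v) w = bil A u w + bil A v w"
  by (simp add: bil_def sum.distrib algebra_simps)
lemma bil_add_right: "bil A w (u + v) = bil A w u + bil A w v"
  by (simp add: bil_def sum.distrib algebra_simps)
lemma bil_scale_left: "bil A (c *s u) w = c * bil A u w"
  by (simp add: bil_def sum_distrib_left algebra_simps)
lemma bil_scale_right: "bil A w (c *s u) = c * bil A w u"
  by (simp add: bil_def sum_distrib_left algebra_simps)

lemma bil_uminus_left: "bil A (- u) w = - bil A u w"
  by (simp add: bil_def sum_negf)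
lemma bil_uminus_right: "bil A w (- u) = - bil A w u"
  by (simp add: bil_def sum_negf)
lemma bil_diff_left: "bil A (u - v) w = bil A u w - bil A v w"
  by (simp add: bil_def sum_subtractf algebra_simps)
lemma bil_diff_right: "bil A w (u - v) = bil A w u - bil A w v"
  by (simp add: bil_def sum_subtractf algebra_simps)
lemma bil_zero_right: "bil A w 0 = 0"
  by (simp add: bil_def)

lemma bil_commute:
  assumes "transpose A = A"
  shows "bil A u v = bil A v u"
proof -
  have A: "A $ i $ j = A $ j $ i" for i j
  proof -
    have "A $ i $ j = transpose A $ j $ i" by (simp add: transpose_def)
    then show ?thesis by (simp only: assms)
  qed
  have "bil A u v = (\<Sum>j\<in>UNIV. \<Sum>i\<in>UNIV. u $ i * A $ i $ j * v $ j)"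
    unfolding bil_def by (rule sum.swap)
  also have "\<dots> = bil A v u"
    unfolding bil_def
  proof (intro sum.cong refl)
    fix i j show "u $ i * A $ i $ j * v $ j = v $ j * A $ j $ i * u $ i"
      unfolding A[of i j] by (simp add: mult_ac)
  qed
  finally show ?thesis .
qed

lemma bil_eq: "bil A u v = (\<Sum>i\<in>UNIV. u $ i * (A *v v) $ i)"
  by (simp add: bil_def matrix_vector_mult_def sum_distrib_left mult.assoc)

lemma quadric_span_iff: "v \<noteq> 0 \<Longrightarrow> vec.span {v} \<in> quadric A \<longleftrightarrow> bil A v v = 0"
  by (auto simp: quadric_def range_scale_in_pg_points vec.span_singleton bil_scale_left bil_scale_right
      intro: exI[of _ 1] dest: spec[of _ 1])

lemma contained_in_quadric_bil:
  assumes "contained_in_quadric W A" "vec.subspace W" "v \<in> W"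
  shows "bil A v v = 0"
proof (cases "v = 0")
  case False
  have "vec.span {v} \<subseteq> W" using assms by (simp add: vec.span_minimal)
  then have "vec.span {v} \<in> quadric A"
    using assms False by (simp add: contained_in_quadric_def span_singleton_in_pg_points)
  then show ?thesis using False quadric_span_iff by blast
qed (simp add: bil_def)

context hermitian_field
begin

section \<open>The Hermitian form over the field with conjugation\<close>

lemma cj_sum: "cj (sum g S) = (\<Sum>i\<in>S. cj (g i))"
  by (induction S rule: infinite_finite_induct) auto

lemma herm_eq_cj: "herm q H u v = (\<Sum>i\<in>UNIV. \<Sum>j\<in>UNIV. u $ i * H $ i $ j * cj (v $ j))"
  by (simp add: herm_def cj_def)

lemma herm_add_left: "herm q H (u + v) w = herm q H u w + herm q H v (w :: 'k ^ 4)"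
  by (simp add: herm_def sum.distrib algebra_simps)
lemma herm_add_right: "herm q H w (u + v) = herm q H w u + herm q H w (v :: 'k ^ 4)"
  by (simp add: herm_eq_cj sum.distrib algebra_simps)
lemma herm_scale_left: "herm q H (c *s u) w = c * herm q H u (w :: 'k ^ 4)"
  by (simp add: herm_def sum_distrib_left algebra_simps)
lemma herm_scale_right: "herm q H w (c *s u) = cj c * herm q H w (u :: 'k ^ 4)"
  by (simp add: herm_eq_cj sum_distrib_left algebra_simps)

lemma herm_diff_left: "herm q H (u - v) w = herm q H u w - herm q H v (w :: 'k ^ 4)"
  by (simp add: herm_def sum_subtractf algebra_simps)
lemma herm_diff_right: "herm q H w (u - v) = herm q H w u - herm q H w (v :: 'k ^ 4)"
  by (simp add: herm_eq_cj sum_subtractf algebra_simps)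
lemma herm_uminus_left: "herm q H (- u) w = - herm q H u (w :: 'k ^ 4)"
  by (simp add: herm_def sum_negf)
lemma herm_uminus_right: "herm q H w (- u) = - herm q H w (u :: 'k ^ 4)"
  by (simp add: herm_eq_cj sum_negf)

lemmas herm_linear = herm_add_left herm_add_right herm_scale_left herm_scale_right
  herm_diff_left herm_diff_right herm_uminus_left herm_uminus_right
lemmas bil_linear = bil_add_left bil_add_right bil_scale_left bil_scale_right
  bil_diff_left bil_diff_right bil_uminus_left bil_uminus_right

lemma hermitian_surface_span_iff:
  "v \<noteq> 0 \<Longrightarrow> vec.span {v} \<in> hermitian_surface q H \<longleftrightarrow> herm q H v (v :: 'k ^ 4) = 0"
  by (auto simp: hermitian_surface_def range_scale_in_pg_points vec.span_singleton herm_linear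
      intro: exI[of _ 1] dest: spec[of _ 1])

definition quad :: "'k \<Rightarrow> 'k \<Rightarrow> 'k \<Rightarrow> 'k \<Rightarrow> 'k \<Rightarrow> 'k \<Rightarrow> 'k \<Rightarrow> 'k \<Rightarrow> 'k \<Rightarrow> 'k \<Rightarrow> 'k" where
  "quad a b c d e f t x y z = a * x ^ 2 + 2 * b * x * y + c * y ^ 2 + 2 * d * x * t + 2 * e * y * t
    + 2 * f * t ^ 2 - 2 * z * t"

text \<open>Nonzero common zeros are counted in the coordinates given by \<open>T\<close> and
  divided by q^2 - 1. \<open>T\<close> enters as a bijection that matches zero sets, which spares
  transforming the matrices.\<close>

lemma card_intersection_eq_total_count:
  fixes T :: "'k \<times> 'k \<times> 'k \<times> 'k \<Rightarrow> 'k ^ 4"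
  assumes T: "bij T" "T (0, 0, 0, 0) = 0"
    and h: "\<And>t x y z. herm q H (T (t, x, y, z)) (T (t, x, y, z)) = 0 \<longleftrightarrow> tr (z * cj t - x * cj y) = 0"
    and b: "\<And>t x y z. bil A (T (t, x, y, z)) (T (t, x, y, z)) = 0 \<longleftrightarrow> quad a b c d e f t x y z = 0"
  shows "card (hermitian_surface q H \<inter> quadric A) = total_count a b c d e f"
proof -
  let ?M = "card (hermitian_surface q H \<inter> quadric A)"
  let ?N = "aff_count a b c d e f" and ?W = "inf_count a b c"
  let ?\<Phi> = "\<lambda>v. herm q H v v = 0 \<and> bil A v v = 0"
  let ?\<Psi> = "\<lambda>t x y z. tr (z * cj t - x * cj y) = 0 \<and> quad a b c d e f t x y z = 0"
  have Q1: "q ^ 2 > 1" using q_ge_3 by (intro one_less_power) auto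
  have "hermitian_surface q H \<inter> quadric A = {P \<in> pg_points. \<forall>v\<in>P. ?\<Phi> v}"
    by (auto simp: hermitian_surface_def quadric_def)
  then have "?M * (q ^ 2 - 1) = card {v. v \<noteq> 0 \<and> ?\<Phi> v}"
    using card_points_times[of ?\<Phi>] by (simp add: herm_linear bil_linear cardk)
  also have "\<dots> = card {(t, x, y, z). (t, x, y, z) \<noteq> (0, 0, 0, 0) \<and> ?\<Psi> t x y z}"
  proof -
    have "T s = 0 \<longleftrightarrow> s = (0, 0, 0, 0)" for s
      using T by (metis bij_is_inj injD)
    then have "T ` {(t, x, y, z). (t, x, y, z) \<noteq> (0, 0, 0, 0) \<and> ?\<Psi> t x y z} \<subseteq> {v. v \<noteq> 0 \<and> ?\<Phi> v}"
      by (auto simp: h b)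
    moreover have "v \<in> T ` {(t, x, y, z). (t, x, y, z) \<noteq> (0, 0, 0, 0) \<and> ?\<Psi> t x y z}" if v: "v \<noteq> 0" "?\<Phi> v" for v
    proof -
      obtain t x y z where "v = T (t, x, y, z)" using T(1) by (metis bij_pointE prod.collapse)
      moreover from this have "(t, x, y, z) \<noteq> (0, 0, 0, 0)" using v T(2) by metis
      ultimately show ?thesis using v h[of t x y z] b[of t x y z] by blast
    qed
    ultimately have "{v. v \<noteq> 0 \<and> ?\<Phi> v} = T ` {(t, x, y, z). (t, x, y, z) \<noteq> (0, 0, 0, 0) \<and> ?\<Psi> t x y z}"
      by blast
    then show ?thesis using T(1) by (metis (no_types, lifting) card_image bij_is_inj inj_on_subset subset_UNIV)
  qed
  also have "\<dots> = card {(t, x, y, z). t \<noteq> 0 \<and> ?\<Psi> t x y z}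
      + card {(t, x, y, z). t = 0 \<and> (t, x, y, z) \<noteq> (0, 0, 0, 0) \<and> ?\<Psi> t x y z}"
  proof -
    have "{(t, x, y, z). (t, x, y, z) \<noteq> (0, 0, 0, 0) \<and> ?\<Psi> t x y z} = {(t, x, y, z). t \<noteq> 0 \<and> ?\<Psi> t x y z}
      \<union> {(t, x, y, z). t = 0 \<and> (t, x, y, z) \<noteq> (0, 0, 0, 0) \<and> ?\<Psi> t x y z}" by blast
    moreover have "{(t, x, y, z). t \<noteq> 0 \<and> ?\<Psi> t x y z}
      \<inter> {(t, x, y, z). t = 0 \<and> (t, x, y, z) \<noteq> (0, 0, 0, 0) \<and> ?\<Psi> t x y z} = {}" by blast
    ultimately show ?thesis by (simp only: card_Un_disjoint[OF finite finite])
  qed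
  \<comment> \<open>Dividing by \<open>t\<close> scales the quadratic equation by a square and the
    Hermitian one by a norm. What is left is an affine zero \<open>(x, y)\<close>, with
    \<open>z\<close> determined by it, and q^2 - 1 choices of \<open>t\<close>.\<close>
  also have "card {(t, x, y, z). t \<noteq> 0 \<and> ?\<Psi> t x y z} = (q ^ 2 - 1) * ?N"
  proof -
    let ?z = "\<lambda>x y. a / 2 * x ^ 2 + b * x * y + c / 2 * y ^ 2 + d * x + e * y + f"
    let ?S = "{(x, y). aff a b c d e f x y = 0}"
    have quad: "quad a b c d e f t (t * x) (t * y) (t * z) = 2 * t ^ 2 * (?z x y - z)" for t x y z
      by (simp add: quad_def power2_eq_square algebra_simps)
    have tr: "tr (t * z * cj t - t * x * cj (t * y)) = t * cj t * tr (z - x * cj y)" for t x y z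
    proof -
      have "t * z * cj t - t * x * cj (t * y) = (t * cj t) * (z - x * cj y)" by (simp add: algebra_simps)
      then show ?thesis using tr_scale[of "t * cj t"] by simp
    qed
    have "bij_betw (\<lambda>(t, x, y). (t, t * x, t * y, t * ?z x y)) ((- {0}) \<times> ?S) {(t, x, y, z). t \<noteq> 0 \<and> ?\<Psi> t x y z}"
      unfolding bij_betw_def
    proof
      show "inj_on (\<lambda>(t, x, y). (t, t * x, t * y, t * ?z x y)) ((- {0}) \<times> ?S)"
        by (auto simp: inj_on_def)
      show "(\<lambda>(t, x, y). (t, t * x, t * y, t * ?z x y)) ` ((- {0}) \<times> ?S) = {(t, x, y, z). t \<noteq> 0 \<and> ?\<Psi> t x y z}"
      proof (intro equalityI subsetI)
        fix s assume "s \<in> (\<lambda>(t, x, y). (t, t * x, t * y, t * ?z x y)) ` ((- {0}) \<times> ?S)"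
        then obtain t x y where s: "s = (t, t * x, t * y, t * ?z x y)" "t \<noteq> 0" "aff a b c d e f x y = 0"
          by auto
        then have "?\<Psi> t (t * x) (t * y) (t * ?z x y)"
          unfolding tr quad aff_def by simp
        then show "s \<in> {(t, x, y, z). t \<noteq> 0 \<and> ?\<Psi> t x y z}" using s by simp
      next
        fix s assume "s \<in> {(t, x, y, z). t \<noteq> 0 \<and> ?\<Psi> t x y z}"
        then obtain t x' y' z' where s: "s = (t, x', y', z')" "t \<noteq> 0" "?\<Psi> t x' y' z'" by auto
        define x y z where "x = x' / t" and "y = y' / t" and "z = z' / t"
        have s': "x' = t * x" "y' = t * y" "z' = t * z" using s(2) by (simp_all add: x_def y_def z_def)
        have "z = ?z x y" using s(3) s(2) unfolding s' quad by simp
        moreover have "tr (z - x * cj y) = 0" using s(3) s(2) unfolding s' tr by simp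
        ultimately have "aff a b c d e f x y = 0" unfolding aff_def by simp
        then show "s \<in> (\<lambda>(t, x, y). (t, t * x, t * y, t * ?z x y)) ` ((- {0}) \<times> ?S)"
          using s(1,2) s' \<open>z = ?z x y\<close> by (intro image_eqI[of _ _ "(t, x, y)"]) auto
      qed
    qed
    then have "card {(t, x, y, z). t \<noteq> 0 \<and> ?\<Psi> t x y z} = card ((- {0::'k}) \<times> ?S)"
      by (simp add: bij_betw_same_card)
    then show ?thesis by (simp add: card_cartesian_product aff_count_def Compl_eq_Diff_UNIV card_Diff_subset cardk)
  qed
  \<comment> \<open>In this plane \<open>z\<close> is free; the subtracted 1 is the zero
    vector.\<close>
  also have "card {(t, x, y, z). t = 0 \<and> (t, x, y, z) \<noteq> (0, 0, 0, 0) \<and> ?\<Psi> t x y z} = q ^ 2 * ?W - 1"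
  proof -
    let ?S = "{(x, y). a * x ^ 2 + 2 * b * x * y + c * y ^ 2 = 0 \<and> tr (x * cj y) = 0}"
    have "bij_betw (\<lambda>((x, y), z). (0, x, y, z)) (?S \<times> UNIV - {((0, 0), 0)})
        {(t, x, y, z). t = 0 \<and> (t, x, y, z) \<noteq> (0, 0, 0, 0) \<and> ?\<Psi> t x y z}"
      by (rule bij_betw_byWitness[of _ "\<lambda>(t, x, y, z). ((x, y), z)"]) (auto simp: quad_def)
    then have "card {(t, x, y, z). t = 0 \<and> (t, x, y, z) \<noteq> (0, 0, 0, 0) \<and> ?\<Psi> t x y z}
        = card (?S \<times> (UNIV::'k set) - {((0, 0), 0)})"
      by (simp add: bij_betw_same_card)
    also have "\<dots> = card (?S \<times> (UNIV::'k set)) - 1"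
      by (subst card_Diff_singleton) auto
    finally show ?thesis by (simp add: card_cartesian_product cardk inf_count_def mult.commute)
  qed
  finally have M: "?M * (q ^ 2 - 1) = (q ^ 2 - 1) * ?N + (q ^ 2 * ?W - 1)" .
  then have "(q ^ 2 * ?W - 1) div (q ^ 2 - 1) + ?N = ?M * (q ^ 2 - 1) div (q ^ 2 - 1)"
    using Q1 by simp
  then show ?thesis using Q1 by (simp add: total_count_def)
qed

section \<open>A basis adapted to the point of tangency\<close>

lemma exists_in_kernel:
  fixes g g' :: "'k ^ 4 \<Rightarrow> 'k"
  assumes g: "\<And>u v. g (u - v) = g u - g v" and g': "\<And>u v. g' (u - v) = g' u - g' v"
    and P: "card P \<le> q ^ 2"
  shows "\<exists>v. v \<notin> P \<and> g v = 0 \<and> g' v = 0"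
proof (rule ccontr)
  let ?ker = "{v. (g v, g' v) = (0, 0)}"
  assume "\<not> ?thesis"
  then have "?ker \<subseteq> P" by blast
  then have ker: "card ?ker \<le> q ^ 2" using P card_mono[of P ?ker] by simp
  have le: "card {v. (g v, g' v) = s} \<le> card ?ker" for s
  proof (cases "{v. (g v, g' v) = s} = {}")
    case False
    then obtain u where u: "(g u, g' u) = s" by blast
    show ?thesis
      by (rule card_inj_on_le[of "\<lambda>v. v - u"]) (use u in \<open>auto simp: inj_on_def g g'\<close>)
  qed simp
  \<comment> \<open>With at most q^2 vectors in each of the q^4 fibres, the whole space of q^8
    vectors could not be covered.\<close>
  have "(q ^ 2) ^ 4 = card (UNIV :: ('k ^ 4) set)" by (simp add: cardk)
  also have "\<dots> = (\<Sum>s\<in>UNIV. card {v. (g v, g' v) = s})"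
    using sum.group[of "UNIV :: ('k ^ 4) set" UNIV "\<lambda>v. (g v, g' v)" "\<lambda>_. 1::nat"] by simp
  also have "\<dots> \<le> (\<Sum>s\<in>(UNIV :: ('k \<times> 'k) set). q ^ 2)"
    by (intro sum_mono order_trans[OF le ker])
  also have "\<dots> = (q ^ 2) ^ 3" by (simp add: card_cartesian_product cardk power3_eq_cube flip: UNIV_Times_UNIV)
  finally have "(q ^ 2) ^ 4 \<le> (q ^ 2) ^ 3" .
  moreover have "q ^ 2 > 1" using q_ge_3 by (intro one_less_power) auto
  ultimately have "4 \<le> (3::nat)" by (intro power_le_imp_le_exp)
  then show False by simp
qed

lemma herm_cj:
  fixes H :: "'k ^ 4 ^ 4"
  assumes "nondegenerate_hermitian_matrix q H"
  shows "cj (herm q H u v) = herm q H v u"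
proof -
  have H: "cj (H $ i $ j) = H $ j $ i" for i j
    using assms unfolding nondegenerate_hermitian_matrix_def cj_def by (blast intro: sym)
  have "cj (herm q H u v) = (\<Sum>i\<in>UNIV. \<Sum>j\<in>UNIV. v $ j * H $ j $ i * cj (u $ i))"
    by (simp add: herm_eq_cj cj_sum H mult_ac)
  also have "\<dots> = herm q H v u" unfolding herm_eq_cj by (rule sum.swap)
  finally show ?thesis .
qed

lemma herm_nondegenerate:
  fixes H :: "'k ^ 4 ^ 4"
  assumes H: "nondegenerate_hermitian_matrix q H" and v: "\<And>u. herm q H u v = 0"
  shows "v = 0"
proof -
  let ?w = "\<chi> j. cj (v $ j)"
  have "(H *v ?w) $ i = 0" for i
  proof -
    have "herm q H (axis i 1) v = (\<Sum>j\<in>UNIV. H $ i $ j * cj (v $ j))"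
      unfolding herm_eq_cj by (subst sum.remove[of _ i]) (auto simp: axis_def)
    then show ?thesis using v[of "axis i 1"] by (simp add: matrix_vector_mult_def)
  qed
  then have "H *v ?w = 0" by (simp add: vec_eq_iff)
  moreover have "invertible H"
    using H by (simp add: invertible_det_nz nondegenerate_hermitian_matrix_def)
  ultimately have "?w = 0" using matrix_left_invertible_ker invertible_left_inverse by blast
  then show ?thesis by (simp add: vec_eq_iff)
qed

lemma card_span_singleton_le: "card (vec.span {p :: 'k ^ 4}) \<le> q ^ 2"
  unfolding vec.span_singleton using card_image_le[of UNIV "\<lambda>k. k *s p"] by (simp add: cardk)

text \<open>Take vectors \<open>u\<close> and \<open>u'\<close> orthogonal to \<open>p\<close> and
  to each other. If neither is isotropic, surjectivity of the norm onto \<open>K\<close> gives a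
  \<nu> that makes \<open>u + \<nu> *s u'\<close> isotropic.\<close>

lemma exists_isotropic:
  fixes H :: "'k ^ 4 ^ 4"
  assumes H: "nondegenerate_hermitian_matrix q H" and p: "herm q H p p = 0"
  shows "\<exists>w. w \<notin> vec.span {p} \<and> herm q H w p = 0 \<and> herm q H w w = 0"
proof -
  let ?h = "herm q H"
  note cjh = herm_cj[OF H]
  obtain u where u: "u \<notin> vec.span {p}" "?h u p = 0"
    using exists_in_kernel[of "\<lambda>v. ?h v p" "\<lambda>v. ?h v p" "vec.span {p}"] card_span_singleton_le
    by (auto simp: herm_diff_left)
  obtain u' where u': "u' \<notin> vec.span {p}" "?h u' p = 0" "?h u' u = 0"
    using exists_in_kernel[of "\<lambda>v. ?h v p" "\<lambda>v. ?h v u" "vec.span {p}"] card_span_singleton_le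
    by (auto simp: herm_diff_left)
  have uu': "?h u u' = 0" using cjh[of u' u] u' by simp
  have pu: "?h p u = 0" using cjh[of u p] u by simp
  show ?thesis
  proof (cases "?h u u = 0 \<or> ?h u' u' = 0")
    case True then show ?thesis using u u' by blast
  next
    case False
    have "- ?h u u / ?h u' u' \<in> K" using cjh[of u u] cjh[of u' u'] by (simp add: K_iff)
    then obtain \<nu> where \<nu>: "\<nu> * cj \<nu> = - ?h u u / ?h u' u'" using norm_surj by blast
    let ?w = "u + \<nu> *s u'"
    have "?h ?w ?w = ?h u u + \<nu> * cj \<nu> * ?h u' u'"
      using u' uu' by (simp add: herm_linear algebra_simps)
    then have "?h ?w ?w = 0" using \<nu> False by simp
    moreover have "?h ?w p = 0" using u u' by (simp add: herm_linear)
    \<comment> \<open>Pairing with \<open>u\<close> separates the two: \<open>p\<close> is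
      orthogonal to \<open>u\<close>, while \<open>?w\<close> is not.\<close>
    moreover have "?w \<notin> vec.span {p}"
    proof
      assume "?w \<in> vec.span {p}"
      then obtain k where "?w = k *s p" by (auto simp: vec.span_singleton)
      then have "?h ?w u = 0" using pu by (simp add: herm_linear)
      then show False using False u' by (simp add: herm_linear)
    qed
    ultimately show ?thesis by blast
  qed
qed

text \<open>A Witt decomposition into two hyperbolic planes, spanned by \<open>p\<close>,
  \<open>r\<close> and by \<open>w\<close>, \<open>e\<close>. The value -1 on the second pair
  produces the normal form \<open>tr (z * cj t - x * cj y)\<close>. Self-products lie in
  \<open>K\<close> and can be halved, so adding multiples of \<open>w\<close> and \<open>p\<close>
  makes \<open>e\<close> and \<open>r\<close> isotropic.\<close>

lemma hyperbolic_basis: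
  fixes H :: "'k ^ 4 ^ 4"
  assumes H: "nondegenerate_hermitian_matrix q H" and p: "p \<noteq> 0" "herm q H p p = 0"
    and w: "w \<notin> vec.span {p}" "herm q H w p = 0" "herm q H w w = 0"
  shows "\<exists>r e. herm q H e p = 0 \<and> herm q H e e = 0 \<and> herm q H w e = - 1 \<and>
    herm q H r p = 1 \<and> herm q H r r = 0 \<and> herm q H r w = 0 \<and> herm q H r e = 0"
proof -
  let ?h = "herm q H"
  note cjh = herm_cj[OF H]
  obtain r0 where "?h r0 p \<noteq> 0" using herm_nondegenerate[OF H] p(1) by blast
  define r1 where "r1 = (1 / ?h r0 p) *s r0"
  have r1: "?h r1 p = 1" using \<open>?h r0 p \<noteq> 0\<close> by (simp add: r1_def herm_linear)
  \<comment> \<open>Otherwise some \<open>w\<close> plus a multiple of \<open>p\<close> would be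
    orthogonal to the whole space, and \<open>w\<close> would lie in the span of
    \<open>p\<close>.\<close>
  have "\<exists>u. ?h u p = 0 \<and> ?h u w \<noteq> 0"
  proof (rule ccontr)
    assume none: "\<not> ?thesis"
    let ?w = "w + (- cj (?h r1 w)) *s p"
    have "?h u ?w = 0" for u
    proof -
      let ?u = "u + (- ?h u p) *s r1"
      have "?h ?u p = 0" using r1 by (simp add: herm_linear)
      then have "?h ?u w = 0" using none by blast
      then show ?thesis by (simp add: herm_linear algebra_simps)
    qed
    then have "?w = 0" by (rule herm_nondegenerate[OF H])
    then have "w = cj (?h r1 w) *s p" by (simp add: vec_eq_iff algebra_simps)
    then show False using w(1) by (auto simp: vec.span_singleton)
  qed
  then obtain u0 where u0: "?h u0 p = 0" "?h u0 w \<noteq> 0" by blast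
  define u where "u = (- 1 / ?h u0 w) *s u0"
  have u: "?h u p = 0" "?h u w = - 1" using u0 by (simp_all add: u_def herm_linear)
  have wu: "?h w u = - 1" using cjh[of u w] u by simp
  have pw: "?h p w = 0" using cjh[of w p] w by simp
  have half: "cj (?h v v / 2) = ?h v v / 2" for v using cjh[of v v] by simp
  define e where "e = u + (?h u u / 2) *s w"
  have e: "?h e p = 0" "?h w e = - 1"
    using u wu w by (simp_all add: e_def herm_linear)
  have ee: "?h e e = 0"
    using u wu w half[of u] by (simp add: e_def herm_linear)
  have ew: "?h e w = - 1" using cjh[of w e] e by simp
  have pe: "?h p e = 0" using cjh[of e p] e by simp
  \<comment> \<open>Removes the component of \<open>r1\<close> in the plane of \<open>w\<close> and
    \<open>e\<close>; the plus signs come from the pairing -1.\<close>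
  define r2 where "r2 = r1 + ?h r1 e *s w + ?h r1 w *s e"
  have r2: "?h r2 p = 1" "?h r2 w = 0" "?h r2 e = 0"
    using r1 w e ee ew by (simp_all add: r2_def herm_linear)
  have pr2: "?h p r2 = 1" using cjh[of r2 p] r2 by simp
  define r where "r = r2 + (- ?h r2 r2 / 2) *s p"
  have r: "?h r p = 1" "?h r w = 0" "?h r e = 0"
    using r2 p pw pe by (simp_all add: r_def herm_linear)
  moreover have "?h r r = 0"
    using r2 p pr2 half[of r2] by (simp add: r_def herm_linear)
  ultimately show ?thesis using e ee by blast
qed

text \<open>A quadric with a vertex \<open>v\<close> outside the radical would lie in the plane \<open>v\<^sup>\<bottom>\<close>; but every line
  through \<open>v\<close> that is not in this plane meets the quadric in a second point.\<close>

lemma radical_of_cone: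
  fixes A :: "'k ^ 4 ^ 4"
  assumes cone: "one_degenerate_cone A" and P: "P \<in> quadric A"
  shows "\<exists>v. v \<noteq> 0 \<and> (\<forall>y. bil A v y = 0)"
proof -
  have sym: "bil A u v = bil A v u" for u v
    using cone bil_commute by (auto simp: one_degenerate_cone_def quadric_matrix_def)
  obtain V \<sigma> where V: "V \<in> pg_points"
    and Q: "quadric A = {P \<in> pg_points. \<exists>R\<in>quadric A. R \<subseteq> \<sigma> \<and> P \<subseteq> vec.span (V \<union> R)}"
    using cone unfolding one_degenerate_cone_def by blast
  obtain v where v: "v \<noteq> 0" "V = vec.span {v}" using V pg_pointsE by blast
  have vV: "v \<in> V" using v by (simp add: vec.span_base)
  have "V \<in> quadric A"
  proof -
    obtain R where "R \<in> quadric A" "R \<subseteq> \<sigma>" using P Q by blast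
    moreover have "V \<subseteq> vec.span (V \<union> R)" using vec.span_superset by blast
    ultimately show ?thesis using V Q by blast
  qed
  then have vv: "bil A v v = 0" using v quadric_span_iff by blast
  have perp: "bil A v x = 0" if x: "bil A x x = 0" for x
  proof (cases "x = 0 \<or> v + x = 0")
    case True
    then have "x = 0 \<or> x = - v" by (auto simp: add_eq_0_iff)
    then show ?thesis using vv by (auto simp: bil_uminus_right bil_zero_right)
  next
    case False
    then have "vec.span {x} \<in> quadric A" using x quadric_span_iff by blast
    then obtain R where R: "R \<in> quadric A" "R \<subseteq> \<sigma>" "vec.span {x} \<subseteq> vec.span (V \<union> R)" using Q by blast
    have "x \<in> vec.span (V \<union> R)" using R(3) by (meson vec.span_base singletonI subsetD)
    moreover have "v \<in> vec.span (V \<union> R)" using vV by (simp add: vec.span_base)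
    ultimately have "vec.span {v + x} \<subseteq> vec.span (V \<union> R)"
      by (intro vec.span_minimal) (auto simp: vec.span_add)
    then have "vec.span {v + x} \<in> quadric A"
      using R Q False span_singleton_in_pg_points by blast
    then have "bil A (v + x) (v + x) = 0" using False quadric_span_iff by blast
    then show ?thesis using vv x sym[of x v] by (simp add: bil_linear)
  qed
  have "bil A v y = 0" for y
  proof (rule ccontr)
    assume vy: "bil A v y \<noteq> 0"
    let ?x = "y + (- bil A y y / (2 * bil A v y)) *s v"
    have "bil A ?x ?x = 0" using vv vy sym[of y v] by (simp add: bil_linear)
    then have "bil A v ?x = 0" by (rule perp)
    then show False using vv vy by (simp add: bil_linear)
  qed
  then show ?thesis using v by blast
qed

text \<open>The hyperbolic basis normalizes the Hermitian form. Equality of the tangent planes makes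
  \<open>p\<close> orthogonal to \<open>w\<close> and \<open>u\<close> for the quadric as well, so
  that \<open>z\<close> occurs in its equation only through z t.\<close>

lemma tangent_pair_normal_form:
  fixes H A :: "'k ^ 4 ^ 4"
  assumes tp: "tangent_pair q H A"
  shows "\<exists>a b c d e f. card (hermitian_surface q H \<inter> quadric A) = total_count a b c d e f \<and>
    (a \<noteq> 0 \<or> b \<noteq> 0 \<or> c \<noteq> 0) \<and>
    (a = 0 \<or> (\<forall>x y. a * x ^ 2 + 2 * b * x * y + c * y ^ 2 = 0 \<longrightarrow> tr (x * cj y) = 0 \<longrightarrow> x = 0 \<and> y = 0)) \<and>
    (elliptic_quadric A \<longrightarrow> (\<forall>x y. a * x ^ 2 + 2 * b * x * y + c * y ^ 2 = 0 \<longrightarrow> x = 0 \<and> y = 0)) \<and>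
    (one_degenerate_cone A \<longrightarrow> b ^ 2 = a * c)"
proof -
  let ?h = "herm q H" and ?b = "bil A"
  have H: "nondegenerate_hermitian_matrix q H" and irr: "irreducible_quadric A"
    using tp by (auto simp: tangent_pair_def)
  obtain P where P: "P \<in> hermitian_surface q H" "P \<in> quadric A"
    and tan: "hermitian_tangent q H P = quadric_tangent A P"
    using tp by (auto simp: tangent_pair_def)
  obtain p where p: "p \<noteq> 0" "P = vec.span {p}"
    using P pg_pointsE unfolding quadric_def by blast
  note cjh = herm_cj[OF H]
  have sym: "?b u v = ?b v u" for u v
    using irr bil_commute by (auto simp: irreducible_quadric_def quadric_matrix_def)
  have hp: "?h p p = 0" and bp: "?b p p = 0"
    using P p hermitian_surface_span_iff quadric_span_iff by auto
  have tan: "?h x p = 0 \<longleftrightarrow> ?b p x = 0" for x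
  proof -
    have "x \<in> hermitian_tangent q H P \<longleftrightarrow> ?h x p = 0"
      unfolding hermitian_tangent_def p(2) vec.span_singleton
      by (auto simp: herm_linear dest: spec[of _ 1])
    moreover have "x \<in> quadric_tangent A P \<longleftrightarrow> ?b p x = 0"
      unfolding quadric_tangent_def p(2) vec.span_singleton
      by (auto simp: bil_linear dest: spec[of _ 1])
    ultimately show ?thesis using tan by simp
  qed
  \<comment> \<open>If the surfaces share a line through the point of tangency, \<open>w\<close> is
    taken on it, which gives a = 0. Otherwise any isotropic \<open>w\<close> will do, and no line is
    shared.\<close>
  obtain w where w: "w \<notin> vec.span {p}" "?h w p = 0" "?h w w = 0"
    and pref: "?b w w = 0 \<or> (\<forall>v. v \<notin> vec.span {p} \<longrightarrow> ?h v p = 0 \<longrightarrow> ?h v v = 0 \<longrightarrow> ?b v v \<noteq> 0)"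
    using exists_isotropic[OF H hp] by blast
  obtain r u where u: "?h u p = 0" "?h u u = 0" "?h w u = - 1"
    and r: "?h r p = 1" "?h r r = 0" "?h r w = 0" "?h r u = 0"
    using hyperbolic_basis[OF H p(1) hp w] by blast
  have h': "?h p w = 0" "?h p u = 0" "?h u w = - 1" "?h p r = 1" "?h w r = 0" "?h u r = 0"
    using cjh[of w p] cjh[of u p] cjh[of w u] cjh[of r p] cjh[of r w] cjh[of r u] w u r by simp_all
  define l where "l = ?b p r"
  have l: "l \<noteq> 0" using tan[of r] r by (simp add: l_def)
  have b': "?b p w = 0" "?b p u = 0" "?b w p = 0" "?b u p = 0" "?b r p = l" "?b p r = l" "?b u w = ?b w u"
    "?b w r = ?b r w" "?b u r = ?b r u"
    using tan[of w] tan[of u] w u sym by (simp_all add: l_def)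
  define T where "T = (\<lambda>(t, x, y, z). t *s r + x *s w + y *s u + z *s p)"
  have T: "T (t, x, y, z) = t *s r + x *s w + y *s u + z *s p" for t x y z
    by (simp add: T_def)
  have hT: "?h (T (t, x, y, z)) p = t" "?h (T (t, x, y, z)) u = - x" "?h (T (t, x, y, z)) w = - y" for t x y z
    using hp w u r h' by (simp_all add: T herm_linear)
  have "inj T"
  proof (rule injI)
    fix s s' assume "T s = T s'"
    moreover obtain t x y z where s: "s = (t, x, y, z)" by (metis prod.collapse)
    moreover obtain t' x' y' z' where s': "s' = (t', x', y', z')" by (metis prod.collapse)
    ultimately have eq: "T (t, x, y, z) = T (t', x', y', z')" by simp
    then have 1: "t = t'" "x = x'" "y = y'" using hT by (metis neg_equal_iff_equal)+
    then have "z *s p = z' *s p" using eq by (simp add: T)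
    then show "s = s'" using 1 p s s' by simp
  qed
  moreover have "card (UNIV :: ('k \<times> 'k \<times> 'k \<times> 'k) set) = card (UNIV :: ('k ^ 4) set)"
    by (simp add: power4_eq_xxxx mult.assoc)
  ultimately have bijT: "bij T"
    by (metis bij_def card_image card_subset_eq finite subset_UNIV)
  have T0: "T (0, 0, 0, 0) = 0" by (simp add: T)
  have hTT: "?h (T (t, x, y, z)) (T (t, x, y, z)) = tr (z * cj t - x * cj y)" for t x y z
    using hp w u r h' by (simp add: T herm_linear tr_def algebra_simps)
  \<comment> \<open>Gram entries divided by \<open>- l\<close>, which turns the z t term into the -2
    z t of \<open>quad\<close>.\<close>
  define a where "a = - ?b w w / l"
  define b where "b = - ?b w u / l"
  define c where "c = - ?b u u / l"
  define d where "d = - ?b r w / l"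
  define e where "e = - ?b r u / l"
  define f where "f = - ?b r r / (2 * l)"
  have coef: "?b w w = - l * a" "?b w u = - l * b" "?b u u = - l * c" "?b r w = - l * d" "?b r u = - l * e"
    "?b r r = - l * (2 * f)"
    using l by (simp_all add: a_def b_def c_def d_def e_def f_def)
  have bTT: "?b (T (t, x, y, z)) (T (t, x, y, z)) = - l * quad a b c d e f t x y z" for t x y z
    using bp by (simp add: T bil_linear b' coef quad_def power2_eq_square algebra_simps)
  have M: "card (hermitian_surface q H \<inter> quadric A) = total_count a b c d e f"
    using card_intersection_eq_total_count[OF bijT T0, of H A a b c d e f] hTT bTT l by simp
  have notin: "T (0, x, y, z) \<notin> vec.span {p}" if "x \<noteq> 0 \<or> y \<noteq> 0" for x y z
  proof
    assume "T (0, x, y, z) \<in> vec.span {p}"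
    then obtain k where "T (0, x, y, z) = T (0, 0, 0, k)" by (auto simp: vec.span_singleton T)
    then show False using injD[OF \<open>inj T\<close>] that by blast
  qed
  have nz: "a \<noteq> 0 \<or> b \<noteq> 0 \<or> c \<noteq> 0"
  proof (rule ccontr)
    assume "\<not> ?thesis"
    then have 0: "a = 0" "b = 0" "c = 0" by auto
    \<comment> \<open>With a = b = c = 0 the form is the coordinate t times a linear form. Here t is
      \<open>?b v p / l\<close>, and the other factor is \<open>2 * ?b v r - g * ?b v p\<close>;
      this contradicts irreducibility.\<close>
    define g where "g = ?b r r / l"
    let ?a = "(1 / l) *s (A *v p)" and ?c = "2 *s (A *v r) + (- g) *s (A *v p)"
    have lin: "(\<Sum>i\<in>UNIV. ?a $ i * v $ i) = ?b v p / l"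
      "(\<Sum>i\<in>UNIV. ?c $ i * v $ i) = 2 * ?b v r - g * ?b v p" for v
      unfolding bil_eq by (simp_all add: sum_divide_distrib sum_distrib_left sum_subtractf algebra_simps sum.distrib sum_negf)
    have "?b v v = ?b v p / l * (2 * ?b v r - g * ?b v p)" for v
    proof -
      obtain t x y z where v: "v = T (t, x, y, z)" using bijT by (metis bij_pointE prod.collapse)
      have vp: "?b v p = t * l" and vr: "?b v r = - 2 * l * f * t - l * d * x - l * e * y + z * l"
        using bp unfolding v by (simp_all add: T bil_linear b' coef)
      have vv: "?b v v = - l * (2 * d * x * t + 2 * e * y * t + 2 * f * t ^ 2 - 2 * z * t)"
        unfolding v bTT quad_def 0 by simp
      have g: "g = - 2 * f" using l by (simp add: g_def coef)
      show ?thesis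
        unfolding vp vr vv g using l by (simp add: power2_eq_square algebra_simps)
    qed
    then show False using irr unfolding irreducible_quadric_def lin[symmetric] by blast
  qed
  have an: "a = 0 \<or> (\<forall>x y. a * x ^ 2 + 2 * b * x * y + c * y ^ 2 = 0 \<longrightarrow> tr (x * cj y) = 0 \<longrightarrow> x = 0 \<and> y = 0)"
  proof (cases "?b w w = 0")
    case True then show ?thesis using coef l by simp
  next
    case False
    have "x = 0 \<and> y = 0" if xy: "a * x ^ 2 + 2 * b * x * y + c * y ^ 2 = 0" "tr (x * cj y) = 0" for x y
    proof (rule ccontr)
      assume "\<not> ?thesis"
      then have "T (0, x, y, 0) \<notin> vec.span {p}" using notin by blast
      moreover have "?h (T (0, x, y, 0)) (T (0, x, y, 0)) = 0" using hTT xy by simp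
      moreover have "?b (T (0, x, y, 0)) (T (0, x, y, 0)) = 0" using bTT xy by (simp add: quad_def)
      ultimately show False using pref False hT(1)[of 0] by blast
    qed
    then show ?thesis by blast
  qed
  \<comment> \<open>A nontrivial zero would put the whole line joining \<open>T (0, x, y, 0)\<close>
    to \<open>p\<close> on the quadric.\<close>
  have ell: "x = 0 \<and> y = 0" if A: "elliptic_quadric A" and xy: "a * x ^ 2 + 2 * b * x * y + c * y ^ 2 = 0" for x y
  proof (rule ccontr)
    assume "\<not> ?thesis"
    then have v: "T (0, x, y, 0) \<notin> vec.span {p}" using notin by blast
    let ?l = "vec.span {T (0, x, y, 0), p}"
    have "vec.independent {T (0, x, y, 0), p}"
      using v p by (simp add: vec.independent_insert vec.dependent_single)
    moreover have "T (0, x, y, 0) \<noteq> p" using v by (auto simp: vec.span_base)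
    ultimately have "?l \<in> pg_lines"
      unfolding pg_lines_def by (simp add: vec.dim_eq_card_independent)
    moreover have "contained_in_quadric ?l A"
      unfolding contained_in_quadric_def
    proof clarify
      fix R assume R: "R \<in> pg_points" "R \<subseteq> ?l"
      have "?b v v = 0" if "v \<in> ?l" for v
      proof -
        obtain k k' where "v - k *s T (0, x, y, 0) = k' *s p"
          using \<open>v \<in> ?l\<close> by (auto simp: vec.span_breakdown_eq vec.span_singleton)
        then have "v = T (0, k * x, k * y, k')"
          by (simp add: T vec_eq_iff algebra_simps)
        then have "?b v v = - l * (k ^ 2 * (a * x ^ 2 + 2 * b * x * y + c * y ^ 2))"
          using bTT[of 0 "k * x" "k * y" k'] by (simp add: quad_def power2_eq_square algebra_simps)
        then show ?thesis using xy by simp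
      qed
      then show "R \<in> quadric A" using R by (auto simp: quadric_def)
    qed
    ultimately show False using A by (auto simp: elliptic_quadric_def)
  qed
  have "b ^ 2 = a * c" if cone: "one_degenerate_cone A"
  proof -
    \<comment> \<open>A radical vector has t = 0, being orthogonal to \<open>p\<close>. Its part
      \<open>(x, y)\<close> is nonzero and is annihilated by the matrix of the binary form, whose
      determinant therefore vanishes.\<close>
    obtain v where v: "v \<noteq> 0" "\<And>y. ?b v y = 0" using radical_of_cone[OF cone P(2)] by blast
    obtain t x y z where vT: "v = T (t, x, y, z)" using bijT by (metis bij_pointE prod.collapse)
    have "t * l = 0" using v(2)[of p] bp unfolding vT by (simp add: T bil_linear b' coef)
    then have t: "t = 0" using l by simp
    have "- l * (a * x + b * y) = 0" "- l * (b * x + c * y) = 0"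
      using v(2)[of w] v(2)[of u] unfolding vT t by (simp_all add: T bil_linear b' coef algebra_simps)
    then have 1: "a * x + b * y = 0" "b * x + c * y = 0" using l by simp_all
    have "x \<noteq> 0 \<or> y \<noteq> 0"
    proof (rule ccontr)
      assume xy: "\<not> ?thesis"
      then have "z * l = 0" using v(2)[of r] unfolding vT t by (simp add: T bil_linear b')
      then show False using xy v(1) l unfolding vT t by (simp add: T)
    qed
    moreover have "x * (b ^ 2 - a * c) = b * (b * x + c * y) - c * (a * x + b * y)"
      "y * (b ^ 2 - a * c) = b * (a * x + b * y) - a * (b * x + c * y)"
      by (simp_all add: power2_eq_square algebra_simps)
    ultimately show ?thesis using 1 by auto
  qed
  then show ?thesis using M nz an ell by blast
qed

lemma size_tangent_pair:
  fixes H A :: "'k ^ 4 ^ 4"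
  assumes tp: "tangent_pair q H A"
  shows "int (card (hermitian_surface q H \<inter> quadric A)) \<in> hyperbolic_sizes"
    and "elliptic_quadric A \<Longrightarrow> int (card (hermitian_surface q H \<inter> quadric A)) \<in> generic_sizes"
    and "one_degenerate_cone A \<Longrightarrow> int (card (hermitian_surface q H \<inter> quadric A)) \<in> cone_sizes"
proof -
  from tangent_pair_normal_form[OF tp] obtain a b c d e f where
    M: "card (hermitian_surface q H \<inter> quadric A) = total_count a b c d e f" and
    nz: "a \<noteq> 0 \<or> b \<noteq> 0 \<or> c \<noteq> 0" and
    an: "a = 0 \<or> (\<forall>x y. a * x ^ 2 + 2 * b * x * y + c * y ^ 2 = 0 \<longrightarrow> tr (x * cj y) = 0 \<longrightarrow> x = 0 \<and> y = 0)" and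
    ell: "elliptic_quadric A \<longrightarrow> (\<forall>x y. a * x ^ 2 + 2 * b * x * y + c * y ^ 2 = 0 \<longrightarrow> x = 0 \<and> y = 0)" and
    cone: "one_degenerate_cone A \<longrightarrow> b ^ 2 = a * c"
    by blast
  have 1: "int (total_count a b c d e f) \<in> generic_sizes \<or>
      total_count a b c d e f = q ^ 2 + 1 \<and> b ^ 2 \<noteq> a * c \<and> (\<exists>x. a * x ^ 2 + 2 * b * x + c = 0)"
    if "a \<noteq> 0"
    using total_count_aniso[OF that, of b c d e f] an that by blast
  have 2: "int (total_count a b c d e f) \<in> hyperbolic_sizes"
    "b = 0 \<longrightarrow> int (total_count a b c d e f) \<in> cone_sizes" if "a = 0"
    using total_count_linear[of b c d e f] nz that by auto
  have sub: "generic_sizes \<subseteq> cone_sizes" "cone_sizes \<subseteq> hyperbolic_sizes"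
    by (auto simp: cone_sizes_def hyperbolic_sizes_def)
  have "int (q ^ 2 + 1) \<in> hyperbolic_sizes" by (simp add: hyperbolic_sizes_def Let_def)
  then show "int (card (hermitian_surface q H \<inter> quadric A)) \<in> hyperbolic_sizes"
    unfolding M using 1 2 sub by (cases "a = 0") auto
  show "int (card (hermitian_surface q H \<inter> quadric A)) \<in> generic_sizes" if "elliptic_quadric A"
  proof -
    have iso: "x = 0 \<and> y = 0" if "a * x ^ 2 + 2 * b * x * y + c * y ^ 2 = 0" for x y
      using ell \<open>elliptic_quadric A\<close> that by blast
    have "a \<noteq> 0" using iso[of 1 0] by auto
    moreover have "a * x ^ 2 + 2 * b * x + c \<noteq> 0" for x
      using iso[of x 1] by auto
    ultimately show ?thesis unfolding M using 1 by blast
  qed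
  show "int (card (hermitian_surface q H \<inter> quadric A)) \<in> cone_sizes" if "one_degenerate_cone A"
    unfolding M using 1 2 sub cone that by (cases "a = 0") auto
qed

section \<open>Examples realizing the sizes\<close>

text \<open>The normal forms with \<open>d = e = 0\<close>; the indices \<open>1, 2, 3, 4\<close> stand for \<open>t, x, y, z\<close>.\<close>

definition H0 :: "'k ^ 4 ^ 4" where
  "H0 = (\<chi> i j. if (i, j) = (1, 4) \<or> (i, j) = (4, 1) then 1
     else if (i, j) = (2, 3) \<or> (i, j) = (3, 2) then - 1 else 0)"

definition A0 :: "'k \<Rightarrow> 'k \<Rightarrow> 'k \<Rightarrow> 'k \<Rightarrow> 'k ^ 4 ^ 4" where
  "A0 a b c f = (\<chi> i j. if (i, j) = (1, 1) then 2 * f else if (i, j) = (1, 4) \<or> (i, j) = (4, 1) then - 1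
     else if (i, j) = (2, 2) then a else if (i, j) = (2, 3) \<or> (i, j) = (3, 2) then b
     else if (i, j) = (3, 3) then c else 0)"

definition pt :: "'k \<times> 'k \<times> 'k \<times> 'k \<Rightarrow> 'k ^ 4" where
  "pt = (\<lambda>(t, x, y, z). \<chi> i. if i = 1 then t else if i = 2 then x else if i = 3 then y else z)"

lemma pt_nth [simp]:
  "pt (t, x, y, z) $ 1 = t" "pt (t, x, y, z) $ 2 = x" "pt (t, x, y, z) $ 3 = y" "pt (t, x, y, z) $ 4 = z"
  by (simp_all add: pt_def)

lemma pt_eta: "v = pt (v $ 1, v $ 2, v $ 3, v $ 4)"
  by (simp add: vec_eq_iff forall_4)

lemma bij_pt: "bij pt"
proof (rule bijI)
  show "inj pt" by (rule injI) (auto simp: vec_eq_iff forall_4)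
  show "surj pt" by (rule surjI[of _ "\<lambda>v. (v $ 1, v $ 2, v $ 3, v $ 4)"]) (rule pt_eta[symmetric])
qed

lemma pt_0 [simp]: "pt (0, 0, 0, 0) = 0"
  by (simp add: vec_eq_iff forall_4)

lemma herm_H0: "herm q H0 u v = u $ 1 * cj (v $ 4) + u $ 4 * cj (v $ 1) - u $ 2 * cj (v $ 3) - u $ 3 * cj (v $ 2)"
  by (simp add: herm_eq_cj sum_4 H0_def)

lemma bil_A0: "bil (A0 a b c f) u v = a * u $ 2 * v $ 2 + b * (u $ 2 * v $ 3 + u $ 3 * v $ 2) + c * u $ 3 * v $ 3
    + 2 * f * u $ 1 * v $ 1 - (u $ 1 * v $ 4 + u $ 4 * v $ 1)"
  by (simp add: bil_def sum_4 A0_def algebra_simps)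

lemma bil_A0_diag: "bil (A0 a b c f) v v = a * v $ 2 ^ 2 + 2 * b * v $ 2 * v $ 3 + c * v $ 3 ^ 2
    + 2 * f * v $ 1 ^ 2 - 2 * v $ 4 * v $ 1"
  by (simp add: bil_A0 power2_eq_square algebra_simps)

lemma card_example:
  "card (hermitian_surface q H0 \<inter> quadric (A0 a b c f)) = total_count a b c 0 0 f"
  by (rule card_intersection_eq_total_count[OF bij_pt pt_0])
    (simp_all add: herm_H0 bil_A0_diag quad_def tr_def algebra_simps)

lemma nondegenerate_H0: "nondegenerate_hermitian_matrix q H0"
proof -
  have "H0 ** H0 = mat 1"
    by (simp add: vec_eq_iff forall_4 matrix_matrix_mult_def sum_4 H0_def mat_def)
  then have "invertible H0" unfolding invertible_def by blast
  moreover have "H0 $ j $ i = (H0 $ i $ j) ^ q" for i j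
  proof -
    have "cj (H0 $ i $ j) = H0 $ j $ i" by (simp add: H0_def)
    then show ?thesis by (simp add: cj_def)
  qed
  ultimately show ?thesis
    unfolding nondegenerate_hermitian_matrix_def invertible_det_nz by blast
qed

lemma quadric_matrix_A0: "quadric_matrix (A0 a b c f)"
proof -
  have "A0 a b c f $ 1 $ 4 \<noteq> 0" by (simp add: A0_def)
  then have "A0 a b c f \<noteq> 0" by (metis zero_index)
  moreover have "transpose (A0 a b c f) = A0 a b c f"
    by (simp add: vec_eq_iff forall_4 transpose_def A0_def)
  ultimately show ?thesis by (simp add: quadric_matrix_def)
qed

lemma tangent_pair_example:
  assumes nz: "a \<noteq> 0 \<or> b \<noteq> 0 \<or> c \<noteq> 0"
  shows "tangent_pair q H0 (A0 a b c f)"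
proof -
  let ?A = "A0 a b c f" and ?p = "pt (0, 0, 0, 1)"
  have p0: "?p \<noteq> 0" by (metis pt_nth(4) zero_index zero_neq_one)
  have "\<not> (\<exists>g k :: 'k ^ 4. \<forall>x. bil ?A x x = (\<Sum>i\<in>UNIV. g $ i * x $ i) * (\<Sum>i\<in>UNIV. k $ i * x $ i))"
  proof
    assume "\<exists>g k :: 'k ^ 4. \<forall>x. bil ?A x x = (\<Sum>i\<in>UNIV. g $ i * x $ i) * (\<Sum>i\<in>UNIV. k $ i * x $ i)"
    then obtain g k :: "'k ^ 4" where gk: "bil ?A x x = (\<Sum>i\<in>UNIV. g $ i * x $ i) * (\<Sum>i\<in>UNIV. k $ i * x $ i)" for x
      by blast
    have *: "quad a b c 0 0 f t x y z = (g $ 1 * t + g $ 2 * x + g $ 3 * y + g $ 4 * z)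
        * (k $ 1 * t + k $ 2 * x + k $ 3 * y + k $ 4 * z)" for t x y z
      using gk[of "pt (t, x, y, z)"] by (simp add: sum_4 bil_A0_diag quad_def)
    have z: "g $ 4 * k $ 4 = 0" and t: "2 * f = g $ 1 * k $ 1" and x: "a = g $ 2 * k $ 2" and y: "c = g $ 3 * k $ 3"
      using *[of 0 0 0 1] *[of 1 0 0 0] *[of 0 1 0 0] *[of 0 0 1 0] by (simp_all add: quad_def)
    have tz: "g $ 1 * k $ 4 + g $ 4 * k $ 1 + 2 = 0" using *[of 1 0 0 1] z t by (simp add: quad_def algebra_simps)
    have xz: "g $ 2 * k $ 4 + g $ 4 * k $ 2 = 0" using *[of 0 1 0 1] z x by (simp add: quad_def algebra_simps)
    have yz: "g $ 3 * k $ 4 + g $ 4 * k $ 3 = 0" using *[of 0 0 1 1] z y by (simp add: quad_def algebra_simps)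
    have xy: "g $ 2 * k $ 3 + g $ 3 * k $ 2 = 2 * b" using *[of 0 1 1 0] x y by (simp add: quad_def algebra_simps)
    \<comment> \<open>The z^2 coefficient is 0 and the t z coefficient is not, so exactly one factor
      contains z. The x z and y z coefficients then show that the other factor contains neither x
      nor y.\<close>
    have "(g $ 2 = 0 \<and> g $ 3 = 0) \<or> (k $ 2 = 0 \<and> k $ 3 = 0)"
      using z tz xz yz two_neq_0 by (cases "g $ 4 = 0") auto
    then have "a = 0" "c = 0" "2 * b = 0" using x y xy by auto
    then show False using nz by auto
  qed
  then have irr: "irreducible_quadric ?A" using quadric_matrix_A0 by (simp add: irreducible_quadric_def)
  have P: "vec.span {?p} \<in> hermitian_surface q H0 \<inter> quadric ?A"
    using p0 by (simp add: hermitian_surface_span_iff quadric_span_iff herm_H0 bil_A0)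
  have "(?A *v ?p) $ 1 \<noteq> 0" by (simp add: matrix_vector_mult_def sum_4 A0_def)
  then have "?A *v ?p \<noteq> 0" by (metis zero_index)
  then have ns: "nonsingular_point ?A (vec.span {?p})"
    using P vec.span_base[of ?p "{?p}"] by (auto simp: nonsingular_point_def)
  have "x \<in> hermitian_tangent q H0 (vec.span {?p}) \<longleftrightarrow> x $ 1 = 0" for x
    unfolding hermitian_tangent_def vec.span_singleton
    by (auto simp: herm_H0 dest: spec[of _ 1])
  moreover have "x \<in> quadric_tangent ?A (vec.span {?p}) \<longleftrightarrow> x $ 1 = 0" for x
    unfolding quadric_tangent_def vec.span_singleton
    by (auto simp: bil_A0 dest: spec[of _ 1])
  ultimately have "hermitian_tangent q H0 (vec.span {?p}) = quadric_tangent ?A (vec.span {?p})" by blast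
  then show ?thesis using irr nondegenerate_H0 P ns by (auto simp: tangent_pair_def)
qed

lemma nonsingular_example:
  assumes "b ^ 2 \<noteq> a * c"
  shows "nonsingular_quadric (A0 a b c f)"
proof -
  have "A0 a b c f *v v \<noteq> 0" if "v \<noteq> 0" for v
  proof
    assume 0: "A0 a b c f *v v = 0"
    have "(A0 a b c f *v v) $ i = 0" for i by (simp add: 0)
    from this[of 1] this[of 2] this[of 3] this[of 4]
    have "2 * f * v $ 1 - v $ 4 = 0" and ab: "a * v $ 2 + b * v $ 3 = 0" "b * v $ 2 + c * v $ 3 = 0" and "v $ 1 = 0"
      by (simp_all add: matrix_vector_mult_def sum_4 A0_def)
    moreover have "v $ 2 * (b ^ 2 - a * c) = b * (b * v $ 2 + c * v $ 3) - c * (a * v $ 2 + b * v $ 3)"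
      "v $ 3 * (b ^ 2 - a * c) = b * (a * v $ 2 + b * v $ 3) - a * (b * v $ 2 + c * v $ 3)"
      by (simp_all add: power2_eq_square algebra_simps)
    then have "v $ 2 * (b ^ 2 - a * c) = 0" "v $ 3 * (b ^ 2 - a * c) = 0"
      by (simp_all only: ab) simp_all
    then have "v $ 2 = 0" "v $ 3 = 0" using assms by simp_all
    ultimately have "v $ 1 = 0" "v $ 2 = 0" "v $ 3 = 0" "v $ 4 = 0" using assms by simp_all
    then show False using \<open>v \<noteq> 0\<close> by (simp add: vec_eq_iff forall_4)
  qed
  then have "nonsingular_point (A0 a b c f) P" if P: "P \<in> quadric (A0 a b c f)" for P
  proof -
    obtain v where "v \<noteq> 0" "P = vec.span {v}" using P pg_pointsE unfolding quadric_def by blast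
    then show ?thesis
      using P \<open>\<And>v. v \<noteq> 0 \<Longrightarrow> A0 a b c f *v v \<noteq> 0\<close> vec.span_base[of v "{v}"] by (auto simp: nonsingular_point_def)
  qed
  then show ?thesis using quadric_matrix_A0 by (simp add: nonsingular_quadric_def)
qed

lemma hyperbolic_example:
  assumes "b ^ 2 \<noteq> a * c" and xy: "x \<noteq> 0 \<or> y \<noteq> 0" "a * x ^ 2 + 2 * b * x * y + c * y ^ 2 = 0"
  shows "hyperbolic_quadric (A0 a b c f)"
proof -
  let ?w = "pt (0, x, y, 0)" and ?p = "pt (0, 0, 0, 1)"
  let ?l = "vec.span {?w, ?p}"
  have p0: "?p \<noteq> 0" by (metis pt_nth(4) zero_index zero_neq_one)
  have wp: "?w \<notin> vec.span {?p}"
    using xy(1) by (auto simp: vec.span_singleton vec_eq_iff forall_4)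
  then have "vec.independent {?w, ?p}"
    using p0 by (simp add: vec.independent_insert vec.dependent_single)
  moreover have "?w \<noteq> ?p" using wp by (auto simp: vec.span_base)
  ultimately have "?l \<in> pg_lines"
    unfolding pg_lines_def by (simp add: vec.dim_eq_card_independent)
  moreover have "contained_in_quadric ?l (A0 a b c f)"
    unfolding contained_in_quadric_def
  proof clarify
    fix R assume R: "R \<in> pg_points" "R \<subseteq> ?l"
    have "bil (A0 a b c f) v v = 0" if "v \<in> ?l" for v
    proof -
      obtain k k' where "v - k *s ?w = k' *s ?p"
        using \<open>v \<in> ?l\<close> by (auto simp: vec.span_breakdown_eq vec.span_singleton)
      then have "v $ 1 = 0" "v $ 2 = k * x" "v $ 3 = k * y" by (auto simp: vec_eq_iff forall_4)
      then have "bil (A0 a b c f) v v = k ^ 2 * (a * x ^ 2 + 2 * b * x * y + c * y ^ 2)"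
        by (simp add: bil_A0_diag power2_eq_square algebra_simps)
      then show ?thesis using xy(2) by simp
    qed
    then show "R \<in> quadric (A0 a b c f)" using R by (auto simp: quadric_def)
  qed
  ultimately show ?thesis
    using nonsingular_example[OF assms(1)] by (auto simp: hyperbolic_quadric_def)
qed

text \<open>By polarization any two vectors of a line on the quadric are orthogonal. In the plane t
  = 0 the quadric has only the point (0, 0, 0, 1), which is not orthogonal to any vector with
  nonzero t; so such a line would have dimension at most 1.\<close>

lemma elliptic_example:
  assumes an: "\<And>x y. a * x ^ 2 + 2 * b * x * y + c * y ^ 2 = 0 \<Longrightarrow> x = 0 \<and> y = 0"
  shows "elliptic_quadric (A0 a b c f)"
proof -
  let ?A = "A0 a b c f"
  have "b ^ 2 \<noteq> a * c"
  proof
    assume *: "b ^ 2 = a * c"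
    have "a * (- b) ^ 2 + 2 * b * (- b) * a + c * a ^ 2 = a * (a * c - b ^ 2)"
      by (simp add: power2_eq_square algebra_simps)
    then have "a = 0" using an[of "- b" a] * by simp
    then show False using an[of 1 0] by simp
  qed
  moreover have False if l: "l \<in> pg_lines" "contained_in_quadric l ?A" for l
  proof -
    have sub: "vec.subspace l" "vec.dim l = 2" using l by (auto simp: pg_lines_def)
    have sing: "bil ?A v v = 0" if "v \<in> l" for v
      using contained_in_quadric_bil[OF l(2) sub(1) that] .
    have "transpose ?A = ?A" using quadric_matrix_A0 unfolding quadric_matrix_def by blast
    then have comm: "bil ?A u v = bil ?A v u" for u v by (rule bil_commute)
    have orth: "bil ?A u v = 0" if "u \<in> l" "v \<in> l" for u v
      using sing[of "u + v"] sing[of u] sing[of v] that sub(1) comm[of v u]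
      by (simp add: vec.subspace_add bil_linear)
    have inf: "v = pt (0, 0, 0, v $ 4)" if "v \<in> l" "v $ 1 = 0" for v
    proof -
      have "v $ 2 = 0 \<and> v $ 3 = 0" using sing[OF that(1)] that(2) by (intro an) (simp add: bil_A0_diag)
      then show ?thesis using that by (simp add: vec_eq_iff forall_4)
    qed
    show False
    proof (cases "\<forall>v\<in>l. v $ 1 = 0")
      case True
      have "v = v $ 4 *s pt (0, 0, 0, 1)" if "v \<in> l" for v
        using inf[OF that] True that by (simp add: vec_eq_iff forall_4)
      then have "l \<subseteq> vec.span {pt (0, 0, 0, 1)}" unfolding vec.span_singleton by blast
      then have "vec.dim l \<le> card {pt (0, 0, 0, 1)}" by (rule vec.dim_le_card) simp
      then show False using sub(2) by simp
    next
      case False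
      then obtain v where v: "v \<in> l" "v $ 1 \<noteq> 0" by blast
      have "l \<subseteq> vec.span {v}"
      proof
        fix w assume w: "w \<in> l"
        let ?u = "w - (w $ 1 / v $ 1) *s v"
        have u: "?u \<in> l" using w v sub(1) by (simp add: vec.subspace_diff vec.subspace_scale)
        have "?u $ 1 = 0" using v by simp
        then have u4: "?u = pt (0, 0, 0, ?u $ 4)" by (rule inf[OF u])
        have "bil ?A v ?u = 0" using orth u v by blast
        then have "bil ?A v (pt (0, 0, 0, ?u $ 4)) = 0" by (simp only: u4[symmetric])
        then have "?u $ 4 = 0" using v by (simp add: bil_A0)
        then have "?u = 0" by (subst u4) simp
        then show "w \<in> vec.span {v}" by (auto simp: vec.span_singleton)
      qed
      then have "vec.dim l \<le> card {v}" by (rule vec.dim_le_card) simp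
      then show False using sub(2) by simp
    qed
  qed
  ultimately show ?thesis using nonsingular_example by (auto simp: elliptic_quadric_def)
qed

text \<open>The form is a (x + \<rho> y)^2 + 2 f t^2 - 2 z t. It is constant along the direction
  \<open>?v\<close>, which spans the vertex, and the plane y = 0 cuts it in a non-degenerate
  conic.\<close>

lemma cone_example:
  assumes a: "a \<noteq> 0"
  shows "one_degenerate_cone (A0 a (a * \<rho>) (a * \<rho> ^ 2) f)"
proof -
  let ?A = "A0 a (a * \<rho>) (a * \<rho> ^ 2) f" and ?v = "pt (0, - \<rho>, 1, 0)"
  let ?V = "vec.span {?v}" and ?\<sigma> = "{x :: 'k ^ 4. x $ 3 = 0}"
  have v0: "?v \<noteq> 0" by (metis pt_nth(3) zero_index zero_neq_one)
  have \<sigma>: "vec.subspace ?\<sigma>" "vec.dim ?\<sigma> = 3"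
  proof -
    show "vec.subspace ?\<sigma>" by (auto simp: vec.subspace_def)
    have "?\<sigma> = {x. \<forall>i. i \<notin> {1, 2, 4} \<longrightarrow> x $ i = 0}" by (auto simp: forall_4)
    then have "vec.dim ?\<sigma> = card {1, 2, 4 :: 4}" by (simp only: dim_substandard_cart)
    then show "vec.dim ?\<sigma> = 3" by simp
  qed
  have plane: "?\<sigma> \<in> pg_planes" using \<sigma> by (simp add: pg_planes_def)
  have conic: "nondegenerate_conic_section ?A ?\<sigma>"
    unfolding nondegenerate_conic_section_def
  proof (intro conjI plane ballI impI)
    fix u assume u: "u \<in> ?\<sigma>" and rad: "\<forall>w\<in>?\<sigma>. bil ?A u w = 0"
    have "bil ?A u (pt (1, 0, 0, 0)) = 0" "bil ?A u (pt (0, 1, 0, 0)) = 0" "bil ?A u (pt (0, 0, 0, 1)) = 0"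
      using rad by simp_all
    then have "u $ 1 = 0" "u $ 2 = 0" "u $ 4 = 0" using u a by (simp_all add: bil_A0)
    then show "u = 0" using u by (simp add: vec_eq_iff forall_4)
  qed
  have bilv: "bil ?A (u + k *s ?v) (u + k *s ?v) = bil ?A u u" for u k
    by (simp add: bil_A0 power2_eq_square algebra_simps)
  have Q: "P \<in> quadric ?A \<longleftrightarrow> P \<in> pg_points \<and> (\<exists>R\<in>quadric ?A. R \<subseteq> ?\<sigma> \<and> P \<subseteq> vec.span (?V \<union> R))" for P
  proof
    assume P: "P \<in> quadric ?A"
    then have pg: "P \<in> pg_points" by (simp add: quadric_def)
    then obtain w where w: "w \<noteq> 0" "P = vec.span {w}" by (rule pg_pointsE)
    have ww: "bil ?A w w = 0" using P w quadric_span_iff by blast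
    let ?u = "w - w $ 3 *s ?v"
    \<comment> \<open>For \<open>w\<close> in the vertex, the projection along \<open>?v\<close> is
      0; then any point of the conic will do, and (0, 0, 0, 1) is always one.\<close>
    define u where "u = (if ?u = 0 then pt (0, 0, 0, 1) else ?u)"
    have u0: "u \<noteq> 0" unfolding u_def by (metis pt_nth(4) zero_index zero_neq_one)
    have "bil ?A ?u ?u = 0" using bilv[of ?u "w $ 3"] ww by simp
    then have "bil ?A u u = 0" by (simp add: u_def bil_A0_diag)
    then have R: "vec.span {u} \<in> quadric ?A" using u0 quadric_span_iff by blast
    have "u \<in> ?\<sigma>" by (simp add: u_def)
    then have R\<sigma>: "vec.span {u} \<subseteq> ?\<sigma>" using \<sigma>(1) by (intro vec.span_minimal) auto
    have "?v \<in> vec.span (?V \<union> vec.span {u})" "u \<in> vec.span (?V \<union> vec.span {u})"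
      by (auto intro!: vec.span_base)
    then have "w $ 3 *s ?v + (if ?u = 0 then 0 else u) \<in> vec.span (?V \<union> vec.span {u})"
      by (intro vec.span_add vec.span_scale) (simp_all add: vec.span_zero)
    moreover have "w = w $ 3 *s ?v + (if ?u = 0 then 0 else u)" by (simp add: u_def)
    ultimately have "w \<in> vec.span (?V \<union> vec.span {u})" by argo
    then have "P \<subseteq> vec.span (?V \<union> vec.span {u})" unfolding w(2) by (intro vec.span_minimal) auto
    then show "P \<in> pg_points \<and> (\<exists>R\<in>quadric ?A. R \<subseteq> ?\<sigma> \<and> P \<subseteq> vec.span (?V \<union> R))" using pg R R\<sigma> by blast
  next
    assume "P \<in> pg_points \<and> (\<exists>R\<in>quadric ?A. R \<subseteq> ?\<sigma> \<and> P \<subseteq> vec.span (?V \<union> R))"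
    then obtain R where P: "P \<in> pg_points" and R: "R \<in> quadric ?A" "P \<subseteq> vec.span (?V \<union> R)" by blast
    obtain u where u: "u \<noteq> 0" "R = vec.span {u}" using R pg_pointsE unfolding quadric_def by blast
    have uu: "bil ?A u u = 0" using u R quadric_span_iff by blast
    have "bil ?A w w = 0" if "w \<in> P" for w
    proof -
      have "vec.span (?V \<union> R) \<subseteq> vec.span {?v, u}"
        unfolding u(2) by (intro vec.span_minimal Un_least vec.span_mono) auto
      then have "w \<in> vec.span {?v, u}" using that R(2) by blast
      then obtain k k' where "w - k *s ?v = k' *s u"
        by (auto simp: vec.span_breakdown_eq vec.span_singleton)
      then have "w = k' *s u + k *s ?v" by (metis diff_add_cancel)
      then show ?thesis using bilv uu by (simp add: bil_scale_left bil_scale_right)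
    qed
    then show "P \<in> quadric ?A" using P by (simp add: quadric_def)
  qed
  have "?v \<in> ?V" by (simp add: vec.span_base)
  then have "\<not> ?V \<subseteq> ?\<sigma>" by force
  moreover have "quadric ?A = {P \<in> pg_points. \<exists>R\<in>quadric ?A. R \<subseteq> ?\<sigma> \<and> P \<subseteq> vec.span (?V \<union> R)}"
    by (rule set_eqI) (simp only: mem_Collect_eq Q)
  ultimately show ?thesis
    unfolding one_degenerate_cone_def
    by (intro conjI bexI[of _ ?V] bexI[of _ ?\<sigma>] quadric_matrix_A0 plane conic span_singleton_in_pg_points[OF v0])
qed

lemma in_intersection_sizesI:
  assumes "T (A0 a b c f)" "a \<noteq> 0 \<or> b \<noteq> 0 \<or> c \<noteq> 0" "int (total_count a b c 0 0 f) = k"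
  shows "k \<in> int ` intersection_sizes q T"
proof -
  have "total_count a b c 0 0 f \<in> intersection_sizes q T"
    unfolding intersection_sizes_def
    by (intro CollectI exI[of _ H0] exI[of _ "A0 a b c f"] conjI assms(1) tangent_pair_example[OF assms(2)]
        card_example[symmetric])
  then show ?thesis using assms(3) by blast
qed

section \<open>Affine counts for special coefficients\<close>

lemma total_count_eq_aniso:
  assumes "\<And>x y. a * x ^ 2 + 2 * b * x * y + c * y ^ 2 = 0 \<Longrightarrow> tr (x * cj y) = 0 \<Longrightarrow> x = 0 \<and> y = 0"
  shows "int (total_count a b c d e f) = int (aff_count a b c d e f) + 1"
  using total_count_eqI[of a b c 0] inf_count_aniso[OF assms] by simp

lemma tr_half [simp]: "k \<in> K \<Longrightarrow> tr (k / 2) = k"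
  by (simp add: tr_K)

text \<open>Inversion preserves nonsquares, and 1/m - 1 = -(m - 1)/m has the quadratic character
  opposite to that of m - 1. So a nonsquare and its inverse realize both cases.\<close>

lemma exists_nonsquare_pred:
  "\<exists>m. \<not> square m \<and> square (m - 1)" "\<exists>m. \<not> square m \<and> \<not> square (m - 1)"
proof -
  obtain m where m: "\<not> square m" using exists_nonsquare by blast
  have m0: "m \<noteq> 0" "m - 1 \<noteq> 0" using m by auto
  have inv: "\<not> square (1 / m)" using m square_divide[of 1 "1 / m"] by auto
  have *: "square (1 / m - 1) \<longleftrightarrow> \<not> square (m - 1)"
  proof -
    have e: "1 / m - 1 = - ((m - 1) * (1 / m))" using m0 by (simp add: field_simps)
    show ?thesis
      unfolding e square_uminus using nonsquare_mult[of "m - 1" "1 / m"] inv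
        square_mult_left_iff[of "m - 1" "1 / m"] m0 by blast
  qed
  show "\<exists>m. \<not> square m \<and> square (m - 1)" "\<exists>m. \<not> square m \<and> \<not> square (m - 1)"
    using m inv * by blast+
qed

text \<open>The class of \<delta> enters both signs and cancels in the product, leaving the
  quadratic character of \<open>s\<close>.\<close>

lemma \<epsilon>_one_mult:
  assumes "s \<noteq> 0"
  shows "\<epsilon> 1 * \<epsilon> s = (if square s then 1 else - 1)"
proof (cases "square s")
  case True
  then have "\<epsilon> s = \<epsilon> 1" using \<epsilon>_mult_square[of s 1] assms by simp
  then show ?thesis using True \<epsilon>_cases[of 1] by auto
next
  case False
  have "square (s * \<delta>) \<longleftrightarrow> \<not> square \<delta>"
    using nonsquare_mult[OF False, of \<delta>] square_divide[of "s * \<delta>" \<delta>] False \<delta> by auto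
  then show ?thesis using False by (simp add: \<epsilon>_def)
qed

text \<open>Without mixed and linear terms the residual conic is itself a level set of a trace form,
  so its size is known exactly and contributes a second sign.\<close>

lemma aff_count_diag:
  assumes a: "a \<noteq> 0" and c': "c - 1 / cj a \<noteq> 0"
  shows "int (aff_count a 0 c 0 0 f)
    = int q ^ 3 + \<epsilon> a * \<epsilon> (c - 1 / cj a) * ((if tr f = 0 then int q ^ 2 else 0) - int q)"
proof -
  let ?c = "c - 1 / cj a"
  have \<alpha>: "c / 2 - 0 ^ 2 / (2 * a) - 1 / (2 * cj a) = ?c / 2" by (simp add: diff_divide_distrib)
  have N: "int (aff_count a 0 c 0 0 f)
      = int q ^ 3 + \<epsilon> a * int q * (int (card {y. tr (?c / 2 * y ^ 2) + tr f = 0}) - q)"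
    using aff_count_square[OF a, of 0 c 0 0 f] unfolding \<alpha> by simp
  have S: "{y. tr (?c / 2 * y ^ 2) + tr f = 0} = {y. tr (?c / 2 * y ^ 2) = - tr f}"
    by (auto simp: add_eq_0_iff2)
  have Z: "int (card {y. tr (?c / 2 * y ^ 2) = - tr f}) = int q - \<epsilon> ?c + (if tr f = 0 then \<epsilon> ?c * int q else 0)"
    using card_trace_form[of "?c / 2" "- tr f"] c' by simp
  show ?thesis unfolding N S Z by (simp add: power2_eq_square algebra_simps)
qed

text \<open>The fibres of \<open>y \<mapsto> tr (y * s)\<close> all have q elements. The values 0, 1
  and \<open>\<delta> ^ 2\<close> stand for zero, a nonzero square and a nonsquare of
  \<open>K\<close>, with one, two and no roots in \<open>K\<close>.\<close>

lemma card_trace_squared: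
  assumes s: "s \<noteq> 0"
  shows "card {y. tr (y * s) ^ 2 = 0} = q" "card {y. tr (y * s) ^ 2 = 1} = 2 * q"
    "card {y. tr (y * s) ^ 2 = \<delta> ^ 2} = 0"
proof -
  show "card {y. tr (y * s) ^ 2 = 0} = q" using card_tr_mult[OF _ s, of 0] by simp
  have "{y. tr (y * s) ^ 2 = 1} = {y. tr (y * s) = 1} \<union> {y. tr (y * s) = - 1}"
    by (auto simp: power2_eq_1_iff)
  moreover have "{y. tr (y * s) = 1} \<inter> {y. tr (y * s) = - 1} = {}"
    using neq_uminus[of 1] by auto
  ultimately show "card {y. tr (y * s) ^ 2 = 1} = 2 * q"
    using card_tr_mult[OF _ s, of 1] card_tr_mult[OF _ s, of "- 1"] by (simp add: card_Un_disjoint)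
  show "card {y. tr (y * s) ^ 2 = \<delta> ^ 2} = 0" using \<delta>2_nonsquare_K tr_in_K by simp
qed

lemma card_trace_squared_ex:
  assumes s: "s \<noteq> 0" and g: "g \<in> {- 1, 0, 1 :: int}" and n: "n \<in> K" "n \<noteq> 0"
  shows "\<exists>f. int (card {y. tr (y * s) ^ 2 = n * tr f}) = int q + g * int q"
proof -
  have "\<exists>k\<in>K. int (card {y. tr (y * s) ^ 2 = k}) = int q + g * int q"
  proof -
    consider "g = - 1" | "g = 0" | "g = 1" using g by auto
    then show ?thesis
    proof cases
      case 1
      have "int (card {y. tr (y * s) ^ 2 = \<delta> ^ 2}) = int q + g * int q"
        unfolding card_trace_squared(3)[OF s] 1 by simp
      then show ?thesis by (rule bexI) simp
    next
      case 2
      have "int (card {y. tr (y * s) ^ 2 = 0}) = int q + g * int q"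
        unfolding card_trace_squared(1)[OF s] 2 by simp
      then show ?thesis by (rule bexI) simp
    next
      case 3
      have "int (card {y. tr (y * s) ^ 2 = 1}) = int q + g * int q"
        unfolding card_trace_squared(2)[OF s] 3 by simp
      then show ?thesis by (rule bexI) simp
    qed
  qed
  then obtain k where k: "k \<in> K" "int (card {y. tr (y * s) ^ 2 = k}) = int q + g * int q" by blast
  have "tr (k / n / 2) = k / n" using k n by (intro tr_half K_simps)
  then have "n * tr (k / n / 2) = k" using n by simp
  then show ?thesis using k(2) by (intro exI[of _ "k / n / 2"]) (simp only:)
qed

text \<open>The coefficients are chosen so that twice the quadratic part of the residual conic is
  the single square \<open>tr (y * s) ^ 2\<close>. Its level sets have 0, q or 2 q points, and
  \<open>f\<close> selects one. The sign \<open>\<epsilon> 1\<close> is absorbed because the range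
  of \<open>g\<close> is symmetric.\<close>

lemma aff_count_corank_one:
  assumes s: "s \<noteq> 0" and g: "g \<in> {- 1, 0, 1 :: int}" and b: "b = s * cj s / 2"
  shows "\<exists>f. int (aff_count 1 b (b ^ 2 + 1 + s ^ 2) 0 0 f) = int q ^ 3 + g * int q ^ 2"
proof -
  have bK: "b \<in> K" unfolding b by (intro K_simps norm_in_K)
  have trb: "tr b = s * cj s" using tr_K[OF bK] unfolding b by simp
  have \<alpha>: "(b ^ 2 + 1 + s ^ 2) / 2 - b ^ 2 / (2 * 1) - 1 / (2 * cj 1) = s ^ 2 / 2"
    by (simp add: add_divide_distrib)
  have G: "2 * (tr (s ^ 2 / 2 * y ^ 2) + s * cj s * (y * cj y)) = tr (y * s) ^ 2" for y
    by (simp add: tr_def power2_eq_square algebra_simps)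
  have eq: "tr (s ^ 2 / 2 * y ^ 2) + s * cj s * (y * cj y) + tr f = 0 \<longleftrightarrow> tr (y * s) ^ 2 = - 2 * tr f" for y f
  proof -
    have "tr (s ^ 2 / 2 * y ^ 2) + s * cj s * (y * cj y) + tr f = 0
        \<longleftrightarrow> 2 * (tr (s ^ 2 / 2 * y ^ 2) + s * cj s * (y * cj y) + tr f) = 0" by (simp del: distrib_left_numeral)
    also have "\<dots> \<longleftrightarrow> tr (y * s) ^ 2 + 2 * tr f = 0" using G[of y] by (simp add: distrib_left)
    finally show ?thesis by (simp add: add_eq_0_iff2)
  qed
  have N: "int (aff_count 1 b (b ^ 2 + 1 + s ^ 2) 0 0 f)
      = int q ^ 3 + \<epsilon> 1 * int q * (int (card {y. tr (y * s) ^ 2 = - 2 * tr f}) - q)" for f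
  proof -
    have "{y. tr (s ^ 2 / 2 * y ^ 2) + tr (b / 1) * (y * cj y) + tr ((0 - b * 0 / 1 + cj 0 / cj 1) * y)
        + tr (f - 0 ^ 2 / (2 * 1)) = 0} = {y. tr (y * s) ^ 2 = - 2 * tr f}"
      unfolding eq[symmetric] by (simp add: trb)
    then show ?thesis
      using aff_count_square[of 1 b "b ^ 2 + 1 + s ^ 2" 0 0 f] unfolding \<alpha> by simp
  qed
  have "\<epsilon> 1 * g \<in> {- 1, 0, 1}" using g \<epsilon>_cases[of 1] by auto
  moreover have "- 2 \<in> K" "- 2 \<noteq> (0::'k)" by simp_all
  ultimately obtain f where "int (card {y. tr (y * s) ^ 2 = - 2 * tr f}) = int q + (\<epsilon> 1 * g) * int q"
    using card_trace_squared_ex[OF s, of "\<epsilon> 1 * g" "- 2"] by blast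
  then have "int (aff_count 1 b (b ^ 2 + 1 + s ^ 2) 0 0 f) = int q ^ 3 + (\<epsilon> 1 * \<epsilon> 1) * g * int q ^ 2"
    unfolding N by (simp add: power2_eq_square algebra_simps)
  moreover have "\<epsilon> 1 * \<epsilon> 1 = 1" using \<epsilon>_cases[of 1] by auto
  ultimately show ?thesis by auto
qed

section \<open>Elliptic examples\<close>

lemma elliptic_sizes_attained:
  "generic_sizes \<subseteq> int ` intersection_sizes q (elliptic_quadric :: 'k ^ 4 ^ 4 \<Rightarrow> bool)"
proof -
  \<comment> \<open>The form is (x + b y)^2 + m y^2; as -1 is a square in the big field, a nonsquare
    \<open>m\<close> makes it anisotropic.\<close>
  have an: "x = 0 \<and> y = 0" if m: "\<not> square m" and xy: "1 * x ^ 2 + 2 * b * x * y + (b ^ 2 + m) * y ^ 2 = 0" for m b x y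
  proof -
    have e: "(x + b * y) ^ 2 + m * y ^ 2 = 0" using xy by (simp add: power2_eq_square algebra_simps)
    have "y = 0"
    proof (rule ccontr)
      assume y: "y \<noteq> 0"
      have "m * y ^ 2 = - ((x + b * y) ^ 2)" using e by (simp add: add_eq_0_iff)
      then have "m = - (((x + b * y) / y) ^ 2)" using y by (simp add: field_simps)
      then show False using m by (metis square_uminus square_power2)
    qed
    then show ?thesis using e by simp
  qed
  \<comment> \<open>A nonsquare \<open>m\<close> ensures ellipticity, while \<open>m - 1\<close> is
    the coefficient of the residual conic and decides the sign.\<close>
  have diag: "int q ^ 3 + (if square (m - 1) then 1 else - 1) * ((if tr f = 0 then int q ^ 2 else 0) - int q) + 1
      \<in> int ` intersection_sizes q (elliptic_quadric :: 'k ^ 4 ^ 4 \<Rightarrow> bool)" if m: "\<not> square m" for m f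
  proof (rule in_intersection_sizesI)
    have an': "x = 0 \<and> y = 0" if "1 * x ^ 2 + 2 * 0 * x * y + m * y ^ 2 = 0" for x y
      using an[OF m, of x 0 y] that by simp
    then show "elliptic_quadric (A0 1 0 m f)" by (rule elliptic_example)
    have "m - 1 \<noteq> 0" using m by auto
    then have "int (aff_count 1 0 m 0 0 f)
        = int q ^ 3 + (if square (m - 1) then 1 else - 1) * ((if tr f = 0 then int q ^ 2 else 0) - int q)"
      using aff_count_diag[of 1 m f] \<epsilon>_one_mult[of "m - 1"] by simp
    moreover have "int (total_count 1 0 m 0 0 f) = int (aff_count 1 0 m 0 0 f) + 1"
      by (rule total_count_eq_aniso) (rule an')
    ultimately show "int (total_count 1 0 m 0 0 f) = int q ^ 3 + (if square (m - 1) then 1 else - 1)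
        * ((if tr f = 0 then int q ^ 2 else 0) - int q) + 1"
      by simp
  qed simp
  have corank: "int q ^ 3 + g * int q ^ 2 + 1
      \<in> int ` intersection_sizes q (elliptic_quadric :: 'k ^ 4 ^ 4 \<Rightarrow> bool)" if g: "g \<in> {- 1, 0, 1}" for g
  proof -
    \<comment> \<open>With \<open>s\<close> a root of \<open>m - 1\<close>, the coefficient
      \<open>b ^ 2 + 1 + s ^ 2\<close> of \<open>aff_count_corank_one\<close> is
      \<open>b ^ 2 + m\<close>, so the form stays anisotropic.\<close>
    obtain m where m: "\<not> square m" "square (m - 1)" using exists_nonsquare_pred by blast
    obtain s where ms: "m - 1 = s ^ 2" using m(2) by (auto simp: square_def)
    have s: "s \<noteq> 0" using ms m by auto
    have m': "1 + s ^ 2 = m" using ms by (metis add_diff_cancel_left' diff_add_cancel add.commute)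
    let ?b = "s * cj s / 2" and ?c = "(s * cj s / 2) ^ 2 + 1 + s ^ 2"
    have c: "?c = ?b ^ 2 + m" using m' by (simp add: add.assoc)
    obtain f where f: "int (aff_count 1 ?b ?c 0 0 f) = int q ^ 3 + g * int q ^ 2"
      using aff_count_corank_one[OF s g refl] by blast
    have an': "x = 0 \<and> y = 0" if "1 * x ^ 2 + 2 * ?b * x * y + ?c * y ^ 2 = 0" for x y
      using an[OF m(1), of x ?b y] that unfolding c .
    show ?thesis
    proof (rule in_intersection_sizesI)
      show "elliptic_quadric (A0 1 ?b ?c f)" using an' by (rule elliptic_example)
      have "int (total_count 1 ?b ?c 0 0 f) = int (aff_count 1 ?b ?c 0 0 f) + 1"
        by (rule total_count_eq_aniso) (rule an')
      then show "int (total_count 1 ?b ?c 0 0 f) = int q ^ 3 + g * int q ^ 2 + 1"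
        by (simp only: f)
    qed simp
  qed
  obtain m1 where m1: "\<not> square m1" "square (m1 - 1)" using exists_nonsquare_pred by blast
  obtain m2 where m2: "\<not> square m2" "\<not> square (m2 - 1)" using exists_nonsquare_pred by blast
  have t: "tr (1 / 2) \<noteq> 0" by simp
  show ?thesis
    using diag[OF m1(1), of 0] diag[OF m1(1), of "1 / 2"] diag[OF m2(1), of 0] diag[OF m2(1), of "1 / 2"]
      corank[of 1] corank[of 0] corank[of "- 1"] m1 m2 t
    unfolding generic_sizes_def Let_def by (simp add: algebra_simps)
qed

section \<open>Examples of cones\<close>

text \<open>The binary form is a (x + y/2)^2. With X = x + y/2 and Y = y - X, the trace of
  \<open>x * cj y\<close> is the norm of X minus the norm of Y. So the norm form in Y splits off
  with sign -1 and leaves an explicit conic in X.\<close>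

lemma aff_count_cone:
  "int (aff_count a (a * (1 / 2)) (a * (1 / 2) ^ 2) 0 0 f)
    = int q ^ 3 - int q * (int (card {x. tr (a * (1 / 2) * x ^ 2) - x * cj x + tr f = 0}) - q)"
proof -
  let ?G = "\<lambda>x. tr (a * (1 / 2) * x ^ 2) - x * cj x + tr f"
  have eq: "aff a (a * (1 / 2)) (a * (1 / 2) ^ 2) 0 0 f (X - h * (Y + X)) (Y + X) = Y * cj Y + ?G X"
    if h: "h = 1 / 2" for X Y h
  proof -
    have hh: "2 * h = 1" "cj h = h" unfolding h by simp_all
    have a2: "a / 2 = a * h" "a * (1 / 2) = a * h" "a * (1 / 2) ^ 2 / 2 = a * h ^ 2 * h"
      unfolding h by (simp_all add: power2_eq_square)
    have sq: "a * h * x ^ 2 + a * h * x * y + a * h ^ 2 * h * y ^ 2 = a * h * (x + h * y) ^ 2" for x y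
    proof -
      have "a * h * (x + h * y) ^ 2 = a * h * x ^ 2 + (2 * h) * (a * h * x * y) + a * h ^ 2 * h * y ^ 2"
        by (simp add: power2_eq_square algebra_simps)
      then show ?thesis using hh by simp
    qed
    have nrm: "tr ((X - h * (Y + X)) * cj (Y + X)) = X * cj X - Y * cj Y"
    proof -
      have "tr ((X - h * (Y + X)) * cj (Y + X))
          = X * cj X + X * cj X + (X * cj Y + cj X * Y) - (2 * h) * ((Y + X) * cj (Y + X))"
        using hh(2) by (simp add: tr_def algebra_simps)
      also have "\<dots> = X * cj X + X * cj X + (X * cj Y + cj X * Y) - 1 * ((Y + X) * cj (Y + X))"
        by (simp only: hh(1))
      also have "\<dots> = X * cj X - Y * cj Y" by (simp add: algebra_simps)
      finally show ?thesis .
    qed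
    show ?thesis
      unfolding aff_def a2 sq using nrm by (simp add: algebra_simps)
  qed
  have "bij_betw (\<lambda>(Y, X). (X - 1 / 2 * (Y + X), Y + X)) {(Y, X). Y * cj Y + ?G X = 0}
      {(x, y). aff a (a * (1 / 2)) (a * (1 / 2) ^ 2) 0 0 f x y = 0}"
    unfolding bij_betw_def
  proof
    show "inj_on (\<lambda>(Y, X). (X - 1 / 2 * (Y + X), Y + X)) {(Y, X). Y * cj Y + ?G X = 0}"
      by (auto simp: inj_on_def)
    show "(\<lambda>(Y, X). (X - 1 / 2 * (Y + X), Y + X)) ` {(Y, X). Y * cj Y + ?G X = 0}
        = {(x, y). aff a (a * (1 / 2)) (a * (1 / 2) ^ 2) 0 0 f x y = 0}"
    proof (intro equalityI subsetI)
      fix s assume "s \<in> {(x, y). aff a (a * (1 / 2)) (a * (1 / 2) ^ 2) 0 0 f x y = 0}"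
      then obtain x y where s: "s = (x, y)" "aff a (a * (1 / 2)) (a * (1 / 2) ^ 2) 0 0 f x y = 0" by auto
      define X Y where "X = x + 1 / 2 * y" and "Y = y - X"
      have xy: "y = Y + X" "x = X - 1 / 2 * (Y + X)" by (simp_all add: X_def Y_def)
      then have "Y * cj Y + ?G X = 0" using s(2) eq[OF refl, of X Y] by simp
      then show "s \<in> (\<lambda>(Y, X). (X - 1 / 2 * (Y + X), Y + X)) ` {(Y, X). Y * cj Y + ?G X = 0}"
        using s(1) xy by (intro image_eqI[of _ _ "(Y, X)"]) auto
    next
      fix s assume "s \<in> (\<lambda>(Y, X). (X - 1 / 2 * (Y + X), Y + X)) ` {(Y, X). Y * cj Y + ?G X = 0}"
      then obtain X Y where "s = (X - 1 / 2 * (Y + X), Y + X)" "Y * cj Y + ?G X = 0" by auto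
      then show "s \<in> {(x, y). aff a (a * (1 / 2)) (a * (1 / 2) ^ 2) 0 0 f x y = 0}"
        using eq[OF refl, of X Y] by simp
    qed
  qed
  then have "aff_count a (a * (1 / 2)) (a * (1 / 2) ^ 2) 0 0 f = card {(Y, X). Y * cj Y + ?G X = 0}"
    unfolding aff_count_def by (simp add: bij_betw_same_card)
  moreover have "?G x \<in> K" for x by (intro K_simps tr_in_K norm_in_K)
  ultimately show ?thesis
    using card_form_plus[of "\<lambda>x. x * cj x" "- 1" ?G] card_norm_form by simp
qed

lemma cone_sizes_attained:
  assumes q: "q > 3"
  shows "cone_sizes \<subseteq> int ` intersection_sizes q (one_degenerate_cone :: 'k ^ 4 ^ 4 \<Rightarrow> bool)"
proof -
  let ?I = "int ` intersection_sizes q (one_degenerate_cone :: 'k ^ 4 ^ 4 \<Rightarrow> bool)"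
  \<comment> \<open>The form x^2 shares the line x = 0 with the Hermitian surface, so n = 1 although
    a is nonzero. This yields the size q^3 + 2 q^2 - q + 1, and also q^3 + q^2 - q + 1.\<close>
  have iso: "int q ^ 3 + ((if tr f = 0 then int q ^ 2 else 0) - int q) + 1 + int q ^ 2 \<in> ?I" for f
  proof (rule in_intersection_sizesI)
    show "one_degenerate_cone (A0 1 0 0 f)" using cone_example[of 1 0 f] by simp
    have "{(x, y). 1 * x ^ 2 + 2 * 0 * x * y + 0 * y ^ 2 = 0 \<and> tr (x * cj y) = 0} = {0} \<times> UNIV" by auto
    then have "inf_count 1 0 0 = q ^ 2" by (simp add: inf_count_def card_cartesian_product cardk)
    then have "inf_count 1 0 0 = 1 + 1 * (q ^ 2 - 1)" by simp
    then have "total_count 1 0 0 0 0 f = aff_count 1 0 0 0 0 f + 1 + q ^ 2 * 1" by (rule total_count_eqI)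
    moreover have "int (aff_count 1 0 0 0 0 f) = int q ^ 3 + ((if tr f = 0 then int q ^ 2 else 0) - int q)"
      using aff_count_diag[of 1 0 f] \<epsilon>_one_mult[of "- 1"] by simp
    ultimately show "int (total_count 1 0 0 0 0 f)
        = int q ^ 3 + ((if tr f = 0 then int q ^ 2 else 0) - int q) + 1 + int q ^ 2" by simp
  qed simp
  \<comment> \<open>On the double line x + y/2 = 0 the trace of \<open>x * cj y\<close> is minus the
    norm of \<open>y\<close>, so no line is shared.\<close>
  have gen: "int q ^ 3 - int q * (Z - int q) + 1 \<in> ?I"
    if a: "a \<noteq> 0" and Z: "int (card {x. tr (a * (1 / 2) * x ^ 2) - x * cj x + tr f = 0}) = Z" for a f Z
  proof (rule in_intersection_sizesI)
    let ?b = "a * (1 / 2)" and ?c = "a * (1 / 2) ^ 2"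
    show "one_degenerate_cone (A0 a ?b ?c f)" by (rule cone_example[OF a])
    show "a \<noteq> 0 \<or> ?b \<noteq> 0 \<or> ?c \<noteq> 0" using a by simp
    have an: "x = 0 \<and> y = 0" if xy: "a * x ^ 2 + 2 * ?b * x * y + ?c * y ^ 2 = 0" "tr (x * cj y) = 0" for x y
    proof -
      have "a * x ^ 2 + 2 * ?b * x * y + ?c * y ^ 2 = a * (x + 1 / 2 * y) ^ 2"
      proof -
        have "a * x ^ 2 + 2 * (a * h) * x * y + (a * h ^ 2) * y ^ 2 = a * (x + h * y) ^ 2" for h
          by (simp add: power2_eq_square algebra_simps)
        then show ?thesis .
      qed
      then have "x + 1 / 2 * y = 0" using xy a by simp
      then have x: "x = - (1 / 2) * y" by (simp add: add_eq_0_iff2)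
      have "x * cj y = (- (1 / 2)) * (y * cj y)" using x by simp
      also have "tr \<dots> = - (1 / 2) * tr (y * cj y)" by (rule tr_scale) (simp only: K_simps)
      also have "tr (y * cj y) = 2 * (y * cj y)" by (rule tr_K) (rule norm_in_K)
      finally show ?thesis using xy x by simp
    qed
    have "int (total_count a ?b ?c 0 0 f) = int (aff_count a ?b ?c 0 0 f) + 1"
      by (rule total_count_eq_aniso) (rule an)
    then show "int (total_count a ?b ?c 0 0 f) = int q ^ 3 - int q * (Z - int q) + 1"
      unfolding aff_count_cone Z .
  qed
  \<comment> \<open>For a = 1 the residual form is (x - cj x)^2 / 2, which is
    \<open>tr (x * \<delta>) ^ 2\<close> divided by \<open>2 * \<delta> ^ 2\<close> and has rank
    one.\<close>
  have corank: "int q ^ 3 + g * int q ^ 2 + 1 \<in> ?I" if g: "g \<in> {- 1, 0, 1}" for g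
  proof -
    have "- g \<in> {- 1, 0, 1}" using g by auto
    moreover have "- 2 * \<delta> ^ 2 \<in> K" "- 2 * \<delta> ^ 2 \<noteq> 0" using \<delta> by simp_all
    ultimately obtain f where f: "int (card {y. tr (y * \<delta>) ^ 2 = - 2 * \<delta> ^ 2 * tr f}) = int q + (- g) * int q"
      using card_trace_squared_ex[OF \<delta>(1)] by blast
    have "tr (1 * (1 / 2) * x ^ 2) - x * cj x + tr f = 0 \<longleftrightarrow> tr (x * \<delta>) ^ 2 = - 2 * \<delta> ^ 2 * tr f" for x
    proof -
      have t: "tr (1 * (1 / 2) * x ^ 2) = (x ^ 2 + cj x ^ 2) / 2"
        by (simp add: tr_def add_divide_distrib)
      have "2 * \<delta> ^ 2 * ((x ^ 2 + cj x ^ 2) / 2 - x * cj x + tr f) = tr (x * \<delta>) ^ 2 + 2 * \<delta> ^ 2 * tr f"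
        by (simp add: tr_def \<delta> power2_eq_square algebra_simps)
      then have "(x ^ 2 + cj x ^ 2) / 2 - x * cj x + tr f = 0 \<longleftrightarrow> tr (x * \<delta>) ^ 2 + 2 * \<delta> ^ 2 * tr f = 0"
        using \<delta> by (metis mult_eq_0_iff power_not_zero two_neq_0)
      then show ?thesis unfolding t by (simp add: add_eq_0_iff2)
    qed
    then have "int (card {x. tr (1 * (1 / 2) * x ^ 2) - x * cj x + tr f = 0}) = int q + (- g) * int q"
      using f by simp
    then have "int q ^ 3 - int q * (int q + (- g) * int q - int q) + 1 \<in> ?I"
      by (rule gen[OF one_neq_zero])
    then show ?thesis by (simp add: power2_eq_square algebra_simps)
  qed
  \<comment> \<open>The coefficient \<open>1 + \<delta>\<close> makes the residual form isotropic:
    at \<open>t - s + s * \<delta>\<close> it equals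
    \<open>2 * \<delta> ^ 2 * (s * t)\<close>.\<close>
  have isoX: "int q ^ 3 - int q * ((if tr f = 0 then 2 * int q - 1 else int q - 1) - int q) + 1 \<in> ?I" for f
  proof (rule gen)
    show "1 + \<delta> \<noteq> 0" using \<delta>_notin_K K_simps(6)[of 1] by (metis K_simps(2) add_eq_0_iff)
    let ?k = "- tr f / (2 * \<delta> ^ 2)"
    let ?S = "{x. tr ((1 + \<delta>) * (1 / 2) * x ^ 2) - x * cj x + tr f = 0}"
    let ?T = "{(s, t). s \<in> K \<and> t \<in> K \<and> s * t = ?k}"
    have eq: "tr ((1 + \<delta>) * (1 / 2) * (t - s + s * \<delta>) ^ 2) - (t - s + s * \<delta>) * cj (t - s + s * \<delta>) + tr f = 0
        \<longleftrightarrow> s * t = ?k" if st: "s \<in> K" "t \<in> K" for s t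
    proof -
      let ?x = "t - s + s * \<delta>"
      have cjx: "cj ?x = t - s - s * \<delta>" using st by (simp add: K_iff \<delta>)
      have t2: "tr ((1 + \<delta>) * (1 / 2) * ?x ^ 2) = ((1 + \<delta>) * ?x ^ 2 + (1 - \<delta>) * cj ?x ^ 2) / 2"
        by (simp only: tr_def cj_mult cj_add cj_power cj_divide cj_1 cj_numeral \<delta>) (simp add: add_divide_distrib)
      have "(1 + \<delta>) * ?x ^ 2 + (1 - \<delta>) * (t - s - s * \<delta>) ^ 2
          = 2 * (?x * (t - s - s * \<delta>)) + 2 * (2 * \<delta> ^ 2 * (s * t))"
        by (simp add: power2_eq_square algebra_simps)
      then have "tr ((1 + \<delta>) * (1 / 2) * ?x ^ 2) - ?x * cj ?x + tr f = 2 * \<delta> ^ 2 * (s * t) + tr f"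
        unfolding t2 cjx by (simp add: add_divide_distrib)
      moreover have "2 * \<delta> ^ 2 * (s * t) + tr f = 0 \<longleftrightarrow> s * t = ?k"
        using \<delta> by (auto simp: field_simps add_eq_0_iff2)
      ultimately show ?thesis by simp
    qed
    have "bij_betw (\<lambda>(s, t). t - s + s * \<delta>) ?T ?S"
      unfolding bij_betw_def
    proof
      show "inj_on (\<lambda>(s, t). t - s + s * \<delta>) ?T"
      proof (rule inj_onI)
        fix p p' assume p: "p \<in> ?T" "p' \<in> ?T" and e: "(case p of (s, t) \<Rightarrow> t - s + s * \<delta>) = (case p' of (s, t) \<Rightarrow> t - s + s * \<delta>)"
        obtain s t s' t' where st: "p = (s, t)" "p' = (s', t')" by (metis prod.collapse)
        have K: "s \<in> K" "t \<in> K" "s' \<in> K" "t' \<in> K" using p st by auto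
        have "(\<lambda>(u, v). u + v * \<delta>) (t - s, s) = (\<lambda>(u, v). u + v * \<delta>) (t' - s', s')"
          using e st by simp
        then have "(t - s, s) = (t' - s', s')"
          by (rule inj_onD[OF bij_betw_imp_inj_on[OF bij_coords]]) (use K in auto)
        then show "p = p'" using st by auto
      qed
      show "(\<lambda>(s, t). t - s + s * \<delta>) ` ?T = ?S"
      proof (intro equalityI subsetI)
        fix x assume x: "x \<in> ?S"
        obtain u v where uv: "u \<in> K" "v \<in> K" "x = u + v * \<delta>" using coords_exist by blast
        have "x = (u + v) - v + v * \<delta>" using uv by simp
        then have "v * (u + v) = ?k" using x eq[of v "u + v"] uv by simp
        then show "x \<in> (\<lambda>(s, t). t - s + s * \<delta>) ` ?T"
          using uv by (intro image_eqI[of _ _ "(v, u + v)"]) auto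
      next
        fix x assume "x \<in> (\<lambda>(s, t). t - s + s * \<delta>) ` ?T"
        then obtain s t where "x = t - s + s * \<delta>" "s \<in> K" "t \<in> K" "s * t = ?k" by auto
        then show "x \<in> ?S" using eq[of s t] by simp
      qed
    qed
    then have "card ?S = card ?T" by (simp add: bij_betw_same_card)
    also have "\<dots> = (if ?k = 0 then 2 * q - 1 else q - 1)" by (rule card_hyperbola) (simp add: \<delta>2_in_K)
    finally have "int (card ?S) = (if ?k = 0 then 2 * int q - 1 else int q - 1)"
      using q_ge_3 by (simp split: if_splits)
    moreover have "?k = 0 \<longleftrightarrow> tr f = 0" using \<delta> by simp
    ultimately show "int (card ?S) = (if tr f = 0 then 2 * int q - 1 else int q - 1)" by simp
  qed
  \<comment> \<open>An anisotropic residual form: if \<open>a\<close> has norm 1 - \<mu>^2 and l =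
    \<mu> - 1, then 2 l times the form is the norm of \<open>a * x + l * cj x\<close>. The element
    \<mu> of \<open>K\<close> must avoid 0, 1 and -1, which is where q > 3 enters.\<close>
  have anX: "int q ^ 3 - int q * (int q + 1 - int q) + 1 \<in> ?I"
  proof -
    have "card (K - {0, 1, - 1}) > 0"
    proof -
      have "card {0, 1, - 1 :: 'k} \<le> 3" by (simp add: card_insert_if)
      then show ?thesis using diff_card_le_card_Diff[of "{0, 1, - 1}" K] q by simp
    qed
    then have "K - {0, 1, - 1} \<noteq> {}" by (metis card.empty less_irrefl)
    then obtain \<mu> where \<mu>: "\<mu> \<in> K" "\<mu> \<noteq> 0" "\<mu> \<noteq> 1" "\<mu> \<noteq> - 1" by blast
    obtain a where a: "a * cj a = 1 - \<mu> ^ 2" using norm_surj[of "1 - \<mu> ^ 2"] \<mu> by auto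
    have "\<mu> ^ 2 \<noteq> 1" using \<mu> by (simp add: power2_eq_1_iff)
    then have a0: "a \<noteq> 0" using a by auto
    define l where "l = \<mu> - 1"
    have l: "l \<in> K" "l \<noteq> 0" "cj l = l" using \<mu> by (simp_all add: l_def K_iff)
    have D: "a * cj a - l ^ 2 \<noteq> 0"
    proof -
      have "a * cj a - l ^ 2 = - 2 * \<mu> * l" unfolding a l_def by (simp add: power2_eq_square algebra_simps)
      then show ?thesis using \<mu> l by simp
    qed
    have N: "(a * x + l * cj x) * cj (a * x + l * cj x) = 2 * l * (tr (a * (1 / 2) * x ^ 2) - x * cj x)" for x
    proof -
      have "(a * x + l * cj x) * cj (a * x + l * cj x)
          = l * (a * x ^ 2 + cj a * cj x ^ 2) + (a * cj a + l ^ 2) * (x * cj x)"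
        using l by (simp add: power2_eq_square algebra_simps)
      also have "a * cj a + l ^ 2 = - 2 * l" unfolding a l_def by (simp add: power2_eq_square algebra_simps)
      also have "l * (a * x ^ 2 + cj a * cj x ^ 2) = 2 * l * tr (a * (1 / 2) * x ^ 2)"
        by (simp add: tr_def distrib_left)
      finally show ?thesis by (simp add: algebra_simps)
    qed
    have "bij (\<lambda>x. a * x + l * cj x)"
    proof -
      have "inj (\<lambda>x. a * x + l * cj x)"
      proof (rule injI)
        fix x x' assume e: "a * x + l * cj x = a * x' + l * cj x'"
        let ?d = "x - x'"
        have d: "a * ?d + l * cj ?d = 0" using e by (simp add: algebra_simps)
        have d': "cj a * cj ?d + l * ?d = 0" using arg_cong[OF d, of cj] l by simp
        have "(a * cj a - l ^ 2) * ?d = cj a * (a * ?d + l * cj ?d) - l * (cj a * cj ?d + l * ?d)"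
          by (simp only: power2_eq_square) (simp add: algebra_simps)
        also have "\<dots> = 0" by (simp only: d d') simp
        finally show "x = x'" using D by simp
      qed
      then show ?thesis by (simp add: bij_def finite_UNIV_inj_surj)
    qed
    then have "bij_betw (\<lambda>x. a * x + l * cj x) {x. (a * x + l * cj x) * cj (a * x + l * cj x) = - 2 * l}
        {y. y * cj y = - 2 * l}"
    proof (rule bij_betw_subset)
      show "(\<lambda>x. a * x + l * cj x) ` {x. (a * x + l * cj x) * cj (a * x + l * cj x) = - 2 * l}
          = {y. y * cj y = - 2 * l}"
      proof (intro equalityI subsetI)
        fix y assume y: "y \<in> {y. y * cj y = - 2 * l}"
        obtain x where "y = a * x + l * cj x" using \<open>bij (\<lambda>x. a * x + l * cj x)\<close> by (rule bij_pointE)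
        then show "y \<in> (\<lambda>x. a * x + l * cj x) ` {x. (a * x + l * cj x) * cj (a * x + l * cj x) = - 2 * l}"
          using y by blast
      qed blast
    qed simp
    moreover have "card {y. y * cj y = - 2 * l} = q + 1" using l by (intro card_norm) auto
    ultimately have "card {x. (a * x + l * cj x) * cj (a * x + l * cj x) = - 2 * l} = q + 1"
      by (simp only: bij_betw_same_card)
    moreover have "(a * x + l * cj x) * cj (a * x + l * cj x) = - 2 * l
        \<longleftrightarrow> tr (a * (1 / 2) * x ^ 2) - x * cj x + tr (1 / 2) = 0" for x
    proof -
      have "2 * l * w = - 2 * l \<longleftrightarrow> w + 1 = 0" for w
      proof -
        have "2 * l * w = - 2 * l \<longleftrightarrow> 2 * l * (w + 1) = 0" by (simp add: distrib_left add_eq_0_iff2)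
        then show ?thesis using l by simp
      qed
      then show ?thesis unfolding N by simp
    qed
    ultimately have "int (card {x. tr (a * (1 / 2) * x ^ 2) - x * cj x + tr (1 / 2) = 0}) = int q + 1"
      by simp
    then show ?thesis by (rule gen[OF a0])
  qed
  have t: "tr (1 / 2) \<noteq> 0" by simp
  show ?thesis
    using iso[of 0] iso[of "1 / 2"] isoX[of 0] isoX[of "1 / 2"] anX t corank[of 1] corank[of 0] corank[of "- 1"]
    unfolding cone_sizes_def generic_sizes_def Let_def by (simp add: algebra_simps power2_eq_square)
qed

section \<open>Hyperbolic examples\<close>

lemma aff_count_linear_unique:
  assumes "b * cj b \<noteq> 1"
  shows "int (aff_count 0 b c 0 0 f) = int q ^ 3 - int q + (if tr f = 0 then int q ^ 2 else 0)"
proof -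
  have Y: "{y. cj y = b * y + 0} = {0}" using card_semilinear_unique[OF assms, of 0] by simp
  have mem: "cj y = b * y + 0 \<longleftrightarrow> y = 0" for y using Y by blast
  have "{y. cj y = b * y + 0 \<and> tr (c / 2 * y ^ 2 + 0 * y + f) = 0} = (if tr f = 0 then {0} else {})"
    unfolding mem by auto
  then show ?thesis
    using arg_cong[OF aff_count_linear[of b c 0 0 f], of int] Y by (simp split: if_splits)
qed

lemma aff_count_linear_one:
  assumes "c \<in> K"
  shows "int (aff_count 0 1 c 0 0 f) = int q ^ 3 - int q ^ 2 + int q ^ 2 * int (card {t \<in> K. c * t ^ 2 + tr f = 0})"
proof -
  have Y: "{y. cj y = 1 * y + 0} = K" by (auto simp: K_iff)
  have "tr (c / 2 * t ^ 2) = c * t ^ 2" if "t \<in> K" for t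
    using tr_half[of "c * t ^ 2"] that assms by simp
  then have S: "{y. cj y = 1 * y + 0 \<and> tr (c / 2 * y ^ 2 + 0 * y + f) = 0} = {t \<in> K. c * t ^ 2 + tr f = 0}"
    by (auto simp: K_iff)
  show ?thesis
    using arg_cong[OF aff_count_linear[of 1 c 0 0 f], of int] unfolding Y S by (simp add: power2_eq_square)
qed

lemma total_count_linear_eq:
  assumes "b \<noteq> 0"
  shows "int (total_count 0 b c 0 0 f)
    = int (aff_count 0 b c 0 0 f) + 1 + int q ^ 2 * (if tr (c / b) = 0 then 2 else 1)"
  using total_count_eqI[OF inf_count_linear[of b c]] assms by simp

lemma hyperbolic_sizes_attained:
  "hyperbolic_sizes - (if q = 3 then {int q ^ 3 - int q ^ 2 + 1} else {})
    \<subseteq> int ` intersection_sizes q (hyperbolic_quadric :: 'k ^ 4 ^ 4 \<Rightarrow> bool)"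
proof -
  let ?I = "int ` intersection_sizes q (hyperbolic_quadric :: 'k ^ 4 ^ 4 \<Rightarrow> bool)"
  have t: "tr (1 / 2) = 1" by simp
  have lin: "int (aff_count 0 b c 0 0 f) + 1 + int q ^ 2 * (if tr (c / b) = 0 then 2 else 1) \<in> ?I"
    if b: "b \<noteq> 0" for b c f
  proof (rule in_intersection_sizesI)
    show "hyperbolic_quadric (A0 0 b c f)" using b by (intro hyperbolic_example[of b 0 c 1 0]) auto
    show "int (total_count 0 b c 0 0 f)
        = int (aff_count 0 b c 0 0 f) + 1 + int q ^ 2 * (if tr (c / b) = 0 then 2 else 1)"
      by (rule total_count_linear_eq[OF b])
  qed (use b in simp)
  \<comment> \<open>The norm -1 differs from 1, so \<open>cj y = b * y\<close> has only the zero
    solution. The same \<open>b\<close> serves below for the size q^2 + 1.\<close>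
  obtain b where b: "b * cj b = - 1" using norm_surj[of "- 1"] by auto
  have b0: "b \<noteq> 0" and b1: "b * cj b \<noteq> 1" using b neq_uminus[of 1] by auto
  have 1: "int q ^ 3 + int q ^ 2 - int q + 1 \<in> ?I"
    using lin[OF b0, of b "1 / 2"] b0 unfolding aff_count_linear_unique[OF b1] by (simp add: t tr_K algebra_simps)
  have 2: "int q ^ 3 + 2 * int q ^ 2 - int q + 1 \<in> ?I"
    using lin[OF b0, of 0 "1 / 2"] unfolding aff_count_linear_unique[OF b1] by (simp add: t algebra_simps)
  have 3: "int q ^ 3 + 3 * int q ^ 2 - int q + 1 \<in> ?I"
    using lin[OF b0, of 0 0] unfolding aff_count_linear_unique[OF b1] by (simp add: algebra_simps)
  have 4: "2 * int q ^ 3 + int q ^ 2 + 1 \<in> ?I"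
    using lin[of 1 0 0] unfolding aff_count_linear_one[OF K_simps(1)]
    by (simp add: power2_eq_square power3_eq_cube algebra_simps)
  have 5: "int q ^ 3 + int q ^ 2 + 1 \<in> ?I"
    using lin[of 1 0 "1 / 2"] unfolding aff_count_linear_one[OF K_simps(1)] by (simp add: t algebra_simps)
  have 6: "int q ^ 3 + 1 \<in> ?I"
  proof -
    have tf: "tr (- (\<delta> ^ 2) / 2) = - (\<delta> ^ 2)" by (rule tr_half) simp
    have "{u \<in> K. 1 * u ^ 2 + - (\<delta> ^ 2) = 0} = {}" using \<delta>2_nonsquare_K by auto
    then have C: "card {u \<in> K. 1 * u ^ 2 + tr (- (\<delta> ^ 2) / 2) = 0} = 0" unfolding tf by simp
    show ?thesis
      using lin[of 1 1 "- (\<delta> ^ 2) / 2"] unfolding aff_count_linear_one[OF K_simps(2)] C by (simp add: tr_K algebra_simps)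
  qed
  have 7: "int q ^ 3 + 2 * int q ^ 2 + 1 \<in> ?I"
  proof -
    have tf: "tr (- 1 / 2) = - 1" by (rule tr_half) simp
    have "{u \<in> K. 1 * u ^ 2 + - 1 = 0} = {1, - 1}" by (auto simp: power2_eq_1_iff)
    then have C: "card {u \<in> K. 1 * u ^ 2 + tr (- 1 / 2) = 0} = 2" unfolding tf using neq_uminus[of 1] by simp
    show ?thesis
      using lin[of 1 1 "- 1 / 2"] unfolding aff_count_linear_one[OF K_simps(2)] C by (simp add: tr_K algebra_simps)
  qed
  \<comment> \<open>The form x^2 - x0^2 y^2 vanishes on two lines, x = x0 y and x = -x0 y; a nonzero
    \<open>tr x0\<close> prevents both from being shared.\<close>
  have diag: "int q ^ 3 + (if square (1 + x0 ^ 2) then 1 else - 1) * ((if tr f = 0 then int q ^ 2 else 0) - int q) + 1 \<in> ?I"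
    if x0: "x0 \<noteq> 0" "tr x0 \<noteq> 0" "1 + x0 ^ 2 \<noteq> 0" for x0 f
  proof (rule in_intersection_sizesI)
    let ?c = "- (x0 ^ 2)"
    show "hyperbolic_quadric (A0 1 0 ?c f)" using x0 by (intro hyperbolic_example[of 0 1 ?c x0 1]) auto
    have an: "x = 0 \<and> y = 0" if xy: "1 * x ^ 2 + 2 * 0 * x * y + ?c * y ^ 2 = 0" "tr (x * cj y) = 0" for x y
    proof -
      have "x ^ 2 = (x0 * y) ^ 2" using xy by (simp add: power_mult_distrib)
      then have x: "x = x0 * y \<or> x = - (x0 * y)" by (simp only: power2_eq_iff)
      have "tr (x0 * y * cj y) = y * cj y * tr x0"
        using tr_scale[of "y * cj y" x0] by (simp add: mult_ac)
      then have "y = 0" using x xy(2) x0 by auto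
      then show ?thesis using x by auto
    qed
    have c': "?c - 1 / cj 1 = - (1 + x0 ^ 2)" by simp
    have "int (aff_count 1 0 ?c 0 0 f)
        = int q ^ 3 + (if square (1 + x0 ^ 2) then 1 else - 1) * ((if tr f = 0 then int q ^ 2 else 0) - int q)"
      using aff_count_diag[of 1 ?c f] \<epsilon>_one_mult[of "- (1 + x0 ^ 2)"] x0(3)
      unfolding c' square_uminus neg_equal_0_iff_equal by simp
    moreover have "int (total_count 1 0 ?c 0 0 f) = int (aff_count 1 0 ?c 0 0 f) + 1"
      by (rule total_count_eq_aniso) (rule an)
    ultimately show "int (total_count 1 0 ?c 0 0 f) = int q ^ 3
        + (if square (1 + x0 ^ 2) then 1 else - 1) * ((if tr f = 0 then int q ^ 2 else 0) - int q) + 1" by simp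
  qed simp
  have 8: "int q ^ 3 - int q + 1 \<in> ?I"
  proof -
    have "square (1 + 1 ^ 2)" by (rule square_K) simp
    then show ?thesis using diag[of 1 "1 / 2"] by (simp add: t tr_K)
  qed
  obtain m where m: "\<not> square m" "square (m - 1)" using exists_nonsquare_pred by blast
  obtain x0 where ms: "m - 1 = x0 ^ 2" using m(2) by (auto simp: square_def)
  have m': "1 + x0 ^ 2 = m" using ms by (metis add_diff_cancel_left' diff_add_cancel add.commute)
  have x0: "x0 \<noteq> 0" "1 + x0 ^ 2 \<noteq> 0" using ms m m' by auto
  \<comment> \<open>An imaginary \<open>x0\<close> would put \<open>m\<close> into \<open>K\<close>,
    where every element is a square.\<close>
  have "tr x0 \<noteq> 0"
  proof
    assume "tr x0 = 0"
    then have "cj x0 = - x0" by (simp add: tr_def add_eq_0_iff)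
    then have "1 + x0 ^ 2 \<in> K" by (simp add: K_iff)
    then show False using square_K m m' by auto
  qed
  note d = diag[OF x0(1) this x0(2), unfolded m' if_not_P[OF m(1)]]
  have 9: "int q ^ 3 - int q ^ 2 + int q + 1 \<in> ?I" using d[of 0] by (simp add: algebra_simps)
  have 10: "int q ^ 3 + int q + 1 \<in> ?I" using d[of "1 / 2"] by (simp add: t algebra_simps)
  \<comment> \<open>With a = b, c = -b and \<open>b\<close> of norm -1 the residual conic vanishes
    identically. Moreover \<open>\<epsilon> b = - 1\<close>: a root of \<open>b * \<delta>\<close>
    would have a norm whose square is \<open>\<delta> ^ 2\<close>, a nonsquare of
    \<open>K\<close>.\<close>
  have 11: "int q ^ 2 + 1 \<in> ?I"
  proof (rule in_intersection_sizesI)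
    show "hyperbolic_quadric (A0 b 0 (- b) 0)" using b0 by (intro hyperbolic_example[of 0 b "- b" 1 1]) auto
    have an: "x = 0 \<and> y = 0" if xy: "b * x ^ 2 + 2 * 0 * x * y + (- b) * y ^ 2 = 0" "tr (x * cj y) = 0" for x y
    proof -
      have "x ^ 2 = y ^ 2" using xy b0 by simp
      then have x: "x = y \<or> x = - y" by (simp only: power2_eq_iff)
      have "tr (y * cj y) = 2 * (y * cj y)" by (rule tr_K) (rule norm_in_K)
      then have "y = 0" using x xy(2) by auto
      then show ?thesis using x by auto
    qed
    have "- b - 1 / cj b = - (b * cj b + 1) / cj b" using b0 by (simp add: field_simps)
    then have "- b - 1 / cj b = 0" using b by simp
    then have \<alpha>: "- b / 2 - 0 ^ 2 / (2 * b) - 1 / (2 * cj b) = 0"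
      by (metis diff_divide_distrib divide_eq_0_iff power_zero_numeral diff_zero mult.commute divide_divide_eq_left)
    have "\<not> square (b * \<delta>)"
    proof
      assume "square (b * \<delta>)"
      then obtain w where w: "b * \<delta> = w ^ 2" by (auto simp: square_def)
      have "(w * cj w) ^ 2 = w ^ 2 * cj (w ^ 2)" by (simp add: power_mult_distrib)
      also have "\<dots> = (b * cj b) * (- (\<delta> ^ 2))" unfolding w[symmetric] by (simp add: \<delta> power2_eq_square)
      finally show False using b \<delta>2_nonsquare_K[of "w * cj w"] by simp
    qed
    then have \<epsilon>: "\<epsilon> b = - 1" by (simp add: \<epsilon>_def)
    have "int (aff_count b 0 (- b) 0 0 0) = int q ^ 2"
      using aff_count_square[OF b0, of 0 "- b" 0 0 0] unfolding \<alpha> \<epsilon>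
      by (simp add: cardk power2_eq_square power3_eq_cube algebra_simps)
    moreover have "int (total_count b 0 (- b) 0 0 0) = int (aff_count b 0 (- b) 0 0 0) + 1"
      by (rule total_count_eq_aniso) (rule an)
    ultimately show "int (total_count b 0 (- b) 0 0 0) = int q ^ 2 + 1" by simp
  qed (use b0 in simp)
  \<comment> \<open>The form is (x + b y)^2 - \<theta>^2 y^2 with imaginary \<theta> and nonzero
    \<open>b\<close> in \<open>K\<close>; its lines have slopes of trace -2 b and are not shared. To
    fit \<open>aff_count_corank_one\<close>, s^2 = -(1 + \<theta>^2) must be nonzero. For q = 3
    every nonzero imaginary element squares to -1, so this size is set apart there.\<close>
  have 12: "int q ^ 3 - int q ^ 2 + 1 \<in> ?I" if q: "q \<noteq> 3"
  proof -
    have "\<exists>\<theta>. \<theta> \<noteq> 0 \<and> cj \<theta> = - \<theta> \<and> \<theta> ^ 2 \<noteq> - 1"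
    proof (cases "\<delta> ^ 2 = - 1")
      case False then show ?thesis using \<delta> by blast
    next
      case True
      have "card {0, 1, - 1 :: 'k} \<le> 3" by (simp add: card_insert_if)
      then have "card (K - {0, 1, - 1}) > 0"
        using diff_card_le_card_Diff[of "{0, 1, - 1}" K] q q_ge_3 by simp
      then have "K - {0, 1, - 1} \<noteq> {}" by (metis card.empty less_irrefl)
    then obtain \<mu> where \<mu>: "\<mu> \<in> K" "\<mu> \<noteq> 0" "\<mu> \<noteq> 1" "\<mu> \<noteq> - 1" by blast
      have "\<mu> ^ 2 \<noteq> 1" using \<mu> by (simp add: power2_eq_1_iff)
      then have "(\<mu> * \<delta>) ^ 2 \<noteq> - 1" using True by (simp add: power_mult_distrib)
      moreover have "\<mu> * \<delta> \<noteq> 0" "cj (\<mu> * \<delta>) = - (\<mu> * \<delta>)" using \<mu> \<delta> by (simp_all add: K_iff)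
      ultimately show ?thesis by blast
    qed
    then obtain \<theta> where \<theta>: "\<theta> \<noteq> 0" "cj \<theta> = - \<theta>" "\<theta> ^ 2 \<noteq> - 1" by blast
    have "- (1 + \<theta> ^ 2) \<in> K" using \<theta> by (simp add: K_iff)
    then obtain s where s: "- (1 + \<theta> ^ 2) = s ^ 2" using square_K by (auto simp: square_def)
    have s0: "s \<noteq> 0"
    proof
      assume "s = 0"
      then have "- 1 = \<theta> ^ 2" using s by simp
      then show False using \<theta>(3) by simp
    qed
    define b where "b = s * cj s / 2"
    let ?c = "b ^ 2 + 1 + s ^ 2"
    have c: "?c = b ^ 2 - \<theta> ^ 2" unfolding s[symmetric] by simp
    have bK: "b \<in> K" unfolding b_def by (intro K_simps norm_in_K)
    have b2: "b \<noteq> 0" using s0 by (simp add: b_def)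
    obtain f where f: "int (aff_count 1 b ?c 0 0 f) = int q ^ 3 + (- 1) * int q ^ 2"
      using aff_count_corank_one[OF s0 _ b_def, of "- 1"] by auto
    have an: "x = 0 \<and> y = 0" if xy: "1 * x ^ 2 + 2 * b * x * y + ?c * y ^ 2 = 0" "tr (x * cj y) = 0" for x y
    proof -
      have "(x + b * y) ^ 2 = (\<theta> * y) ^ 2" using xy(1) unfolding c by (simp add: power2_eq_square algebra_simps)
      then have "x + b * y = \<theta> * y \<or> x + b * y = - (\<theta> * y)" by (simp only: power2_eq_iff)
      then obtain \<theta>' where \<theta>': "x + b * y = \<theta>' * y" "tr \<theta>' = 0"
        using \<theta> by (metis tr_def add.right_inverse mult_minus_left tr_simps(4) neg_equal_0_iff_equal)
      have x: "x = (\<theta>' - b) * y" using \<theta>'(1) by (simp add: algebra_simps)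
      have "tr (x * cj y) = y * cj y * tr (\<theta>' - b)"
        using tr_scale[of "y * cj y" "\<theta>' - b"] unfolding x by (simp add: mult_ac)
      also have "tr (\<theta>' - b) = - 2 * b" using \<theta>'(2) tr_K[OF bK] by simp
      finally have "y = 0" using xy(2) b2 by simp
      then show ?thesis using x by simp
    qed
    show ?thesis
    proof (rule in_intersection_sizesI)
      show "hyperbolic_quadric (A0 1 b ?c f)"
      proof (rule hyperbolic_example[of b 1 ?c "\<theta> - b" 1])
        show "b ^ 2 \<noteq> 1 * ?c" unfolding c using \<theta>(1) by simp
        show "1 * (\<theta> - b) ^ 2 + 2 * b * (\<theta> - b) * 1 + ?c * 1 ^ 2 = 0"
          unfolding c by (simp add: power2_eq_square algebra_simps)
      qed simp
      have "int (total_count 1 b ?c 0 0 f) = int (aff_count 1 b ?c 0 0 f) + 1"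
        by (rule total_count_eq_aniso) (rule an)
      then show "int (total_count 1 b ?c 0 0 f) = int q ^ 3 - int q ^ 2 + 1" by (simp add: f)
    qed simp
  qed
  show ?thesis
    unfolding hyperbolic_sizes_def cone_sizes_def generic_sizes_def Let_def
    using 1 2 3 4 5 6 7 8 9 10 11 12 by (cases "q = 3") (simp_all add: insert_Diff_if)
qed

end

section \<open>The size sets in the natural numbers\<close>

theorem theorem1:
  fixes q :: nat
  assumes "primepow q" and "odd q" and "CARD('k::{field,finite}) = q ^ 2"
  shows
    "intersection_sizes q (elliptic_quadric :: 'k ^ 4 ^ 4 \<Rightarrow> bool) =
         {q^3 - q^2 + 1, q^3 - q^2 + q + 1, q^3 - q + 1, q^3 + 1, q^3 + q + 1,
          q^3 + q^2 - q + 1, q^3 + q^2 + 1} \<and>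
     (q > 3 \<longrightarrow> intersection_sizes q (one_degenerate_cone :: 'k ^ 4 ^ 4 \<Rightarrow> bool) =
         {q^3 - q^2 + 1, q^3 - q^2 + q + 1, q^3 - q + 1, q^3 + 1, q^3 + q + 1,
          q^3 + q^2 - q + 1, q^3 + q^2 + 1,
          q^3 + 2 * q^2 - q + 1}) \<and>
     intersection_sizes q (hyperbolic_quadric :: 'k ^ 4 ^ 4 \<Rightarrow> bool) \<subseteq>
         {q^2 + 1, q^3 - q^2 + 1, q^3 - q^2 + q + 1, q^3 - q + 1, q^3 + 1, q^3 + q + 1,
          q^3 + q^2 - q + 1, q^3 + q^2 + 1,
          q^3 + 2 * q^2 - q + 1, q^3 + 2 * q^2 + 1, q^3 + 3 * q^2 - q + 1, 2 * q^3 + q^2 + 1} \<and>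
     {q^2 + 1, q^3 - q^2 + 1, q^3 - q^2 + q + 1, q^3 - q + 1, q^3 + 1, q^3 + q + 1,
          q^3 + q^2 - q + 1, q^3 + q^2 + 1,
          q^3 + 2 * q^2 - q + 1, q^3 + 2 * q^2 + 1, q^3 + 3 * q^2 - q + 1, 2 * q^3 + q^2 + 1}
       - (if q = 3 then {q^3 - q^2 + 1} else {})
         \<subseteq> intersection_sizes q (hyperbolic_quadric :: 'k ^ 4 ^ 4 \<Rightarrow> bool)"
    (is "?E = ?e \<and> (_ \<longrightarrow> ?C = ?c) \<and> ?H \<subseteq> ?h \<and> ?h - ?x \<subseteq> ?H")
proof -
  interpret hermitian_field q "TYPE('k)" using assms by unfold_locales
  \<comment> \<open>These inequalities make the truncated subtractions of the statement agree with
    subtraction of integers.\<close>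
  have le: "q ^ 2 \<le> q ^ 3" "q \<le> q ^ 3" "q \<le> q ^ 3 + q ^ 2" "q \<le> q ^ 3 + 2 * q ^ 2" "q \<le> q ^ 3 + 3 * q ^ 2"
    using q_ge_3 power_increasing[of 2 3 q] self_le_power[of q 3] by (simp_all add: trans_le_add1)
  have n: "int (q^3 - q^2 + 1) = int q ^ 3 - int q ^ 2 + 1" "int (q^3 - q^2 + q + 1) = int q ^ 3 - int q ^ 2 + int q + 1"
    "int (q^3 - q + 1) = int q ^ 3 - int q + 1" "int (q^3 + 1) = int q ^ 3 + 1" "int (q^3 + q + 1) = int q ^ 3 + int q + 1"
    "int (q^3 + q^2 - q + 1) = int q ^ 3 + int q ^ 2 - int q + 1" "int (q^3 + q^2 + 1) = int q ^ 3 + int q ^ 2 + 1"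
    "int (q^3 + 2 * q^2 - q + 1) = int q ^ 3 + 2 * int q ^ 2 - int q + 1" "int (q^2 + 1) = int q ^ 2 + 1"
    "int (q^3 + 2 * q^2 + 1) = int q ^ 3 + 2 * int q ^ 2 + 1"
    "int (q^3 + 3 * q^2 - q + 1) = int q ^ 3 + 3 * int q ^ 2 - int q + 1"
    "int (2 * q^3 + q^2 + 1) = 2 * int q ^ 3 + int q ^ 2 + 1"
    using le by (simp_all add: of_nat_diff)
  have e: "int ` ?e = generic_sizes"
    unfolding sizes_defs image_insert image_empty n by blast
  have c: "int ` ?c = cone_sizes"
    unfolding sizes_defs image_insert image_empty n by blast
  have h: "int ` ?h = hyperbolic_sizes"
    unfolding sizes_defs image_insert image_empty n by blast
  have x: "int ` ?x = (if q = 3 then {int q ^ 3 - int q ^ 2 + 1} else {})"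
    unfolding n(1)[symmetric] by simp
  have inj: "A \<subseteq> B" if "int ` A \<subseteq> int ` B" for A B
    using that by (simp add: inj_image_subset_iff)
  have "int ` ?E \<subseteq> int ` ?e" "int ` ?C \<subseteq> int ` ?c" "int ` ?H \<subseteq> int ` ?h"
    unfolding e c h intersection_sizes_def using size_tangent_pair by auto
  moreover have "int ` ?e \<subseteq> int ` ?E" unfolding e by (rule elliptic_sizes_attained)
  moreover have "q > 3 \<longrightarrow> int ` ?c \<subseteq> int ` ?C" unfolding c using cone_sizes_attained by blast
  moreover have "int ` (?h - ?x) \<subseteq> int ` ?H"
    unfolding image_set_diff[OF inj_of_nat] h x by (rule hyperbolic_sizes_attained)
  ultimately have "?E \<subseteq> ?e" "?e \<subseteq> ?E" "?C \<subseteq> ?c" "q > 3 \<longrightarrow> ?c \<subseteq> ?C" "?H \<subseteq> ?h" "?h - ?x \<subseteq> ?H"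
    by (blast intro!: inj)+
  then show ?thesis by (intro conjI impI subset_antisym) blast+
qed

end
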